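(* Let $N\ge 3$ and assume $[A]$, $[V]$, $[K]$ (see context). Assume there are $R_1,R_2>0$, $\alpha_0,\alpha_\infty\in\mathbb{R}$, $\beta_0,\beta_\infty\in[0,1]$ such that $$\operatorname*{ess\,sup}_{|x|<R_1}\frac{K(|x|)}{|x|^{\alpha_0}V(|x|)^{\beta_0}}<+\infty,\qquad \operatorname*{ess\,sup}_{|x|\ge R_2}\frac{K(|x|)}{|x|^{\alpha_\infty}V(|x|)^{\beta_\infty}}<+\infty .$$ Then, for all $q_1,q_2$ such that $$q_1\in\mathcal{I}_1=\big(\max\{1,2\beta_0\},\,q^*(a_0,\alpha_0,\beta_0)\big),\qquad q_2\in\mathcal{I}_2=\big(\max\{1,2\beta_\infty,q^*(a_\infty,\alpha_\infty,\beta_\infty)\},+\infty\big),$$ the embedding $$X\hookrightarrow L^{q_1}_K(\mathbb{R}^N)+L^{q_2}_K(\mathbb{R}^N)$$ is continuous and compact.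
   Context: Hypotheses on the potentials. $[A]$: $A:(0,+\infty)\to(0,+\infty)$ is continuous and there are real numbers $2-N<a_0,a_\infty\le 2$ and $c_0,c_\infty>0$ with $$c_0\le\liminf_{r\to0^+}\frac{A(r)}{r^{a_0}}\le\limsup_{r\to0^+}\frac{A(r)}{r^{a_0}}<+\infty,\qquad c_\infty\le\liminf_{r\to+\infty}\frac{A(r)}{r^{a_\infty}}\le\limsup_{r\to+\infty}\frac{A(r)}{r^{a_\infty}}<+\infty.$$ $[V]$: $V:(0,+\infty)\to[0,+\infty)$ belongs to $L^1_{loc}(0,+\infty)$. $[K]$: $K:(0,+\infty)\to(0,+\infty)$ belongs to $L^s_{loc}(0,+\infty)$ for some $s>\max\{\frac{2N}{N-a_0+2},\frac{2N}{N-a_\infty+2}\}$. Function spaces. For $q>1$, $L^q_K=L^q(\mathbb{R}^N,K(|x|)dx)$. For $q_1,q_2>1$, $L^{q_1}_K+L^{q_2}_K=\{u=u_1+u_2: u_i\in L^{q_i}_K\}$ with norm $\inf\{\max\{\|u_1\|_{L^{q_1}_K},\|u_2\|_{L^{q_2}_K}\}: u=u_1+u_2,\ u_i\in L^{q_i}_K\}$; $L^{p}+L^{q}$ is the case $K\equiv1$. $p_0=\frac{2N}{N+a_0-2}$, $p_\infty=\frac{2N}{N+a_\infty-2}$. $S_A$ is the set of radial $u\in C_c^\infty(\mathbb{R}^N)$ with $\|u\|_A=(\int_{\mathbb{R}^N}A(|x|)|\nabla u|^2dx)^{1/2}<\infty$. $D_A$ is the space of $u\in L^{p_0}+L^{p_\infty}$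 for which there is a sequence $\{u_n\}\subset S_A$ that converges to $u$ in $L^{p_0}+L^{p_\infty}$ and is Cauchy with respect to $\|\cdot\|_A$; each $u\in D_A$ has a weak gradient in $L^2_{loc}(\mathbb{R}^N\setminus\{0\})$, and $\|u\|_A$ is defined on $D_A$ by the same formula. $X=\{u\in D_A:\int_{\mathbb{R}^N}V(|x|)|u|^2dx<\infty\}$, a Hilbert space with norm $\|u\|^2=\int_{\mathbb{R}^N}A(|x|)|\nabla u|^2dx+\int_{\mathbb{R}^N}V(|x|)|u|^2dx$. For $\alpha\in\mathbb{R}$, $\beta\in[0,1]$, $a\in(2-N,2]$: $q^*(a,\alpha,\beta)=2\,\frac{\alpha-2\beta+N+a\beta}{N+a-2}$. Conventions: $V^0\equiv1$; for $\beta>0$ the quotient $K/(|x|^\alpha V^\beta)$ is $+\infty$ where $V=0$. *)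

theory Defs
  imports "HOL-Analysis.Analysis" "HOL-Probability.Essential_Supremum"
begin

text \<open>
  Euclidean space of dimension \<open>N\<close> is a type \<open>'a :: euclidean_space\<close> with \<open>N = DIM('a)\<close>.
  Elements of function spaces are functions rather than classes modulo a.e. equality; apart
  from the spaces of smooth functions, the spaces below are closed under a.e. modification, and
  their norms (then seminorms) are invariant under it. The potentials \<open>A\<close>, \<open>V\<close>, \<open>K\<close> are total functions of which only the values on
  \<open>{0<..}\<close> matter: \<open>norm x = 0\<close> only on a null set.
\<close>

subsection \<open>Locally integrable functions\<close>

definition Lp_loc ::
  "real \<Rightarrow> 'a::euclidean_space set \<Rightarrow> ('a \<Rightarrow> 'b::euclidean_space) \<Rightarrow> bool" where
  "Lp_loc p \<Omega> f \<longleftrightarrow> f \<in> borel_measurable (lebesgue_on \<Omega>) \<and>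
     (\<forall>C. compact C \<and> C \<subseteq> \<Omega> \<longrightarrow> set_integrable lebesgue C (\<lambda>x. norm (f x) powr p))"

subsection \<open>Hypotheses on the potentials\<close>

definition hyp_A :: "nat \<Rightarrow> (real \<Rightarrow> real) \<Rightarrow> real \<Rightarrow> real \<Rightarrow> bool" where
  "hyp_A N A a0 ainf \<longleftrightarrow>
     continuous_on {0<..} A \<and> (\<forall>r>0. 0 < A r) \<and>
     2 - real N < a0 \<and> a0 \<le> 2 \<and> 2 - real N < ainf \<and> ainf \<le> 2 \<and>
     (\<exists>c0>0. \<exists>cinf>0.
        ereal c0 \<le> Liminf (at_right 0) (\<lambda>r. ereal (A r / r powr a0)) \<and>
        Limsup (at_right 0) (\<lambda>r. ereal (A r / r powr a0)) < \<infinity> \<and>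
        ereal cinf \<le> Liminf at_top (\<lambda>r. ereal (A r / r powr ainf)) \<and>
        Limsup at_top (\<lambda>r. ereal (A r / r powr ainf)) < \<infinity>)"

definition hyp_V :: "(real \<Rightarrow> real) \<Rightarrow> bool" where
  "hyp_V V \<longleftrightarrow> (\<forall>r>0. 0 \<le> V r) \<and> Lp_loc 1 {0<..} V"

definition hyp_K :: "nat \<Rightarrow> real \<Rightarrow> real \<Rightarrow> (real \<Rightarrow> real) \<Rightarrow> bool" where
  "hyp_K N a0 ainf K \<longleftrightarrow> (\<forall>r>0. 0 < K r) \<and>
     (\<exists>s > max (2 * real N / (real N - a0 + 2)) (2 * real N / (real N - ainf + 2)).
        Lp_loc s {0<..} K)"

text \<open>
  The quotient \<open>K(r) / (r\<^sup>\<alpha> V(r)\<^sup>\<beta>)\<close> as an extended nonnegative real. The case \<open>\<beta> = 0\<close> is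
  singled out because \<open>0 powr 0 = 0\<close>, whereas here \<open>V\<^sup>0 = 1\<close> also where \<open>V\<close> vanishes. For
  \<open>\<beta> > 0\<close>, \<open>r > 0\<close>, \<open>K r > 0\<close> and \<open>V r = 0\<close>, division by zero in \<open>ennreal\<close> gives \<open>\<infinity>\<close>.
\<close>

definition quotient_KV ::
  "(real \<Rightarrow> real) \<Rightarrow> (real \<Rightarrow> real) \<Rightarrow> real \<Rightarrow> real \<Rightarrow> real \<Rightarrow> ennreal" where
  "quotient_KV K V \<alpha> \<beta> r =
     ennreal (K r) / ennreal (r powr \<alpha> * (if \<beta> = 0 then 1 else V r powr \<beta>))"

subsection \<open>Weighted Lebesgue spaces and their sums\<close>

definition Lq :: "(real \<Rightarrow> real) \<Rightarrow> real \<Rightarrow> ('a::euclidean_space \<Rightarrow> real) set" where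
  "Lq K q = {u \<in> borel_measurable lebesgue.
     integrable lebesgue (\<lambda>x. K (norm x) * \<bar>u x\<bar> powr q)}"

definition Lq_norm :: "(real \<Rightarrow> real) \<Rightarrow> real \<Rightarrow> ('a::euclidean_space \<Rightarrow> real) \<Rightarrow> real" where
  "Lq_norm K q u = (LINT x|lebesgue. K (norm x) * \<bar>u x\<bar> powr q) powr (1 / q)"

definition Lsum :: "(real \<Rightarrow> real) \<Rightarrow> real \<Rightarrow> real \<Rightarrow> ('a::euclidean_space \<Rightarrow> real) set" where
  "Lsum K q1 q2 = {u. \<exists>u1 \<in> Lq K q1. \<exists>u2 \<in> Lq K q2. u = (\<lambda>x. u1 x + u2 x)}"

definition Lsum_norm ::
  "(real \<Rightarrow> real) \<Rightarrow> real \<Rightarrow> real \<Rightarrow> ('a::euclidean_space \<Rightarrow> real) \<Rightarrow> real" where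
  "Lsum_norm K q1 q2 u = Inf {max (Lq_norm K q1 u1) (Lq_norm K q2 u2) | u1 u2.
     u1 \<in> Lq K q1 \<and> u2 \<in> Lq K q2 \<and> u = (\<lambda>x. u1 x + u2 x)}"

subsection \<open>Smooth functions and gradients\<close>

definition grad :: "('a::euclidean_space \<Rightarrow> real) \<Rightarrow> 'a \<Rightarrow> 'a" where
  "grad u x = (SOME D. GDERIV u x :> D)"

primrec Ck :: "nat \<Rightarrow> ('a::euclidean_space \<Rightarrow> real) \<Rightarrow> bool" where
  "Ck 0 u \<longleftrightarrow> continuous_on UNIV u"
| "Ck (Suc k) u \<longleftrightarrow> (\<forall>x. u differentiable (at x)) \<and> (\<forall>b\<in>Basis. Ck k (\<lambda>x. grad u x \<bullet> b))"

definition Cc_infinity :: "'a::euclidean_space set \<Rightarrow> ('a \<Rightarrow> real) set" where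
  "Cc_infinity \<Omega> =
     {u. (\<forall>k. Ck k u) \<and> compact (closure {x. u x \<noteq> 0}) \<and> closure {x. u x \<noteq> 0} \<subseteq> \<Omega>}"

definition radial :: "('a::euclidean_space \<Rightarrow> real) \<Rightarrow> bool" where
  "radial u \<longleftrightarrow> (\<forall>x y. norm x = norm y \<longrightarrow> u x = u y)"

text \<open>Integration by parts is stated as an identity between vector-valued integrals.\<close>

definition is_weak_grad ::
  "'a::euclidean_space set \<Rightarrow> ('a \<Rightarrow> real) \<Rightarrow> ('a \<Rightarrow> 'a) \<Rightarrow> bool" where
  "is_weak_grad \<Omega> u g \<longleftrightarrow> Lp_loc 1 \<Omega> u \<and> Lp_loc 1 \<Omega> g \<and>
     (\<forall>\<phi> \<in> Cc_infinity \<Omega>.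
        (LINT x:\<Omega>|lebesgue. u x *\<^sub>R grad \<phi> x) = - (LINT x:\<Omega>|lebesgue. \<phi> x *\<^sub>R g x))"

text \<open>The weak gradient away from the origin, unique up to null sets when it exists.\<close>

definition wgrad :: "('a::euclidean_space \<Rightarrow> real) \<Rightarrow> 'a \<Rightarrow> 'a" where
  "wgrad u = (SOME g. is_weak_grad (- {0}) u g)"

subsection \<open>The energy spaces\<close>

definition A_energy :: "(real \<Rightarrow> real) \<Rightarrow> ('a::euclidean_space \<Rightarrow> 'a) \<Rightarrow> real" where
  "A_energy A g = (LINT x|lebesgue. A (norm x) * (norm (g x))\<^sup>2)"

definition S_space :: "(real \<Rightarrow> real) \<Rightarrow> ('a::euclidean_space \<Rightarrow> real) set" where
  "S_space A = {u \<in> Cc_infinity UNIV. radial u \<and>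
     integrable lebesgue (\<lambda>x. A (norm x) * (norm (grad u x))\<^sup>2)}"

definition S_norm :: "(real \<Rightarrow> real) \<Rightarrow> ('a::euclidean_space \<Rightarrow> real) \<Rightarrow> real" where
  "S_norm A u = sqrt (A_energy A (grad u))"

definition p_exp :: "nat \<Rightarrow> real \<Rightarrow> real" where
  "p_exp N a = 2 * real N / (real N + a - 2)"

definition D_space ::
  "(real \<Rightarrow> real) \<Rightarrow> real \<Rightarrow> real \<Rightarrow> ('a::euclidean_space \<Rightarrow> real) set" where
  "D_space A a0 ainf =
     (let p0 = p_exp DIM('a) a0; pinf = p_exp DIM('a) ainf in
      {u \<in> Lsum (\<lambda>_. 1) p0 pinf.
         \<exists>w. (\<forall>n. w n \<in> S_space A) \<and>
             (\<lambda>n. Lsum_norm (\<lambda>_. 1) p0 pinf (\<lambda>x. w n x - u x)) \<longlonglongrightarrow> 0 \<and>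
             (\<forall>e>0. \<exists>M::nat. \<forall>m\<ge>M. \<forall>n\<ge>M. S_norm A (\<lambda>x. w m x - w n x) < e)})"

definition X_space ::
  "(real \<Rightarrow> real) \<Rightarrow> (real \<Rightarrow> real) \<Rightarrow> real \<Rightarrow> real \<Rightarrow> ('a::euclidean_space \<Rightarrow> real) set" where
  "X_space A V a0 ainf =
     {u \<in> D_space A a0 ainf. integrable lebesgue (\<lambda>x. V (norm x) * \<bar>u x\<bar>\<^sup>2)}"

definition X_norm ::
  "(real \<Rightarrow> real) \<Rightarrow> (real \<Rightarrow> real) \<Rightarrow> ('a::euclidean_space \<Rightarrow> real) \<Rightarrow> real" where
  "X_norm A V u = sqrt (A_energy A (wgrad u) + (LINT x|lebesgue. V (norm x) * \<bar>u x\<bar>\<^sup>2))"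

definition q_star :: "nat \<Rightarrow> real \<Rightarrow> real \<Rightarrow> real \<Rightarrow> real" where
  "q_star N a \<alpha> \<beta> = 2 * ((\<alpha> - 2 * \<beta> + real N + a * \<beta>) / (real N + a - 2))"

subsection \<open>Continuous and compact embeddings\<close>

definition continuous_embedding ::
  "('a \<Rightarrow> real) set \<Rightarrow> (('a \<Rightarrow> real) \<Rightarrow> real) \<Rightarrow>
   ('a \<Rightarrow> real) set \<Rightarrow> (('a \<Rightarrow> real) \<Rightarrow> real) \<Rightarrow> bool" where
  "continuous_embedding X nX Y nY \<longleftrightarrow> X \<subseteq> Y \<and> (\<exists>C. \<forall>u\<in>X. nY u \<le> C * nX u)"

definition compact_embedding ::
  "('a \<Rightarrow> real) set \<Rightarrow> (('a \<Rightarrow> real) \<Rightarrow> real) \<Rightarrow>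
   ('a \<Rightarrow> real) set \<Rightarrow> (('a \<Rightarrow> real) \<Rightarrow> real) \<Rightarrow> bool" where
  "compact_embedding X nX Y nY \<longleftrightarrow> X \<subseteq> Y \<and>
     (\<forall>u :: nat \<Rightarrow> 'a \<Rightarrow> real. (\<forall>n. u n \<in> X) \<and> (\<exists>M. \<forall>n. nX (u n) \<le> M) \<longrightarrow>
        (\<exists>r v. strict_mono (r :: nat \<Rightarrow> nat) \<and> v \<in> Y \<and>
               (\<lambda>n. nY (\<lambda>x. u (r n) x - v x)) \<longlonglongrightarrow> 0))"

end

theory Submission
  imports Defs "HOL-Complex_Analysis.Great_Picard"
begin

text \<open>
  Let \<open>I(r, s)\<close> be the integral of \<open>1 / (A t\<^sup>N\<^sup>-\<^sup>1)\<close> over \<open>[r, s]\<close>. By polar coordinates and Young's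
  inequality, a radial \<open>u(x) = f(|x|)\<close> of finite energy satisfies
  \<open>|f(r) - f(s)| \<le> c \<parallel>u\<parallel>\<^sub>A I(r, s)\<^sup>1\<^sup>/\<^sup>2\<close>. This passes to limits in \<open>D\<^sub>A\<close>; that \<open>\<parallel>u\<parallel>\<^sub>A\<close> there is the
  norm of the chosen weak gradient uses uniqueness of weak gradients. Hence, for \<open>u\<close> bounded
  in \<open>X\<close>, the profiles are equicontinuous on compact subsets of \<open>(0, \<infinity>)\<close> and decay like
  \<open>r\<close> to the power \<open>-(N + a - 2) / 2\<close>, with \<open>a = a\<^sub>0\<close> near \<open>0\<close> and \<open>a = a\<^sub>\<infinity>\<close> near \<open>\<infinity>\<close>.
  Interpolating \<open>K \<le> M |x|\<^sup>\<alpha> V\<^sup>\<beta>\<close> against the bound on the integral of \<open>V u\<^sup>2\<close> gives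
  \<open>K |u|\<^sup>q \<le> C |x|\<^sup>\<delta> (V u\<^sup>2 + |x|\<^sup>\<delta>\<^sup>-\<^sup>N)\<close>, where \<open>\<delta>\<close> has the sign of \<open>q\<^sup>* - q\<close>; so the integrals near \<open>0\<close>
  and near \<open>\<infinity>\<close> are uniformly small. On annuli a subsequence converges pointwise and is dominated.
\<close>

subsection \<open>Radial integration\<close>

text \<open>The energy on \<open>X_space\<close> is defined through \<open>wgrad\<close>, an
  arbitrary choice of weak gradient, and is tied to the profile in one place: the gradients of the
  approximating test functions converge in the weighted square-integrable sense to some
  \<open>G\<close>, \<open>G\<close> is a weak gradient of \<open>u\<close>, and so the energy of
  \<open>u\<close> is that of \<open>G\<close>. From then on the energy is replaced by
  \<open>profile_bound\<close>, which passes to pointwise limits. Hence no weak compactness is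
  called for: a diagonal selection on the rationals produces the limit, which must lie in the sum
  space, as \<open>compact_embedding\<close> asks, and is not shown to lie in
  \<open>X_space\<close>. All estimates are homogeneous, so they are stated for normalised functions
  (\<open>admissible\<close>), with constants chosen before the function. The sum norm is estimated
  by a single decomposition, the cut at the sphere of radius \<open>R1\<close>. The exterior
  hypothesis on \<open>K\<close> starts at \<open>R2\<close>; if \<open>R1 < R2\<close>, the shell
  between is handled like any annulus.\<close>

abbreviation (input) sphere_area :: "nat \<Rightarrow> real" where
  "sphere_area N \<equiv> real N * unit_ball_vol (real N)"

text \<open>The area of the sphere of radius \<open>t\<close>, extended by zero so that it is a
  density on the whole line.\<close>

definition sphere_weight :: "nat \<Rightarrow> real \<Rightarrow> real" where
  "sphere_weight N t = (if 0 < t then sphere_area N * t ^ (N - 1) else 0)"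

lemma sphere_weight_measurable [measurable]: "sphere_weight N \<in> borel_measurable borel"
  unfolding sphere_weight_def by measurable

lemma sphere_weight_nonneg: "0 \<le> sphere_weight N t"
  by (simp add: sphere_weight_def)

lemma emeasure_sphere_weight:
  assumes "N > 0" "0 \<le> a" "a \<le> b"
  shows "emeasure (density lborel (\<lambda>t. ennreal (sphere_weight N t))) {a<..b}
    = ennreal (unit_ball_vol N * b ^ N - unit_ball_vol N * a ^ N)"
proof -
  have "emeasure (density lborel (\<lambda>t. ennreal (sphere_weight N t))) {a<..b}
      = (\<integral>\<^sup>+ t. ennreal (sphere_weight N t) * indicator {a<..b} t \<partial>lborel)"
    by (subst emeasure_density) auto
  also have "\<dots> = (\<integral>\<^sup>+ t. ennreal (sphere_area N * t ^ (N - 1)) * indicator {a..b} t \<partial>lborel)"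
    using AE_lborel_singleton[of a]
    by (intro nn_integral_cong_AE, eventually_elim)
       (use assms in \<open>auto simp: sphere_weight_def indicator_def\<close>)
  also have "\<dots> = ennreal (unit_ball_vol N * b ^ N - unit_ball_vol N * a ^ N)"
    using assms
    by (intro nn_integral_FTC_Icc) (auto intro!: derivative_eq_intros)
  finally show ?thesis .
qed

text \<open>Polar coordinates for radial functions, as a push-forward of measures. Both sides agree
  on half-open intervals by the volume formula for balls, and these intervals form an
  intersection-stable generator of the Borel sets.\<close>

lemma distr_norm_lborel:
  "distr lborel borel (norm :: 'a::euclidean_space \<Rightarrow> real) =
     density lborel (\<lambda>t. ennreal (sphere_weight DIM('a) t))" (is "?M = ?D")
proof -
  let ?v = "unit_ball_vol (real DIM('a))"
  have pre: "norm -` {a<..b} = (cball 0 b - cball 0 a :: 'a set)" for a b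
    by auto
  have M: "emeasure ?M {a<..b} = ennreal (?v * b ^ DIM('a) - ?v * a ^ DIM('a))"
    if "0 \<le> a" "a \<le> b" for a b
  proof -
    have "emeasure ?M {a<..b} = emeasure lborel (cball 0 b - cball 0 a :: 'a set)"
      by (subst emeasure_distr) (auto simp: pre)
    also have "\<dots> = emeasure lborel (cball 0 b :: 'a set) - emeasure lborel (cball 0 a :: 'a set)"
      using that emeasure_lborel_cball_finite[of "0::'a" a] by (intro emeasure_Diff) auto
    also have "\<dots> = ennreal (?v * b ^ DIM('a) - ?v * a ^ DIM('a))"
      using that by (simp add: emeasure_cball ennreal_minus)
    finally show ?thesis .
  qed
  let ?E = "range (\<lambda>(a, b). {a <.. b::real})"
  have eq: "emeasure ?M {a<..b} = emeasure ?D {a<..b}" for a b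
  proof -
    have negM: "emeasure ?M {..0} = 0"
    proof -
      have "norm -` {..0} = {0 :: 'a}" by auto
      thus ?thesis by (subst emeasure_distr) auto
    qed
    have negD: "emeasure ?D {..0} = 0"
      by (subst emeasure_density) (auto simp: sphere_weight_def indicator_def nn_integral_0_iff_AE)
    show ?thesis
    proof (cases "a < b")
      case True
      \<comment> \<open>Both measures vanish on \<open>{..0}\<close>, whose preimage under the norm
        is the origin. An arbitrary interval may therefore be cut at 0, and the ball formula applies
        to the rest.\<close>
      have "emeasure N {a<..b} = emeasure N {max 0 a <..max 0 b}"
        if "emeasure N {..0} = 0" "sets N = sets borel" for N
      proof -
        have "emeasure N {a<..b} = emeasure N ({a<..b} - {..0})"
          using that by (intro emeasure_Diff_null_set[symmetric]) (auto simp: null_sets_def)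
        also have "{a<..b} - {..0} = {max 0 a <..max 0 b}" by auto
        finally show ?thesis .
      qed
      from this[OF negM] this[OF negD] show ?thesis
        using M[of "max 0 a" "max 0 b"] True emeasure_sphere_weight[of "DIM('a)" "max 0 a" "max 0 b"]
        by auto
    qed auto
  qed
  show ?thesis
  proof (rule measure_eqI_generator_eq[where E = "?E" and \<Omega> = UNIV and A = "\<lambda>n. {- real n <.. real n}"])
    show "Int_stable ?E"
      unfolding Int_stable_def
    proof (intro ballI, elim imageE)
      fix X Y p q assume "X = (case p of (a, b) \<Rightarrow> {a<..b::real})" "Y = (case q of (a, b) \<Rightarrow> {a<..b::real})"
      then have "X \<inter> Y = (\<lambda>(a, b). {a<..b}) (max (fst p) (fst q), min (snd p) (snd q))"
        by (simp add: split_beta)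
      then show "X \<inter> Y \<in> ?E" by (rule range_eqI)
    qed
    show "sets ?M = sigma_sets UNIV ?E" "sets ?D = sigma_sets UNIV ?E"
      by (simp_all add: borel_sigma_sets_Ioc)
    show "(\<Union>i. {- real i<..real i}) = UNIV"
    proof (intro set_eqI iffI UNIV_I)
      fix x :: real
      obtain n where "\<bar>x\<bar> < real n" using reals_Archimedean2 by blast
      then show "x \<in> (\<Union>i. {- real i<..real i})" by (intro UN_I[of n]) auto
    qed
    show "emeasure ?M {- real i<..real i} \<noteq> \<infinity>" for i
    proof -
      have "emeasure ?M {- real i<..real i} \<le> emeasure lborel (cball 0 (real i) :: 'a set)"
        by (subst emeasure_distr) (auto intro!: emeasure_mono)
      also have "\<dots> < \<infinity>" using emeasure_lborel_cball_finite[of "0::'a" "real i"] by (simp add: less_top[symmetric])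
      finally show ?thesis by simp
    qed
    show "emeasure ?M X = emeasure ?D X" if "X \<in> ?E" for X
      using that eq by (elim imageE) (simp only: split_beta)
  qed auto
qed

lemma nn_integral_norm:
  fixes f :: "real \<Rightarrow> ennreal"
  assumes [measurable]: "f \<in> borel_measurable borel"
  shows "(\<integral>\<^sup>+ x. f (norm (x::'a::euclidean_space)) \<partial>lborel)
    = (\<integral>\<^sup>+ t. ennreal (sphere_weight DIM('a) t) * f t \<partial>lborel)"
proof -
  have "(\<integral>\<^sup>+ x. f (norm (x::'a)) \<partial>lborel) = (\<integral>\<^sup>+ t. f t \<partial>distr lborel borel (norm :: 'a \<Rightarrow> real))"
    by (subst nn_integral_distr) auto
  also have "\<dots> = (\<integral>\<^sup>+ t. ennreal (sphere_weight DIM('a) t) * f t \<partial>lborel)"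
    by (subst distr_norm_lborel, subst nn_integral_density) auto
  finally show ?thesis .
qed

text \<open>In polar coordinates the distribution of the norm has a density, so a null set of radii
  has a null preimage. The premise is restricted to positive radii because the potentials are
  constrained only there; radius 0 contributes the origin alone.\<close>

lemma AE_norm:
  assumes "AE t in lborel. 0 < t \<longrightarrow> P t"
  shows "AE x in lborel. P (norm (x::'a::euclidean_space))"
proof -
  obtain S where S0: "{t \<in> space lborel. \<not> (0 < t \<longrightarrow> P t)} \<subseteq> S" "emeasure lborel S = 0" "S \<in> sets lborel"
    by (rule AE_E[OF assms])
  then have S: "{t. \<not> (0 < t \<longrightarrow> P t)} \<subseteq> S" "S \<in> sets borel" "emeasure lborel S = 0" by simp_all
  have "(\<integral>\<^sup>+ x. indicator (S \<union> {0}) (norm (x::'a)) \<partial>lborel)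
      = (\<integral>\<^sup>+ t. ennreal (sphere_weight DIM('a) t) * indicator (S \<union> {0}) t \<partial>lborel)"
    using S(2) by (intro nn_integral_norm) auto
  also have "\<dots> = (\<integral>\<^sup>+ t. 0 \<partial>(lborel :: real measure))"
  proof (rule nn_integral_cong_AE)
    have "AE t in lborel. t \<notin> S" using S by (intro AE_not_in) (auto simp: null_sets_def)
    then show "AE t in lborel. ennreal (sphere_weight DIM('a) t) * indicator (S \<union> {0}) t = 0"
      by eventually_elim (simp add: sphere_weight_def)
  qed
  finally have "(\<integral>\<^sup>+ x. indicator (S \<union> {0}) (norm (x::'a)) \<partial>lborel) = 0" by simp
  then have "AE x in lborel. indicator (S \<union> {0}) (norm (x::'a)) = (0::ennreal)"
    using S(2) by (subst (asm) nn_integral_0_iff_AE) auto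
  then show ?thesis
  proof eventually_elim
    case (elim x)
    then have "norm x \<notin> S" "norm x \<noteq> 0" by (auto simp: indicator_def split: if_splits)
    with subsetD[OF S(1), of "norm x"] show ?case by auto
  qed
qed

lemma borel_modification:
  fixes f :: "real \<Rightarrow> real"
  assumes "f \<in> borel_measurable (lebesgue_on {0<..})"
  obtains g where "g \<in> borel_measurable borel" "AE t in lborel. 0 < t \<longrightarrow> f t = g t"
proof -
  have "(\<lambda>t. if t \<in> {0<..} then f t else 0) \<in> borel_measurable lebesgue"
    by (rule borel_measurable_if_I[OF assms]) auto
  from completion_ex_borel_measurable_real[OF this]
  obtain g where "g \<in> borel_measurable lborel" "AE t in lborel. (if t \<in> {0<..} then f t else 0) = g t"
    by auto
  then show ?thesis
    by (intro that[of g]) (auto elim: eventually_mono split: if_splits)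
qed

lemma borel_modification_norm:
  fixes f :: "real \<Rightarrow> real"
  assumes "f \<in> borel_measurable (lebesgue_on {0<..})"
  obtains g where "g \<in> borel_measurable borel" "AE t in lborel. 0 < t \<longrightarrow> f t = g t"
    "AE x in lborel. f (norm (x::'a::euclidean_space)) = g (norm x)"
proof -
  obtain g where g: "g \<in> borel_measurable borel" "AE t in lborel. 0 < t \<longrightarrow> f t = g t"
    using borel_modification[OF assms] by blast
  from that[OF this AE_norm[OF g(2)]] show ?thesis .
qed

text \<open>A Lebesgue measurable function composed with a Borel map need not be measurable in
  general. Here a Borel modification composes well, and \<open>AE_norm\<close> shows that the
  exceptional radii pull back to a null set.\<close>

lemma measurable_norm_comp:
  fixes f :: "real \<Rightarrow> real"
  assumes "f \<in> borel_measurable (lebesgue_on {0<..})"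
  shows "(\<lambda>x::'a::euclidean_space. f (norm x)) \<in> borel_measurable lebesgue"
proof -
  obtain g where g: "g \<in> borel_measurable borel" "AE x in lborel. f (norm (x::'a)) = g (norm x)"
    using borel_modification_norm[OF assms] by blast
  have "(\<lambda>x::'a. g (norm x)) \<in> borel_measurable lebesgue"
    using g(1) by (intro measurable_completion) auto
  moreover have "AE x in lebesgue. g (norm (x::'a)) = f (norm x)"
    using AE_completion[OF g(2)] by (simp add: eq_commute)
  ultimately show ?thesis
    by (rule borel_measurable_AE)
qed

subsection \<open>Test functions\<close>

text \<open>The power in the denominator makes the family closed under differentiation up to linear
  combinations: the derivative of the member \<open>m\<close> involves only the members
  \<open>m + 1\<close> and \<open>m + 2\<close>.\<close>

definition flat_exp :: "nat \<Rightarrow> real \<Rightarrow> real" where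
  "flat_exp m t = (if 0 < t then exp (- 1 / t) / t ^ m else 0)"

lemma flat_exp_tendsto_0: "(flat_exp m \<longlongrightarrow> 0) (at 0)"
proof -
  have "(flat_exp m \<longlongrightarrow> 0) (at_left 0)"
    by (rule tendsto_eventually) (auto simp: flat_exp_def eventually_at_filter)
  moreover have "(flat_exp m \<longlongrightarrow> 0) (at_right 0)"
  proof -
    have "((\<lambda>t::real. inverse t ^ m / exp (inverse t)) \<longlongrightarrow> 0) (at_right 0)"
      by (rule filterlim_compose[OF tendsto_power_div_exp_0 filterlim_inverse_at_top_right])
    then show ?thesis
      by (rule Lim_transform_eventually)
        (auto simp: flat_exp_def eventually_at_filter field_simps exp_minus)
  qed
  ultimately show ?thesis by (simp add: filterlim_split_at)
qed

lemma DERIV_flat_exp: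
  "DERIV (flat_exp m) t :> flat_exp (m + 2) t - real m * flat_exp (m + 1) t"
proof -
  consider "t < 0" | "t = 0" | "t > 0" by linarith
  then show ?thesis
  proof cases
    case 1
    have "DERIV (\<lambda>_. 0) t :> 0" by simp
    then have "DERIV (flat_exp m) t :> 0"
      by (rule has_field_derivative_transform_within_open[where S = "{..<0}"])
         (use 1 in \<open>auto simp: flat_exp_def\<close>)
    then show ?thesis using 1 by (simp add: flat_exp_def)
  next
    case 2
    \<comment> \<open>At 0 the difference quotient is itself a member of the family, so its limit is
      already known.\<close>
    have "(\<lambda>h. (flat_exp m (0 + h) - flat_exp m 0) / h) = flat_exp (m + 1)"
      by (auto simp: flat_exp_def fun_eq_iff)
    then show ?thesis
      using flat_exp_tendsto_0[of "m + 1"] 2 by (simp add: DERIV_def flat_exp_def[of _ 0])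
  next
    case 3
    have "DERIV (\<lambda>t. exp (- 1 / t)) t :> exp (- 1 / t) * (1 / t\<^sup>2)"
      using 3 by (auto intro!: derivative_eq_intros simp: power2_eq_square)
    then have "DERIV (\<lambda>t. exp (- 1 / t) / t ^ m) t :>
        (exp (- 1 / t) * (1 / t\<^sup>2) * t ^ m - exp (- 1 / t) * (real m * t ^ (m - Suc 0))) / (t ^ m * t ^ m)"
      using 3 by (intro DERIV_divide DERIV_pow) auto
    also have "(exp (- 1 / t) * (1 / t\<^sup>2) * t ^ m - exp (- 1 / t) * (real m * t ^ (m - Suc 0))) / (t ^ m * t ^ m)
        = flat_exp (m + 2) t - real m * flat_exp (m + 1) t"
      using 3 by (cases m) (simp_all add: flat_exp_def field_simps power2_eq_square)
    finally have "DERIV (\<lambda>t. exp (- 1 / t) / t ^ m) t :> flat_exp (m + 2) t - real m * flat_exp (m + 1) t" .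
    then show ?thesis
      by (rule has_field_derivative_transform_within_open[where S = "{0<..}"])
         (use 3 in \<open>auto simp: flat_exp_def\<close>)
  qed
qed

text \<open>A class closed under partial derivatives and containing bump functions; its members are
  therefore \<open>C\<^sup>\<infinity>\<close> in the sense of \<open>Ck\<close>.\<close>

inductive flat_smooth :: "('a::euclidean_space \<Rightarrow> real) \<Rightarrow> bool" where
  const: "flat_smooth (\<lambda>_. c)"
| inner: "flat_smooth (\<lambda>x. x \<bullet> b)"
| add: "flat_smooth f \<Longrightarrow> flat_smooth g \<Longrightarrow> flat_smooth (\<lambda>x. f x + g x)"
| mult: "flat_smooth f \<Longrightarrow> flat_smooth g \<Longrightarrow> flat_smooth (\<lambda>x. f x * g x)"
| flat_exp: "flat_smooth f \<Longrightarrow> flat_smooth (\<lambda>x. flat_exp m (f x))"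

lemma grad_eqI: "GDERIV f x :> D \<Longrightarrow> grad f x = D"
proof -
  assume D: "GDERIV f x :> D"
  have "GDERIV f x :> grad f x" unfolding grad_def by (rule someI[of _ D]) (rule D)
  then have "(\<lambda>h. h \<bullet> grad f x) = (\<lambda>h. h \<bullet> D)"
    using D unfolding gderiv_def by (rule has_derivative_unique)
  then have "h \<bullet> (grad f x - D) = 0" for h
    by (metis inner_diff_right right_minus_eq)
  from this[of "grad f x - D"] show ?thesis by simp
qed

text \<open>The values of the derivative on the orthonormal basis represent it as an inner product,
  so the choice in \<open>grad\<close> has a witness.\<close>

lemma GDERIV_grad:
  fixes f :: "'a::euclidean_space \<Rightarrow> real"
  assumes "f differentiable (at x)"
  shows "GDERIV f x :> grad f x"
proof -
  obtain f' where f': "(f has_derivative f') (at x)" using assms differentiable_def by blast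
  interpret bounded_linear f' by (rule has_derivative_bounded_linear[OF f'])
  have "f' h = h \<bullet> (\<Sum>b\<in>Basis. f' b *\<^sub>R b)" for h
  proof -
    have "f' h = f' (\<Sum>b\<in>Basis. (h \<bullet> b) *\<^sub>R b)" by (simp add: euclidean_representation)
    also have "\<dots> = (\<Sum>b\<in>Basis. (h \<bullet> b) * f' b)" by (simp add: sum scaleR)
    also have "\<dots> = h \<bullet> (\<Sum>b\<in>Basis. f' b *\<^sub>R b)" by (simp add: inner_sum_right mult.commute)
    finally show ?thesis .
  qed
  then have "f' = (\<lambda>h. h \<bullet> (\<Sum>b\<in>Basis. f' b *\<^sub>R b))" by (rule ext)
  with f' have "GDERIV f x :> (\<Sum>b\<in>Basis. f' b *\<^sub>R b)"
    unfolding gderiv_def by simp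
  then show ?thesis using grad_eqI by metis
qed

lemma flat_smooth_GDERIV:
  "flat_smooth f \<Longrightarrow> \<exists>g. (\<forall>x. GDERIV f x :> g x) \<and> (\<forall>b. flat_smooth (\<lambda>x. g x \<bullet> b))"
proof (induction rule: flat_smooth.induct)
  case (const c)
  show ?case
    by (rule exI[of _ "\<lambda>_. 0"]) (auto simp: GDERIV_const intro: flat_smooth.const)
next
  case (inner b)
  show ?case
    by (rule exI[of _ "\<lambda>_. b"])
       (auto simp: gderiv_def intro: flat_smooth.const intro!: derivative_eq_intros)
next
  case (add f g)
  then obtain f' g' where "\<forall>x. GDERIV f x :> f' x" "\<forall>b. flat_smooth (\<lambda>x. f' x \<bullet> b)"
    "\<forall>x. GDERIV g x :> g' x" "\<forall>b. flat_smooth (\<lambda>x. g' x \<bullet> b)" by blast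
  then show ?case
    by (intro exI[of _ "\<lambda>x. f' x + g' x"])
       (auto simp: inner_add_left intro: GDERIV_add flat_smooth.add)
next
  case (mult f g)
  then obtain f' g' where "\<forall>x. GDERIV f x :> f' x" "\<forall>b. flat_smooth (\<lambda>x. f' x \<bullet> b)"
    "\<forall>x. GDERIV g x :> g' x" "\<forall>b. flat_smooth (\<lambda>x. g' x \<bullet> b)" by blast
  moreover from this mult.hyps have "flat_smooth (\<lambda>x. f x * (g' x \<bullet> b) + g x * (f' x \<bullet> b))" for b
    by (intro flat_smooth.add flat_smooth.mult) auto
  ultimately show ?case
    by (intro exI[of _ "\<lambda>x. f x *\<^sub>R g' x + g x *\<^sub>R f' x"])
       (auto simp: inner_add_left intro: GDERIV_mult)
next
  case (flat_exp f m)
  then obtain f' where f': "\<forall>x. GDERIV f x :> f' x" "\<forall>b. flat_smooth (\<lambda>x. f' x \<bullet> b)" by blast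
  have "flat_smooth (\<lambda>x. (flat_exp (m + 2) (f x) + - real m * flat_exp (m + 1) (f x)) * (f' x \<bullet> b))" for b
    using flat_exp.hyps f'(2)
    by (intro flat_smooth.mult flat_smooth.add flat_smooth.flat_exp flat_smooth.const) auto
  moreover have "GDERIV (\<lambda>x. flat_exp m (f x)) x :>
      (flat_exp (m + 2) (f x) - real m * flat_exp (m + 1) (f x)) *\<^sub>R f' x" for x
    using f'(1) by (intro GDERIV_DERIV_compose[OF _ DERIV_flat_exp]) auto
  ultimately show ?case
    by (intro exI[of _ "\<lambda>x. (flat_exp (m + 2) (f x) - real m * flat_exp (m + 1) (f x)) *\<^sub>R f' x"])
       auto
qed

lemma GDERIV_imp_differentiable: "GDERIV f x :> D \<Longrightarrow> f differentiable (at x)"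
  by (auto simp: gderiv_def differentiable_def)

lemma flat_smooth_imp_Ck: "flat_smooth f \<Longrightarrow> Ck k f"
proof (induction k arbitrary: f)
  case 0
  obtain g where g: "\<forall>x. GDERIV f x :> g x"
    using flat_smooth_GDERIV[OF 0] by blast
  then have "f differentiable_on UNIV"
    using GDERIV_imp_differentiable differentiable_at_imp_differentiable_on by metis
  then show ?case by (simp add: differentiable_imp_continuous_on)
next
  case (Suc k)
  obtain g where g: "\<forall>x. GDERIV f x :> g x" "\<forall>b. flat_smooth (\<lambda>x. g x \<bullet> b)"
    using flat_smooth_GDERIV[OF Suc.prems] by blast
  then have "grad f = g" by (auto simp: grad_eqI)
  with g Suc.IH show ?case by (auto intro: GDERIV_imp_differentiable)
qed

lemma flat_smooth_prod:
  "finite B \<Longrightarrow> (\<And>b. b \<in> B \<Longrightarrow> flat_smooth (f b)) \<Longrightarrow> flat_smooth (\<lambda>x. \<Prod>b\<in>B. f b x)"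
  by (induction B rule: finite_induct) (auto intro: flat_smooth.intros)

text \<open>A smooth approximation of the indicator of \<open>box a c\<close> with values in
  \<open>[0, 1]\<close>: inside the box each factor has the form \<open>exp (- 1 / (n * s))\<close>
  with \<open>s > 0\<close> and tends to 1 as \<open>n\<close> grows. Differences are written as
  sums so that the rules of \<open>flat_smooth\<close> match.\<close>

definition box_bump :: "'a::euclidean_space \<Rightarrow> 'a \<Rightarrow> nat \<Rightarrow> 'a \<Rightarrow> real" where
  "box_bump a c n x =
     (\<Prod>b\<in>Basis. flat_exp 0 (real n * (x \<bullet> b + - (a \<bullet> b))) * flat_exp 0 (real n * (c \<bullet> b + - 1 * (x \<bullet> b))))"

lemma box_bump_outside: "x \<notin> box a c \<Longrightarrow> box_bump a c n x = 0"
proof -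
  assume "x \<notin> box a c"
  then obtain b where "b \<in> Basis" "x \<bullet> b \<le> a \<bullet> b \<or> c \<bullet> b \<le> x \<bullet> b" by (auto simp: mem_box not_less)
  then show ?thesis
    unfolding box_bump_def
    by (intro prod_zero bexI[of _ b]) (auto simp: flat_exp_def zero_less_mult_iff)
qed

lemma box_bump_bounds: "0 \<le> box_bump a c n x" "box_bump a c n x \<le> 1"
proof -
  have *: "0 \<le> flat_exp 0 t" "flat_exp 0 t \<le> 1" for t by (auto simp: flat_exp_def)
  show "0 \<le> box_bump a c n x" unfolding box_bump_def by (intro prod_nonneg) (auto simp: *)
  show "box_bump a c n x \<le> 1" unfolding box_bump_def
    by (intro prod_le_1) (auto simp: * intro: mult_le_one)
qed

lemma box_bump_Cc_infinity:
  assumes "cbox a c \<subseteq> \<Omega>"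
  shows "box_bump a c n \<in> Cc_infinity \<Omega>"
proof -
  have "flat_smooth (box_bump a c n)"
    unfolding box_bump_def
    by (intro flat_smooth_prod flat_smooth.intros) auto
  moreover have "closure {x. box_bump a c n x \<noteq> 0} \<subseteq> cbox a c"
    using box_bump_outside[of _ a c n] box_subset_cbox[of a c]
    by (intro closure_minimal) auto
  moreover from this have "compact (closure {x. box_bump a c n x \<noteq> 0})"
    by (meson bounded_cbox bounded_subset compact_eq_bounded_closed closed_closure)
  ultimately show ?thesis using assms by (auto simp: Cc_infinity_def flat_smooth_imp_Ck)
qed

lemma box_bump_tendsto: "(\<lambda>n. box_bump a c n x) \<longlonglongrightarrow> indicator (box a c) x"
proof (cases "x \<in> box a c")
  case True
  have *: "(\<lambda>n. flat_exp 0 (real n * s)) \<longlonglongrightarrow> 1" if "s > 0" for s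
  proof -
    have "(\<lambda>n. exp (- (1 / s) / real n)) \<longlonglongrightarrow> exp 0"
      by (intro tendsto_intros lim_const_over_n)
    then have "(\<lambda>n. exp (- (1 / s) / real n)) \<longlonglongrightarrow> 1" by simp
    then show ?thesis
      by (rule Lim_transform_eventually, intro eventually_mono[OF eventually_gt_at_top[of 0]])
         (use that in \<open>auto simp: flat_exp_def\<close>)
  qed
  have "(\<lambda>n. box_bump a c n x) \<longlonglongrightarrow> (\<Prod>b\<in>(Basis::'a set). 1 * 1)"
    unfolding box_bump_def
    using True by (intro tendsto_prod tendsto_mult *) (auto simp: mem_box)
  then show ?thesis using True by simp
next
  case False
  then show ?thesis by (simp add: box_bump_outside)
qed

section \<open>From vanishing integrals over boxes to vanishing almost everywhere\<close>

text \<open>Boxes are an intersection-stable generator, and the sets over which \<open>f\<close>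
  integrates to 0 form a Dynkin system. So all Borel integrals vanish, and densities are
  unique.\<close>

lemma AE_zero_if_box_integrals_zero_lborel:
  fixes f :: "'a::euclidean_space \<Rightarrow> real"
  assumes f: "integrable lborel f" and zero: "\<And>a b. (LINT x:box a b|lborel. f x) = 0"
  shows "AE x in lborel. f x = 0"
proof (rule density_unique_real[OF f integrable_zero])
  fix A :: "'a set" assume "A \<in> sets lborel"
  let ?G = "range (\<lambda>(a, b). box a b :: 'a set)"
  have int: "set_integrable lborel B f" if "B \<in> sets lborel" for B
    unfolding set_integrable_def using that f by (rule integrable_mult_indicator)
  \<comment> \<open>Closure under complements needs the integral over the whole space, which is the
    limit of the integrals over growing boxes.\<close>
  have all: "(LINT x|lborel. f x) = 0"
  proof -
    define B :: "nat \<Rightarrow> 'a set" where "B n = box (- real n *\<^sub>R One) (real n *\<^sub>R One)" for n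
    have lim: "(\<lambda>n. indicator (B n) x *\<^sub>R f x) \<longlonglongrightarrow> f x" for x
    proof (rule tendsto_eventually)
      obtain m where m: "norm x < real m" using reals_Archimedean2 by blast
      show "\<forall>\<^sub>F n in sequentially. indicator (B n) x *\<^sub>R f x = f x"
        using eventually_ge_at_top[of m]
      proof eventually_elim
        case (elim n)
        have "\<bar>x \<bullet> b\<bar> < real n" if "b \<in> Basis" for b
          using Basis_le_norm[OF that, of x] m elim by linarith
        then have "x \<in> B n" unfolding B_def mem_box by (auto simp: abs_less_iff minus_less_iff)
        then show ?case by simp
      qed
    qed
    have "(\<lambda>n. LINT x|lborel. indicator (B n) x *\<^sub>R f x) \<longlonglongrightarrow> (LINT x|lborel. f x)"
    proof (rule integral_dominated_convergence[where w = "\<lambda>x. norm (f x)"])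
      show "(\<lambda>x. indicator (B n) x *\<^sub>R f x) \<in> borel_measurable lborel" for n
        using f by (auto simp: B_def)
    qed (use f lim in \<open>auto simp: indicator_def\<close>)
    moreover have "(LINT x|lborel. indicator (B n) x *\<^sub>R f x) = 0" for n
      using zero[of "- real n *\<^sub>R One" "real n *\<^sub>R One"] by (simp add: set_lebesgue_integral_def B_def)
    ultimately show ?thesis by (simp add: LIMSEQ_const_iff)
  qed
  have S: "A \<in> sigma_sets UNIV ?G"
    using \<open>A \<in> sets lborel\<close> unfolding sets_lborel borel_eq_box by simp
  have "Int_stable ?G"
    by (auto simp: Int_stable_def box_Int_box)
  moreover have "?G \<subseteq> Pow UNIV" by simp
  ultimately have "(LINT x:A|lborel. f x) = 0" using S
  proof (induction rule: sigma_sets_induct_disjoint)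
    case (basic B)
    then show ?case using zero by auto
  next
    case empty
    then show ?case by (simp add: set_lebesgue_integral_def)
  next
    case (compl B)
    have B: "B \<in> sets lborel"
      using compl(1) unfolding sets_lborel borel_eq_box by simp
    have "(LINT x|lborel. f x) = (LINT x|lborel. indicator B x *\<^sub>R f x + indicator (UNIV - B) x *\<^sub>R f x)"
      by (intro Bochner_Integration.integral_cong) (auto simp: indicator_def)
    also have "\<dots> = (LINT x:B|lborel. f x) + (LINT x:UNIV - B|lborel. f x)"
      unfolding set_lebesgue_integral_def
      using int[of B] int[of "UNIV - B"] B
      by (intro Bochner_Integration.integral_add) (auto simp: set_integrable_def)
    finally show ?case using compl(2) all by simp
  next
    case (union B)
    have B: "B i \<in> sets lborel" for i
      using union(2) unfolding sets_lborel borel_eq_box by auto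
    have "(LINT x:(\<Union>i. B i)|lborel. f x) = (\<Sum>i. (LINT x:B i|lborel. f x))"
      using union(1) B int[of "\<Union>i. B i"] by (intro lebesgue_integral_countable_add) (auto simp: disjoint_family_on_def)
    then show ?case using union(3) by simp
  qed
  then show "(LINT x:A|lborel. f x) = (LINT x:A|lborel. 0)" by simp
qed

lemma AE_zero_if_box_integrals_zero:
  fixes f :: "'a::euclidean_space \<Rightarrow> real"
  assumes f: "integrable lebesgue f" and zero: "\<And>a b. (LINT x:box a b|lebesgue. f x) = 0"
  shows "AE x in lebesgue. f x = 0"
proof -
  obtain g where g: "g \<in> borel_measurable lborel" "AE x in lborel. f x = g x"
    using completion_ex_borel_measurable_real[of f lborel] f by auto
  have g': "g \<in> borel_measurable lebesgue" using g(1) by (rule measurable_completion)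
  have "integrable lebesgue g"
    using f g' AE_completion[OF g(2)] by (subst integrable_cong_AE[where g = f]) auto
  then have "integrable lborel g" using integrable_completion[OF g(1)] by simp
  moreover have "(LINT x:box a b|lborel. g x) = 0" for a b
  proof -
    have "(LINT x:box a b|lborel. g x) = (LINT x:box a b|lebesgue. g x)"
      unfolding set_lebesgue_integral_def using g(1) by (intro integral_completion[symmetric]) auto
    also have "\<dots> = (LINT x:box a b|lebesgue. f x)"
      unfolding set_lebesgue_integral_def
    proof (rule integral_cong_AE)
      show "AE x in lebesgue. indicator (box a b) x *\<^sub>R g x = indicator (box a b) x *\<^sub>R f x"
        using AE_completion[OF g(2)] by eventually_elim simp
      have B: "box a b \<in> sets lebesgue" by simp
      show "(\<lambda>x. indicator (box a b) x *\<^sub>R g x) \<in> borel_measurable lebesgue"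
        "(\<lambda>x. indicator (box a b) x *\<^sub>R f x) \<in> borel_measurable lebesgue"
        using f by (intro borel_measurable_scaleR borel_measurable_indicator B g' borel_measurable_integrable)+
    qed
    finally show ?thesis using zero by simp
  qed
  ultimately have "AE x in lborel. g x = 0" by (rule AE_zero_if_box_integrals_zero_lborel)
  with g(2) have "AE x in lborel. f x = 0" by eventually_elim simp
  then show ?thesis by (rule AE_completion)
qed

subsection \<open>Weak gradients\<close>

lemma Lp_loc_1_set_integrable:
  assumes f: "Lp_loc 1 \<Omega> f" and \<Omega>: "\<Omega> \<in> sets lebesgue" and C: "compact C" "C \<subseteq> \<Omega>"
  shows "set_integrable lebesgue C f"
proof -
  have Cm: "C \<in> sets lebesgue" using C(1) by (simp add: compact_imp_closed)
  have "(\<lambda>x. indicator \<Omega> x *\<^sub>R f x) \<in> borel_measurable lebesgue"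
    using f \<Omega> unfolding Lp_loc_def by (subst (asm) borel_measurable_restrict_space_iff) auto
  then have "(\<lambda>x. indicator C x *\<^sub>R (indicator \<Omega> x *\<^sub>R f x)) \<in> borel_measurable lebesgue"
    by (rule borel_measurable_scaleR[OF borel_measurable_indicator[OF Cm]])
  moreover have "indicator C x *\<^sub>R (indicator \<Omega> x *\<^sub>R f x) = indicator C x *\<^sub>R f x" for x
    using C(2) by (auto simp: indicator_def)
  ultimately have m: "(\<lambda>x. indicator C x *\<^sub>R f x) \<in> borel_measurable lebesgue" by (simp only:)
  have i: "integrable lebesgue (\<lambda>x. indicat_real C x *\<^sub>R (norm (f x) powr 1))"
    using f C unfolding Lp_loc_def set_integrable_def by blast
  show ?thesis
    unfolding set_integrable_def
    by (rule Bochner_Integration.integrable_bound[OF i m]) (auto simp: indicator_def)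
qed

lemma continuous_imp_lebesgue_measurable:
  fixes f :: "'a::euclidean_space \<Rightarrow> 'b::topological_space"
  assumes "continuous_on UNIV f"
  shows "f \<in> borel_measurable lebesgue"
  using borel_measurable_continuous_onI[OF assms] by (intro measurable_completion) simp

lemma continuous_on_box_bump: "continuous_on UNIV (box_bump a c n)"
proof -
  have "box_bump a c n \<in> Cc_infinity UNIV" by (rule box_bump_Cc_infinity) simp
  then have "Ck 0 (box_bump a c n)" unfolding Cc_infinity_def by blast
  then show ?thesis by simp
qed

lemma is_weak_gradD:
  assumes "is_weak_grad \<Omega> u g" "\<phi> \<in> Cc_infinity \<Omega>"
  shows "(LINT x:\<Omega>|lebesgue. u x *\<^sub>R grad \<phi> x) = - (LINT x:\<Omega>|lebesgue. \<phi> x *\<^sub>R g x)"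
  using assms unfolding is_weak_grad_def by blast

text \<open>Testing with bumps and passing to the indicator gives equal integrals of
  \<open>g\<close> and \<open>h\<close> over every box whose closure lies in
  \<open>\<Omega>\<close>. On such a box the two agree almost everywhere, and countably many boxes
  cover \<open>\<Omega>\<close>.\<close>

lemma weak_grad_unique:
  fixes g h :: "'a::euclidean_space \<Rightarrow> 'a"
  assumes \<Omega>: "open \<Omega>" and g: "is_weak_grad \<Omega> u g" and h: "is_weak_grad \<Omega> u h"
  shows "AE x in lebesgue. x \<in> \<Omega> \<longrightarrow> g x = h x"
proof -
  have \<Omega>m: "\<Omega> \<in> sets lebesgue" using \<Omega> by simp
  have int: "set_integrable lebesgue C g" "set_integrable lebesgue C h"
    if "compact C" "C \<subseteq> \<Omega>" for C
    using g h that \<Omega>m unfolding is_weak_grad_def by (auto intro: Lp_loc_1_set_integrable)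
  have box0: "(LINT x:box a c|lebesgue. (g x - h x) \<bullet> b) = 0" if ac: "cbox a c \<subseteq> \<Omega>" for a c b
  proof -
    \<comment> \<open>Cutting off at the closed box yields functions integrable on the whole space.
      The integrals against the bumps are unchanged, since the bumps vanish outside the box.\<close>
    define G where "G = (\<lambda>x. indicat_real (cbox a c) x *\<^sub>R g x)"
    define H where "H = (\<lambda>x. indicat_real (cbox a c) x *\<^sub>R h x)"
    have GH: "integrable lebesgue G" "integrable lebesgue H"
      using int[OF compact_cbox ac] by (simp_all add: G_def H_def set_integrable_def)
    have bump: "box_bump a c n \<in> borel_measurable lebesgue" for n
      by (intro continuous_imp_lebesgue_measurable continuous_on_box_bump)
    have I: "integrable lebesgue (\<lambda>x. box_bump a c n x *\<^sub>R F x)" if "integrable lebesgue F" for F :: "'a \<Rightarrow> 'a" and n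
      using that borel_measurable_integrable[OF that] bump[of n]
      by (intro Bochner_Integration.integrable_bound[OF that])
         (auto simp: box_bump_bounds mult_left_le_one_le intro!: borel_measurable_scaleR)
    have z: "(LINT x|lebesgue. box_bump a c n x *\<^sub>R (G x - H x)) = 0" for n
    proof -
      have \<phi>: "box_bump a c n \<in> Cc_infinity \<Omega>" using ac by (rule box_bump_Cc_infinity)
      have "(LINT x:\<Omega>|lebesgue. box_bump a c n x *\<^sub>R g x) = (LINT x:\<Omega>|lebesgue. box_bump a c n x *\<^sub>R h x)"
        using is_weak_gradD[OF g \<phi>] is_weak_gradD[OF h \<phi>] by simp
      moreover have "indicat_real \<Omega> x *\<^sub>R box_bump a c n x *\<^sub>R v = box_bump a c n x *\<^sub>R (indicat_real (cbox a c) x *\<^sub>R v)"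
        for x and v :: 'a
        using ac box_bump_outside[of x a c n] box_subset_cbox[of a c] by (auto simp: indicator_def)
      ultimately have "(LINT x|lebesgue. box_bump a c n x *\<^sub>R G x) = (LINT x|lebesgue. box_bump a c n x *\<^sub>R H x)"
        by (simp only: set_lebesgue_integral_def G_def H_def)
      then show ?thesis
        using I[OF GH(1)] I[OF GH(2)] by (simp add: scaleR_diff_right)
    qed
    have "(\<lambda>n. LINT x|lebesgue. box_bump a c n x *\<^sub>R (G x - H x))
        \<longlonglongrightarrow> (LINT x|lebesgue. indicator (box a c) x *\<^sub>R (G x - H x))"
    proof (rule integral_dominated_convergence[where w = "\<lambda>x. norm (G x - H x)"])
      have GHm: "(\<lambda>x. G x - H x) \<in> borel_measurable lebesgue"
        using GH by (intro borel_measurable_diff borel_measurable_integrable)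
      show "(\<lambda>x. indicat_real (box a c) x *\<^sub>R (G x - H x)) \<in> borel_measurable lebesgue"
        by (intro borel_measurable_scaleR borel_measurable_indicator GHm) simp
      show "(\<lambda>x. box_bump a c n x *\<^sub>R (G x - H x)) \<in> borel_measurable lebesgue" for n
        by (intro borel_measurable_scaleR bump GHm)
      show "integrable lebesgue (\<lambda>x. norm (G x - H x))"
        using GH by (intro integrable_norm Bochner_Integration.integrable_diff)
      show "AE x in lebesgue. (\<lambda>n. box_bump a c n x *\<^sub>R (G x - H x)) \<longlonglongrightarrow> indicator (box a c) x *\<^sub>R (G x - H x)"
        by (intro AE_I2 tendsto_scaleR box_bump_tendsto tendsto_const)
      show "AE x in lebesgue. norm (box_bump a c n x *\<^sub>R (G x - H x)) \<le> norm (G x - H x)" for n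
        by (auto simp: box_bump_bounds mult_left_le_one_le)
    qed
    then have zero: "(LINT x|lebesgue. indicat_real (box a c) x *\<^sub>R (G x - H x)) = 0"
      by (simp add: z LIMSEQ_const_iff)
    have "integrable lebesgue (\<lambda>x. indicat_real (box a c) x *\<^sub>R (G x - H x))"
      using GH by (intro integrable_mult_indicator Bochner_Integration.integrable_diff) auto
    from integral_inner_left[OF this, of b]
    have "(LINT x|lebesgue. (indicat_real (box a c) x *\<^sub>R (G x - H x)) \<bullet> b) = 0" by (simp add: zero)
    moreover have "(indicat_real (box a c) x *\<^sub>R (G x - H x)) \<bullet> b = indicat_real (box a c) x *\<^sub>R ((g x - h x) \<bullet> b)" for x
      using box_subset_cbox[of a c] by (auto simp: G_def H_def indicator_def)
    ultimately show ?thesis by (simp only: set_lebesgue_integral_def)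
  qed
  have loc: "AE x in lebesgue. x \<in> cbox p q \<longrightarrow> g x = h x" if pq: "cbox p q \<subseteq> \<Omega>" for p q
  proof -
    have "AE x in lebesgue. indicat_real (box p q) x *\<^sub>R ((g x - h x) \<bullet> b) = 0" for b
    proof (rule AE_zero_if_box_integrals_zero)
      have "set_integrable lebesgue (cbox p q) (\<lambda>x. g x - h x)"
        using int[OF compact_cbox pq] by (rule set_integral_diff)
      then have "set_integrable lebesgue (box p q) (\<lambda>x. g x - h x)"
        by (rule set_integrable_subset) (auto simp: box_subset_cbox)
      from integrable_inner_left[OF this[unfolded set_integrable_def], of b]
      show "integrable lebesgue (\<lambda>x. indicat_real (box p q) x *\<^sub>R ((g x - h x) \<bullet> b))"
        by simp
      fix a c
      \<comment> \<open>A test box meets \<open>box p q\<close> in another box, whose closed hull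
        stays inside \<open>cbox p q\<close> and hence in \<open>\<Omega>\<close>; so
        \<open>box0\<close> applies to it.\<close>
      define a' where "a' = (\<Sum>i\<in>Basis. max (a \<bullet> i) (p \<bullet> i) *\<^sub>R i)"
      define c' where "c' = (\<Sum>i\<in>Basis. min (c \<bullet> i) (q \<bullet> i) *\<^sub>R i)"
      have "box a c \<inter> box p q = box a' c'" unfolding a'_def c'_def by (rule box_Int_box)
      then have "indicat_real (box a c) x *\<^sub>R indicat_real (box p q) x *\<^sub>R v = indicat_real (box a' c') x *\<^sub>R v" for x and v :: real
        by (auto simp: indicator_def)
      moreover have "cbox a' c' \<subseteq> cbox p q" by (auto simp: mem_box a'_def c'_def)
      from box0[OF order_trans[OF this pq]] have "(LINT x:box a' c'|lebesgue. (g x - h x) \<bullet> b) = 0" .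
      ultimately show "(LINT x:box a c|lebesgue. indicat_real (box p q) x *\<^sub>R ((g x - h x) \<bullet> b)) = 0"
        by (simp only: set_lebesgue_integral_def)
    qed
    then have "AE x in lebesgue. \<forall>b\<in>Basis. indicat_real (box p q) x *\<^sub>R ((g x - h x) \<bullet> b) = 0"
      by (intro AE_finite_allI) auto
    moreover have "cbox p q - box p q \<in> null_sets lebesgue"
      using negligible_iff_null_sets negligible_frontier_interval by blast
    then have "AE x in lebesgue. x \<notin> cbox p q - box p q" by (rule AE_not_in)
    ultimately show ?thesis
    proof eventually_elim
      case (elim x)
      show ?case
      proof
        assume "x \<in> cbox p q"
        with elim(2) have "x \<in> box p q" by simp
        then have "(g x - h x) \<bullet> b = 0" if "b \<in> Basis" for b
          using bspec[OF elim(1) that] by simp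
        then have "g x - h x = 0" using euclidean_all_zero_iff by blast
        then show "g x = h x" by simp
      qed
    qed
  qed
  \<comment> \<open>Countability of the cover keeps the union of the exceptional sets null.\<close>
  obtain \<D> where \<D>: "countable \<D>" "\<D> \<subseteq> Pow \<Omega>" "\<And>X. X \<in> \<D> \<Longrightarrow> \<exists>a b. X = cbox a b" "\<Union>\<D> = \<Omega>"
    by (rule open_countable_Union_open_cbox[OF \<Omega>]) (rule that; simp)
  have "AE x in lebesgue. \<forall>X\<in>\<D>. x \<in> X \<longrightarrow> g x = h x"
    unfolding AE_ball_countable[OF \<D>(1)]
  proof
    fix X assume "X \<in> \<D>"
    then obtain p q where "X = cbox p q" "cbox p q \<subseteq> \<Omega>" using \<D>(2,3) by blast
    then show "AE x in lebesgue. x \<in> X \<longrightarrow> g x = h x" using loc by simp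
  qed
  then show ?thesis
  proof eventually_elim
    case (elim x)
    then show ?case using \<D>(4) by (metis UnionE)
  qed
qed

section \<open>Continuously differentiable functions and integration by parts\<close>

text \<open>Differences and products of test functions are differentiated only once below.
  First-order smoothness is stable under these operations by the sum and product rules, without an
  induction over all \<open>Ck\<close>.\<close>

definition C1 :: "('a::euclidean_space \<Rightarrow> real) \<Rightarrow> bool" where
  "C1 u \<longleftrightarrow> (\<forall>x. u differentiable (at x)) \<and> continuous_on UNIV (grad u)"

lemma C1_I:
  assumes "\<And>x. GDERIV u x :> g x" "continuous_on UNIV g"
  shows "C1 u" "grad u = g"
proof -
  show "grad u = g" using assms(1) by (auto simp: grad_eqI)
  then show "C1 u" using assms by (auto simp: C1_def intro: GDERIV_imp_differentiable)
qed

lemma C1_GDERIV: "C1 u \<Longrightarrow> GDERIV u x :> grad u x"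
  by (simp add: C1_def GDERIV_grad)

lemma C1_grad_continuous: "C1 u \<Longrightarrow> continuous_on S (grad u)"
  unfolding C1_def by (blast intro: continuous_on_subset)

lemma C1_continuous: "C1 u \<Longrightarrow> continuous_on S u"
  unfolding C1_def
  by (intro differentiable_imp_continuous_on differentiable_at_imp_differentiable_on) blast

lemma C1_diff:
  assumes u: "C1 u" and v: "C1 v"
  shows "C1 (\<lambda>x. u x - v x)" "grad (\<lambda>x. u x - v x) = (\<lambda>x. grad u x - grad v x)"
proof -
  have "GDERIV (\<lambda>x. u x - v x) x :> grad u x - grad v x" for x
    by (rule GDERIV_diff[OF C1_GDERIV[OF u] C1_GDERIV[OF v]])
  moreover have "continuous_on UNIV (\<lambda>x. grad u x - grad v x)"
    by (rule continuous_on_diff[OF C1_grad_continuous[OF u] C1_grad_continuous[OF v]])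
  ultimately show "C1 (\<lambda>x. u x - v x)" "grad (\<lambda>x. u x - v x) = (\<lambda>x. grad u x - grad v x)"
    by (rule C1_I)+
qed

lemma C1_mult:
  assumes u: "C1 u" and v: "C1 v"
  shows "C1 (\<lambda>x. u x * v x)" "grad (\<lambda>x. u x * v x) = (\<lambda>x. u x *\<^sub>R grad v x + v x *\<^sub>R grad u x)"
proof -
  have "GDERIV (\<lambda>x. u x * v x) x :> u x *\<^sub>R grad v x + v x *\<^sub>R grad u x" for x
    by (rule GDERIV_mult[OF C1_GDERIV[OF u] C1_GDERIV[OF v]])
  moreover have "continuous_on UNIV (\<lambda>x. u x *\<^sub>R grad v x + v x *\<^sub>R grad u x)"
    by (intro continuous_on_add continuous_on_scaleR C1_continuous[OF u] C1_continuous[OF v]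
        C1_grad_continuous[OF u] C1_grad_continuous[OF v])
  ultimately show "C1 (\<lambda>x. u x * v x)"
    "grad (\<lambda>x. u x * v x) = (\<lambda>x. u x *\<^sub>R grad v x + v x *\<^sub>R grad u x)"
    by (rule C1_I)+
qed

lemma Cc_infinity_C1:
  assumes "u \<in> Cc_infinity \<Omega>"
  shows "C1 u"
proof -
  have "Ck (Suc 0) u" using assms unfolding Cc_infinity_def by blast
  then show ?thesis
    unfolding C1_def Ck.simps by (auto intro: continuous_on_componentwise[THEN iffD2])
qed

lemma grad_zero_outside:
  assumes "x \<notin> closure {x. u x \<noteq> 0}"
  shows "grad u x = 0"
proof (rule grad_eqI)
  have "((\<lambda>_. 0) has_derivative (\<lambda>h. 0)) (at x)" by simp
  then have "(u has_derivative (\<lambda>h. 0)) (at x)"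
    by (rule has_derivative_transform_within_open[where s = "- closure {x. u x \<noteq> 0}"])
       (use assms closure_subset[of "{x. u x \<noteq> 0}"] in auto)
  then show "GDERIV u x :> 0" by (simp add: gderiv_def)
qed

lemma integrable_lebesgue_compact_support:
  fixes f :: "'a::euclidean_space \<Rightarrow> 'b::euclidean_space"
  assumes "continuous_on UNIV f" "compact C" "\<And>x. x \<notin> C \<Longrightarrow> f x = 0"
  shows "integrable lebesgue f"
proof -
  have "integrable lborel (\<lambda>x. indicator C x *\<^sub>R f x)"
    using assms by (intro borel_integrable_compact) (auto intro: continuous_on_subset)
  also have "(\<lambda>x. indicator C x *\<^sub>R f x) = f" using assms(3) by (auto simp: indicator_def)
  finally show ?thesis
    using borel_measurable_continuous_onI[OF assms(1)] by (simp add: integrable_completion)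
qed

text \<open>By translation invariance the integral of every difference quotient is 0. The quotients
  in a coordinate direction are bounded by a Lipschitz constant, live on one fixed ball, and
  converge to the partial derivative; dominated convergence finishes without iterated
  integrals.\<close>

lemma integral_grad_zero:
  fixes u :: "'a::euclidean_space \<Rightarrow> real"
  assumes u: "C1 u" and C: "compact (closure {x. u x \<noteq> 0})"
  shows "integrable lebesgue (grad u)" "(LINT x|lebesgue. grad u x) = 0"
proof -
  let ?C = "closure {x. u x \<noteq> 0}"
  show int: "integrable lebesgue (grad u)"
    using C1_grad_continuous[OF u] C grad_zero_outside[of _ u]
    by (rule integrable_lebesgue_compact_support)
  obtain R where R: "\<And>x. x \<in> ?C \<Longrightarrow> norm x \<le> R" using compact_imp_bounded[OF C] bounded_iff by blast
  have out: "u x = 0" "grad u x = 0" if "norm x > R" for x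
    using that R[of x] closure_subset[of "{x. u x \<noteq> 0}"] grad_zero_outside[of x u] by force+
  have "bounded (grad u ` ?C)"
    by (intro compact_imp_bounded compact_continuous_image C C1_grad_continuous u)
  then obtain B0 where B0: "\<And>x. x \<in> ?C \<Longrightarrow> norm (grad u x) \<le> B0" by (auto simp: bounded_iff)
  \<comment> \<open>The support may be empty, and then \<open>B0\<close> may be negative.\<close>
  define B where "B = max B0 0"
  have B: "norm (grad u x) \<le> B" for x
    using B0[of x] grad_zero_outside[of x u] by (cases "x \<in> ?C") (auto simp: B_def)
  have lip: "\<bar>u x - u y\<bar> \<le> B * norm (x - y)" for x y
  proof -
    have "norm (u x - u y) \<le> B * norm (x - y)"
    proof (rule differentiable_bound[OF convex_UNIV])
      show "(u has_derivative (\<lambda>h. h \<bullet> grad u z)) (at z within UNIV)" for z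
        using C1_GDERIV[OF u, of z] by (simp add: gderiv_def)
      show "onorm (\<lambda>h. h \<bullet> grad u z) \<le> B" for z
      proof (rule onorm_bound)
        show "norm (h \<bullet> grad u z) \<le> B * norm h" for h
          using Cauchy_Schwarz_ineq2[of h "grad u z"] mult_left_mono[OF B[of z] norm_ge_zero[of h]]
          by (simp add: mult.commute)
      qed (simp add: B_def)
    qed auto
    then show ?thesis by simp
  qed
  have ib: "integrable lborel u" and um: "u \<in> borel_measurable borel"
  proof -
    show um: "u \<in> borel_measurable borel"
      by (intro borel_measurable_continuous_onI C1_continuous u)
    have "integrable lebesgue u"
      by (rule integrable_lebesgue_compact_support[OF C1_continuous[OF u] C])
         (use closure_subset[of "{x. u x \<noteq> 0}"] in blast)
    then show "integrable lborel u" using um by (simp add: integrable_completion)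
  qed
  have trans: "integrable lborel (\<lambda>x. u (c + x))" "(LINT x|lborel. u (c + x)) = (LINT x|lborel. u x)" for c
  proof -
    have *: "lborel = distr lborel borel ((+) c)" by (rule lborel_distr_plus[symmetric])
    show "(LINT x|lborel. u (c + x)) = (LINT x|lborel. u x)"
      by (subst (2) *, subst integral_distr) (use um in auto)
    show "integrable lborel (\<lambda>x. u (c + x))"
      using ib by (subst (asm) *, subst (asm) integrable_distr_eq) (use um in auto)
  qed
  have "(LINT x|lebesgue. grad u x) \<bullet> b = 0" if b: "b \<in> Basis" for b
  proof -
    \<comment> \<open>Steps of size at most 1 keep every difference quotient supported in the ball
      of radius \<open>R + 1\<close>.\<close>
    define t where "t n = inverse (real (Suc n))" for n
    have t: "t n > 0" "t n \<le> 1" for n by (auto simp: t_def inverse_le_1_iff)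
    have t0: "t \<longlonglongrightarrow> 0" unfolding t_def by (rule LIMSEQ_inverse_real_of_nat)
    define s where "s n x = (u (t n *\<^sub>R b + x) - u x) / t n" for n x
    have s0: "(LINT x|lborel. s n x) = 0" for n
      unfolding s_def using trans[of "t n *\<^sub>R b"] ib by simp
    have lim: "(\<lambda>n. s n x) \<longlonglongrightarrow> grad u x \<bullet> b" for x
    proof -
      have "((\<lambda>r. u (x + r *\<^sub>R b)) has_vector_derivative b \<bullet> grad u x) (at 0)"
      proof -
        have "((\<lambda>r. x + r *\<^sub>R b) has_derivative (\<lambda>r. r *\<^sub>R b)) (at 0)"
          by (auto intro!: derivative_eq_intros)
        moreover have "(u has_derivative (\<lambda>h. h \<bullet> grad u x)) (at (x + 0 *\<^sub>R b))"
          using C1_GDERIV[OF u, of x] by (simp add: gderiv_def)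
        ultimately have "((\<lambda>r. u (x + r *\<^sub>R b)) has_derivative (\<lambda>r. (r *\<^sub>R b) \<bullet> grad u x)) (at 0)"
          by (rule has_derivative_compose)
        then show ?thesis by (simp add: has_vector_derivative_def)
      qed
      then have "DERIV (\<lambda>r. u (x + r *\<^sub>R b)) 0 :> b \<bullet> grad u x"
        by (simp add: has_real_derivative_iff_has_vector_derivative)
      then have "((\<lambda>h. (u (x + h *\<^sub>R b) - u x) / h) \<longlongrightarrow> b \<bullet> grad u x) (at 0)"
        by (simp add: DERIV_def)
      moreover have "filterlim t (at 0) sequentially"
        using t0 t(1) by (auto simp: filterlim_at less_imp_neq[symmetric])
      ultimately have "(\<lambda>n. (u (x + t n *\<^sub>R b) - u x) / t n) \<longlonglongrightarrow> b \<bullet> grad u x"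
        by (rule filterlim_compose)
      then show ?thesis by (simp add: s_def add.commute inner_commute)
    qed
    have sb: "\<bar>s n x\<bar> \<le> B * indicator (cball 0 (R + 1)) x" for n x
    proof (cases "norm x \<le> R + 1")
      case True
      have "\<bar>u (t n *\<^sub>R b + x) - u x\<bar> \<le> B * t n"
        using lip[of "t n *\<^sub>R b + x" x] b t(1)[of n] by simp
      then show ?thesis using True t(1)[of n] by (simp add: s_def divide_le_eq)
    next
      case False
      have "norm x \<le> norm (t n *\<^sub>R b + x) + norm (t n *\<^sub>R b)" 
        using norm_triangle_ineq4[of "t n *\<^sub>R b + x" "t n *\<^sub>R b"] by simp
      then have "norm (t n *\<^sub>R b + x) > R" using False b t[of n] by simp
      then show ?thesis using out False by (simp add: s_def)
    qed
    have "(\<lambda>n. LINT x|lborel. s n x) \<longlonglongrightarrow> (LINT x|lborel. grad u x \<bullet> b)"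
    proof (rule integral_dominated_convergence[where w = "\<lambda>x. B * indicator (cball 0 (R + 1)) x"])
      show "(\<lambda>x. grad u x \<bullet> b) \<in> borel_measurable lborel"
        using C1_grad_continuous[OF u] by (auto intro!: borel_measurable_continuous_onI continuous_intros)
      show "s n \<in> borel_measurable lborel" for n unfolding s_def using um by measurable
      show "integrable lborel (\<lambda>x. B * indicator (cball 0 (R + 1)) (x::'a))"
        using emeasure_lborel_cball_finite[of "0::'a" "R + 1"] by simp
    qed (use lim sb in auto)
    then have "(LINT x|lborel. grad u x \<bullet> b) = 0" by (simp add: s0 LIMSEQ_const_iff)
    moreover have "(LINT x|lebesgue. grad u x \<bullet> b) = (LINT x|lborel. grad u x \<bullet> b)"
      using C1_grad_continuous[OF u]
      by (intro integral_completion) (auto intro!: borel_measurable_continuous_onI continuous_intros)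
    ultimately show ?thesis using integral_inner_left[OF int, of b] by simp
  qed
  then show "(LINT x|lebesgue. grad u x) = 0" using euclidean_all_zero_iff by blast
qed

lemma continuous_imp_Lp_loc_1:
  fixes f :: "'a::euclidean_space \<Rightarrow> 'b::euclidean_space"
  assumes "open \<Omega>" "continuous_on \<Omega> f"
  shows "Lp_loc 1 \<Omega> f"
  unfolding Lp_loc_def
proof (intro conjI allI impI)
  show "f \<in> borel_measurable (lebesgue_on \<Omega>)"
    using assms by (intro continuous_imp_measurable_on_sets_lebesgue) auto
  fix C assume C: "compact C \<and> C \<subseteq> \<Omega>"
  have "integrable lborel (\<lambda>x. indicator C x *\<^sub>R (norm (f x)))"
    using C assms by (intro borel_integrable_compact continuous_on_norm) (auto intro: continuous_on_subset)
  then have "integrable lebesgue (\<lambda>x. indicator C x *\<^sub>R (norm (f x)))"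
    by (subst integrable_completion) (auto dest: borel_measurable_integrable)
  then show "set_integrable lebesgue C (\<lambda>x. norm (f x) powr 1)"
    unfolding set_integrable_def by simp
qed

text \<open>The product of \<open>u\<close> with a test function has compact support, so its
  gradient integrates to 0; the product rule splits this into the two sides of the identity.\<close>

lemma C1_weak_grad:
  assumes u: "C1 u" and \<Omega>: "open \<Omega>"
  shows "is_weak_grad \<Omega> u (grad u)"
  unfolding is_weak_grad_def
proof (intro conjI ballI)
  show "Lp_loc 1 \<Omega> u" "Lp_loc 1 \<Omega> (grad u)"
    using \<Omega> u by (auto intro: continuous_imp_Lp_loc_1 C1_continuous C1_grad_continuous)
  fix \<phi> assume \<phi>: "\<phi> \<in> Cc_infinity \<Omega>"
  let ?C = "closure {x. \<phi> x \<noteq> 0}"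
  have \<phi>1: "C1 \<phi>" using \<phi> by (rule Cc_infinity_C1)
  have C: "compact ?C" "?C \<subseteq> \<Omega>" using \<phi> by (auto simp: Cc_infinity_def)
  have out: "\<phi> x = 0" "grad \<phi> x = 0" if "x \<notin> ?C" for x
    using that closure_subset[of "{x. \<phi> x \<noteq> 0}"] grad_zero_outside[of x \<phi>] by auto
  have "{x. u x * \<phi> x \<noteq> 0} \<subseteq> {x. \<phi> x \<noteq> 0}" by auto
  then have "closure {x. u x * \<phi> x \<noteq> 0} \<subseteq> ?C" by (rule closure_mono)
  then have C': "compact (closure {x. u x * \<phi> x \<noteq> 0})"
    using compact_Int_closed[OF C(1) closed_closure, of "{x. u x * \<phi> x \<noteq> 0}"] by (simp add: Int_absorb1)
  have ints: "integrable lebesgue (\<lambda>x. u x *\<^sub>R grad \<phi> x)"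
  proof (rule integrable_lebesgue_compact_support[OF _ C(1)])
    show "continuous_on UNIV (\<lambda>x. u x *\<^sub>R grad \<phi> x)"
      by (rule continuous_on_scaleR[OF C1_continuous[OF u] C1_grad_continuous[OF \<phi>1]])
    show "u x *\<^sub>R grad \<phi> x = 0" if "x \<notin> ?C" for x
      unfolding out(2)[OF that] by (rule scaleR_zero_right)
  qed
  have ints': "integrable lebesgue (\<lambda>x. \<phi> x *\<^sub>R grad u x)"
  proof (rule integrable_lebesgue_compact_support[OF _ C(1)])
    show "continuous_on UNIV (\<lambda>x. \<phi> x *\<^sub>R grad u x)"
      by (rule continuous_on_scaleR[OF C1_continuous[OF \<phi>1] C1_grad_continuous[OF u]])
    show "\<phi> x *\<^sub>R grad u x = 0" if "x \<notin> ?C" for x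
      unfolding out(1)[OF that] by (rule scaleR_zero_left)
  qed
  have "(LINT x|lebesgue. u x *\<^sub>R grad \<phi> x + \<phi> x *\<^sub>R grad u x) = 0"
    using integral_grad_zero(2)[OF C1_mult(1)[OF u \<phi>1] C'] C1_mult(2)[OF u \<phi>1] by simp
  then have "(LINT x|lebesgue. u x *\<^sub>R grad \<phi> x) = - (LINT x|lebesgue. \<phi> x *\<^sub>R grad u x)"
    using ints ints' by (simp add: eq_neg_iff_add_eq_0)
  moreover have "indicat_real \<Omega> x *\<^sub>R u x *\<^sub>R grad \<phi> x = u x *\<^sub>R grad \<phi> x"
    "indicat_real \<Omega> x *\<^sub>R \<phi> x *\<^sub>R grad u x = \<phi> x *\<^sub>R grad u x" for x
    using out[of x] C(2) by (auto simp: indicator_def)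
  ultimately show "(LINT x:\<Omega>|lebesgue. u x *\<^sub>R grad \<phi> x) = - (LINT x:\<Omega>|lebesgue. \<phi> x *\<^sub>R grad u x)"
    by (simp only: set_lebesgue_integral_def)
qed

subsection \<open>Radial functions of finite energy\<close>

text \<open>The integrand is the reciprocal of the weight in the radial energy; the area of the unit
  sphere is left to the constant \<open>L\<close> of \<open>profile_bound\<close>.\<close>

definition radial_gap :: "nat \<Rightarrow> (real \<Rightarrow> real) \<Rightarrow> real \<Rightarrow> real \<Rightarrow> real" where
  "radial_gap N A r s = integral {r..s} (\<lambda>t. 1 / (A t * t ^ (N - 1)))"

text \<open>The second conjunct says that the profile vanishes at infinity, in a form that is preserved
  by pointwise limits.\<close>

definition profile_bound :: "nat \<Rightarrow> (real \<Rightarrow> real) \<Rightarrow> real \<Rightarrow> (real \<Rightarrow> real) \<Rightarrow> bool" where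
  "profile_bound N A L f \<longleftrightarrow>
     (\<forall>r s J. 0 < r \<and> r \<le> s \<and> 0 < J \<and> radial_gap N A r s \<le> J \<longrightarrow> \<bar>f r - f s\<bar> \<le> L * sqrt J) \<and>
     (\<forall>r J. 0 < r \<and> 0 < J \<and> (\<forall>s\<ge>r. radial_gap N A r s \<le> J) \<longrightarrow> \<bar>f r\<bar> \<le> L * sqrt J)"

lemma profile_boundI:
  assumes "\<And>r s J. 0 < r \<Longrightarrow> r \<le> s \<Longrightarrow> 0 < J \<Longrightarrow> radial_gap N A r s \<le> J \<Longrightarrow> \<bar>f r - f s\<bar> \<le> L * sqrt J"
    "\<And>r J. 0 < r \<Longrightarrow> 0 < J \<Longrightarrow> (\<And>s. r \<le> s \<Longrightarrow> radial_gap N A r s \<le> J) \<Longrightarrow> \<bar>f r\<bar> \<le> L * sqrt J"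
  shows "profile_bound N A L f"
  using assms unfolding profile_bound_def by simp

lemma profile_boundD1:
  assumes "profile_bound N A L f" "0 < r" "r \<le> s" "0 < J" "radial_gap N A r s \<le> J"
  shows "\<bar>f r - f s\<bar> \<le> L * sqrt J"
  using assms unfolding profile_bound_def by simp

lemma profile_boundD2:
  assumes "profile_bound N A L f" "0 < r" "0 < J" "\<And>s. r \<le> s \<Longrightarrow> radial_gap N A r s \<le> J"
  shows "\<bar>f r\<bar> \<le> L * sqrt J"
  using assms unfolding profile_bound_def by simp

text \<open>Every inequality involves function values at no more than two fixed radii and a fixed
  \<open>J\<close>, so pointwise convergence suffices, without uniformity.\<close>

lemma profile_bound_limit:
  assumes "\<And>n. profile_bound N A (L n) (f n)" "\<And>r. 0 < r \<Longrightarrow> (\<lambda>n. f n r) \<longlonglongrightarrow> g r" "L \<longlonglongrightarrow> M"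
  shows "profile_bound N A M g"
proof (rule profile_boundI)
  fix r s J :: real assume *: "0 < r" "r \<le> s" "0 < J" "radial_gap N A r s \<le> J"
  have "(\<lambda>n. \<bar>f n r - f n s\<bar>) \<longlonglongrightarrow> \<bar>g r - g s\<bar>"
    using * by (intro tendsto_intros assms(2)) auto
  moreover have "(\<lambda>n. L n * sqrt J) \<longlonglongrightarrow> M * sqrt J" by (intro tendsto_intros assms(3))
  ultimately show "\<bar>g r - g s\<bar> \<le> M * sqrt J"
    by (rule LIMSEQ_le) (simp add: profile_boundD1[OF assms(1) *])
next
  fix r J :: real assume *: "0 < r" "0 < J" "\<And>s. r \<le> s \<Longrightarrow> radial_gap N A r s \<le> J"
  have "(\<lambda>n. \<bar>f n r\<bar>) \<longlonglongrightarrow> \<bar>g r\<bar>"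
    using * by (intro tendsto_intros assms(2)) auto
  moreover have "(\<lambda>n. L n * sqrt J) \<longlonglongrightarrow> M * sqrt J" by (intro tendsto_intros assms(3))
  ultimately show "\<bar>g r\<bar> \<le> M * sqrt J"
    by (rule LIMSEQ_le) (simp add: profile_boundD2[OF assms(1) *])
qed

lemma profile_bound_mono:
  assumes "profile_bound N A L f" "L \<le> M"
  shows "profile_bound N A M f"
proof -
  have le: "L * sqrt J \<le> M * sqrt J" if "0 < J" for J
    using assms(2) that by (intro mult_right_mono) auto
  show ?thesis
    by (rule profile_boundI)
       (blast intro: order_trans[OF profile_boundD1[OF assms(1)] le],
        rule order_trans[OF profile_boundD2[OF assms(1)] le], simp_all)
qed

lemma profile_bound_diff:
  assumes "profile_bound N A L f" "profile_bound N A M g"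
  shows "profile_bound N A (L + M) (\<lambda>r. f r - g r)"
proof (rule profile_boundI)
  fix r s J :: real assume *: "0 < r" "r \<le> s" "0 < J" "radial_gap N A r s \<le> J"
  show "\<bar>(f r - g r) - (f s - g s)\<bar> \<le> (L + M) * sqrt J"
    using profile_boundD1[OF assms(1) *] profile_boundD1[OF assms(2) *]
    unfolding distrib_right by linarith
next
  fix r J :: real assume *: "0 < r" "0 < J" "\<And>s. r \<le> s \<Longrightarrow> radial_gap N A r s \<le> J"
  show "\<bar>f r - g r\<bar> \<le> (L + M) * sqrt J"
    using profile_boundD2[OF assms(1) *] profile_boundD2[OF assms(2) *]
    unfolding distrib_right by linarith
qed

section \<open>Estimates of the radial gap\<close>

lemma continuous_on_inverse_weight:
  assumes "continuous_on {0<..} A" "0 < r" "\<And>t. r \<le> t \<Longrightarrow> t \<le> s \<Longrightarrow> 0 < A t"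
  shows "continuous_on {r..s} (\<lambda>t. 1 / (A t * t ^ n :: real))"
proof (intro continuous_on_divide continuous_on_mult continuous_on_const continuous_on_power
    continuous_on_id ballI)
  show "continuous_on {r..s} A" using assms(2) by (intro continuous_on_subset[OF assms(1)]) auto
  show "A t * t ^ n \<noteq> 0" if "t \<in> {r..s}" for t using assms(2) assms(3)[of t] that by simp
qed

text \<open>The integrand is bounded on a compact interval. Through \<open>profile_bound\<close>
  this makes profiles Hoelder continuous of order 1/2 there, with a common constant.\<close>

lemma radial_gap_le_linear:
  assumes A: "continuous_on {0<..} A" "\<And>t. 0 < t \<Longrightarrow> 0 < A t" and ab: "0 < a"
  obtains M where "0 < M" "\<And>r s. a \<le> r \<Longrightarrow> r \<le> s \<Longrightarrow> s \<le> b \<Longrightarrow> radial_gap N A r s \<le> M * (s - r)"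
proof -
  have cont: "continuous_on {a..b} (\<lambda>t. 1 / (A t * t ^ (N - 1)))"
    by (rule continuous_on_inverse_weight[OF A(1) ab]) (use ab A(2) in auto)
  have "bounded ((\<lambda>t. 1 / (A t * t ^ (N - 1))) ` {a..b})"
    by (intro compact_imp_bounded compact_continuous_image cont) auto
  then obtain M0 where M0: "\<And>t. t \<in> {a..b} \<Longrightarrow> norm (1 / (A t * t ^ (N - 1))) \<le> M0"
    unfolding bounded_iff by blast
  show ?thesis
  proof (rule that[of "max M0 1"])
    fix r s assume *: "a \<le> r" "r \<le> s" "s \<le> b"
    have "integral {r..s} (\<lambda>t. 1 / (A t * t ^ (N - 1))) \<le> integral {r..s} (\<lambda>_. max M0 1)"
    proof (rule integral_le)
      show "(\<lambda>t. 1 / (A t * t ^ (N - 1))) integrable_on {r..s}"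
        using * by (intro integrable_continuous_interval continuous_on_subset[OF cont]) auto
      show "1 / (A t * t ^ (N - 1)) \<le> max M0 1" if "t \<in> {r..s}" for t
        using order_trans[OF abs_ge_self M0[of t, unfolded real_norm_def]] that * by simp
    qed auto
    then show "radial_gap N A r s \<le> max M0 1 * (s - r)"
      using * by (simp add: radial_gap_def mult.commute)
  qed auto
qed

text \<open>With \<open>g = N + a - 2 > 0\<close> the integrand is at most
  \<open>t powr (- g - 1) / c\<close>, which has an explicit antiderivative; the contribution of the
  far end \<open>s\<close> has a favourable sign and is dropped. The bound is thus uniform in
  \<open>s\<close>.\<close>

lemma radial_gap_powr:
  assumes A: "continuous_on {0<..} A" and N: "N \<ge> 1" and c: "0 < c" and a: "0 < real N + a - 2"
    and rs: "0 < r" "r \<le> s" and low: "\<And>t. r \<le> t \<Longrightarrow> t \<le> s \<Longrightarrow> c * t powr a \<le> A t"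
  shows "radial_gap N A r s \<le> r powr - (real N + a - 2) / (c * (real N + a - 2))"
proof -
  define g where "g = real N + a - 2"
  have g: "0 < g" using a by (simp add: g_def)
  have pos: "0 < A t" if "r \<le> t" "t \<le> s" for t
    using low[OF that] c rs that by (intro less_le_trans[OF _ low[OF that]]) simp
  have int: "((\<lambda>t. t powr (- g - 1) / c) has_integral (- (s powr - g) / (c * g) - (- (r powr - g) / (c * g)))) {r..s}"
  proof (rule fundamental_theorem_of_calculus[OF rs(2)])
    fix t assume t: "t \<in> {r..s}"
    have "((\<lambda>t. - (t powr - g) / (c * g)) has_real_derivative t powr (- g - 1) / c) (at t)"
      using t rs c g by (auto intro!: derivative_eq_intros)
    then show "((\<lambda>t. - (t powr - g) / (c * g)) has_vector_derivative t powr (- g - 1) / c) (at t within {r..s})"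
      by (simp add: has_real_derivative_iff_has_vector_derivative[symmetric] has_field_derivative_at_within)
  qed
  have "radial_gap N A r s \<le> integral {r..s} (\<lambda>t. t powr (- g - 1) / c)"
    unfolding radial_gap_def
  proof (rule integral_le)
    show "(\<lambda>t. 1 / (A t * t ^ (N - 1))) integrable_on {r..s}"
      by (intro integrable_continuous_interval continuous_on_inverse_weight[OF A rs(1)] pos)
    show "(\<lambda>t. t powr (- g - 1) / c) integrable_on {r..s}" using int by blast
    fix t assume t: "t \<in> {r..s}"
    then have t0: "0 < t" using rs by auto
    have "t powr (g + 1) = t powr a * t ^ (N - 1)"
      using t0 N by (simp add: g_def powr_realpow[symmetric] powr_add[symmetric] of_nat_diff algebra_simps)
    then have "c * t powr (g + 1) \<le> A t * t ^ (N - 1)"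
      using low[of t] t t0 by (simp add: mult.assoc[symmetric] mult_right_mono)
    then have "1 / (A t * t ^ (N - 1)) \<le> 1 / (c * t powr (g + 1))"
      using c t0 by (intro divide_left_mono mult_pos_pos pos) (use t in auto)
    also have "\<dots> = t powr (- g - 1) / c"
    proof -
      have "- g - 1 = - (g + 1)" by simp
      then show ?thesis by (simp only: powr_minus) (simp add: field_simps)
    qed
    finally show "1 / (A t * t ^ (N - 1)) \<le> t powr (- g - 1) / c" .
  qed
  also have "\<dots> = r powr - g / (c * g) - s powr - g / (c * g)" unfolding integral_unique[OF int] by simp
  also have "\<dots> \<le> r powr - g / (c * g)" using c a by (simp add: g_def)
  finally show ?thesis by (simp add: g_def)
qed

lemma lower_power_bound:
  fixes A :: "real \<Rightarrow> real"
  assumes A: "continuous_on {0<..} A" "\<And>t. 0 < t \<Longrightarrow> 0 < A t" and p: "0 < p" "p \<le> q"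
  obtains c where "0 < c" "\<And>t. p \<le> t \<Longrightarrow> t \<le> q \<Longrightarrow> c * t powr a \<le> A t"
proof -
  have "continuous_on {p..q} (\<lambda>t. A t / t powr a)"
    using p by (intro continuous_intros continuous_on_subset[OF A(1)]) auto
  then obtain t0 where t0: "t0 \<in> {p..q}" "\<And>t. t \<in> {p..q} \<Longrightarrow> A t0 / t0 powr a \<le> A t / t powr a"
    using continuous_attains_inf[of "{p..q}" "\<lambda>t. A t / t powr a"] p by auto
  show ?thesis
  proof (rule that[of "A t0 / t0 powr a"])
    show "0 < A t0 / t0 powr a" using t0(1) p A(2)[of t0] by auto
    show "A t0 / t0 powr a * t powr a \<le> A t" if "p \<le> t" "t \<le> q" for t
    proof -
      have "0 < t powr a" using that p by simp
      then show ?thesis using t0(2)[of t] that by (simp only: pos_le_divide_eq atLeastAtMost_iff)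
    qed
  qed
qed

text \<open>Half of each lower limit serves near 0 and near infinity; on the two compact intervals
  that remain on either side of \<open>R\<close>, continuity and positivity give a minimum. The
  radius \<open>R\<close> is free, which later lets the estimate at infinity start anywhere.\<close>

lemma hyp_A_lower_bounds:
  assumes A: "hyp_A N A a0 ainf" and R: "0 < R"
  obtains c where "0 < c" "\<And>t. 0 < t \<Longrightarrow> t \<le> R \<Longrightarrow> c * t powr a0 \<le> A t"
    "\<And>t. R \<le> t \<Longrightarrow> c * t powr ainf \<le> A t"
proof -
  have cont: "continuous_on {0<..} A" and pos: "\<And>t. 0 < t \<Longrightarrow> 0 < A t"
    using A unfolding hyp_A_def by auto
  obtain c0 cinf where c: "0 < c0" "0 < cinf"
    and l0: "ereal c0 \<le> Liminf (at_right 0) (\<lambda>r. ereal (A r / r powr a0))"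
    and li: "ereal cinf \<le> Liminf at_top (\<lambda>r. ereal (A r / r powr ainf))"
    using A unfolding hyp_A_def by blast
  have "ereal (c0 / 2) < Liminf (at_right 0) (\<lambda>r. ereal (A r / r powr a0))"
    using c by (intro less_le_trans[OF _ l0]) simp
  then have "eventually (\<lambda>r. ereal (c0 / 2) < ereal (A r / r powr a0)) (at_right 0)"
    by (rule less_LiminfD)
  then obtain d where d: "0 < d" "\<And>t. 0 < t \<Longrightarrow> t < d \<Longrightarrow> c0 / 2 < A t / t powr a0"
    unfolding eventually_at_right_field by auto
  have "ereal (cinf / 2) < Liminf at_top (\<lambda>r. ereal (A r / r powr ainf))"
    using c by (intro less_le_trans[OF _ li]) simp
  then have "eventually (\<lambda>r. ereal (cinf / 2) < ereal (A r / r powr ainf)) at_top"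
    by (rule less_LiminfD)
  then obtain D where D: "\<And>t. D \<le> t \<Longrightarrow> cinf / 2 < A t / t powr ainf"
    unfolding eventually_at_top_linorder by auto
  obtain e0 where e0: "0 < e0" "\<And>t. min (d / 2) R \<le> t \<Longrightarrow> t \<le> R \<Longrightarrow> e0 * t powr a0 \<le> A t"
    using lower_power_bound[OF cont pos, of "min (d / 2) R" R a0] d R by auto
  obtain e1 where e1: "0 < e1" "\<And>t. R \<le> t \<Longrightarrow> t \<le> max D R \<Longrightarrow> e1 * t powr ainf \<le> A t"
    using lower_power_bound[OF cont pos, of R "max D R" ainf] R by auto
  define c where "c = min (min (c0 / 2) (cinf / 2)) (min e0 e1)"
  have cle: "c \<le> c0 / 2" "c \<le> cinf / 2" "c \<le> e0" "c \<le> e1" by (auto simp: c_def)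
  show ?thesis
  proof (rule that[of c])
    show "0 < c" using c e0 e1 by (simp add: c_def)
    show "c * t powr a0 \<le> A t" if "0 < t" "t \<le> R" for t
    proof (cases "t < d")
      case True
      have "c0 / 2 * t powr a0 \<le> A t" using d(2)[OF that(1) True] that(1) by (simp add: pos_less_divide_eq)
      then show ?thesis using mult_right_mono[OF cle(1), of "t powr a0"] by simp
    next
      case False
      then have "e0 * t powr a0 \<le> A t" using d(1) that by (intro e0(2)) auto
      then show ?thesis using mult_right_mono[OF cle(3), of "t powr a0"] by simp
    qed
    show "c * t powr ainf \<le> A t" if "R \<le> t" for t
    proof (cases "D \<le> t")
      case True
      have "cinf / 2 * t powr ainf \<le> A t" using D[OF True] that R by (simp add: pos_less_divide_eq)
      then show ?thesis using mult_right_mono[OF cle(2), of "t powr ainf"] by simp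
    next
      case False
      then have "e1 * t powr ainf \<le> A t" using that by (intro e1(2)) auto
      then show ?thesis using mult_right_mono[OF cle(4), of "t powr ainf"] by simp
    qed
  qed
qed

text \<open>Only the case \<open>r < R < s\<close> mixes the two powers. The gap is then split at
  \<open>R\<close>, and the outer piece is a constant that the inner power absorbs.\<close>

lemma radial_gap_bounds:
  assumes A: "hyp_A N A a0 ainf" and R: "0 < R" and N: "N \<ge> 1"
  obtains C where "0 < C"
    "\<And>r s. 0 < r \<Longrightarrow> r \<le> R \<Longrightarrow> r \<le> s \<Longrightarrow> radial_gap N A r s \<le> C * r powr - (real N + a0 - 2)"
    "\<And>r s. R \<le> r \<Longrightarrow> r \<le> s \<Longrightarrow> radial_gap N A r s \<le> C * r powr - (real N + ainf - 2)"
proof -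
  define g0 where "g0 = real N + a0 - 2"
  define gi where "gi = real N + ainf - 2"
  have cont: "continuous_on {0<..} A" and pos: "\<And>t. 0 < t \<Longrightarrow> 0 < A t" and g: "0 < g0" "0 < gi"
    using A unfolding hyp_A_def g0_def gi_def by auto
  obtain c where c: "0 < c" "\<And>t. 0 < t \<Longrightarrow> t \<le> R \<Longrightarrow> c * t powr a0 \<le> A t"
    "\<And>t. R \<le> t \<Longrightarrow> c * t powr ainf \<le> A t"
    by (rule hyp_A_lower_bounds[OF A R]) (rule that; blast)
  define C where "C = 1 / (c * g0) + 1 / (c * gi) + R powr g0 * R powr - gi / (c * gi)"
  have inf: "radial_gap N A r s \<le> r powr - gi / (c * gi)" if "R \<le> r" "r \<le> s" for r s
    using radial_gap_powr[OF cont N c(1), of ainf r s] c(3) that R g by (simp add: gi_def)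
  have zero: "radial_gap N A r s \<le> r powr - g0 / (c * g0)" if "0 < r" "s \<le> R" "r \<le> s" for r s
    using radial_gap_powr[OF cont N c(1), of a0 r s] c(2) that R g by (simp add: g0_def)
  show ?thesis
  proof (rule that[of C])
    show "0 < C" using c g R by (auto simp: C_def intro!: add_pos_nonneg)
    show "radial_gap N A r s \<le> C * r powr - (real N + ainf - 2)" if "R \<le> r" "r \<le> s" for r s
    proof -
      have "1 / (c * gi) \<le> C" using c g by (simp add: C_def)
      from mult_right_mono[OF this, of "r powr - gi"] inf[OF that]
      show ?thesis by (simp add: gi_def)
    qed
    show "radial_gap N A r s \<le> C * r powr - (real N + a0 - 2)" if rs: "0 < r" "r \<le> R" "r \<le> s" for r s
    proof (cases "s \<le> R")
      case True
      have "1 / (c * g0) \<le> C" using c g by (simp add: C_def)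
      from mult_right_mono[OF this, of "r powr - g0"] zero[OF rs(1) True rs(3)]
      show ?thesis by (simp add: g0_def)
    next
      case False
      have "(\<lambda>t. 1 / (A t * t ^ (N - 1))) integrable_on {r..s}"
        by (intro integrable_continuous_interval continuous_on_inverse_weight[OF cont rs(1)])
           (use rs pos in auto)
      then have "radial_gap N A r s = radial_gap N A r R + radial_gap N A R s"
        unfolding radial_gap_def using False rs by (intro Henstock_Kurzweil_Integration.integral_combine[symmetric]) auto
      also have "\<dots> \<le> r powr - g0 / (c * g0) + R powr - gi / (c * gi)"
        using zero[of r R] inf[of R s] rs False by (intro add_mono) auto
      \<comment> \<open>Since \<open>R / r\<close> is at least 1, multiplying the constant by
        \<open>(R / r) powr g0\<close> enlarges it and produces the desired power of
        \<open>r\<close>.\<close>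
      also have "R powr - gi / (c * gi) \<le> R powr g0 * R powr - gi / (c * gi) * r powr - g0"
      proof -
        have "1 \<le> (R / r) powr g0" using rs g by (intro ge_one_powr_ge_zero) auto
        also have "(R / r) powr g0 = R powr g0 * r powr - g0"
          using rs R by (simp add: powr_divide powr_minus field_simps)
        finally have "1 * (R powr - gi / (c * gi)) \<le> R powr g0 * r powr - g0 * (R powr - gi / (c * gi))"
          using c g by (intro mult_right_mono) auto
        then show ?thesis by (simp add: mult_ac)
      qed
      finally have "radial_gap N A r s \<le> (1 / (c * g0) + R powr g0 * R powr - gi / (c * gi)) * r powr - g0"
        by (simp add: algebra_simps)
      also have "\<dots> \<le> C * r powr - g0" using c g by (intro mult_right_mono) (auto simp: C_def)
      finally show ?thesis by (simp add: g0_def)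
    qed
  qed
qed

section \<open>Energy bounds for test functions and their profiles\<close>

abbreviation (input) energy_density ::
  "(real \<Rightarrow> real) \<Rightarrow> ('a::euclidean_space \<Rightarrow> 'a) \<Rightarrow> 'a \<Rightarrow> real" where
  "energy_density A g \<equiv> \<lambda>x. A (norm x) * (norm (g x))\<^sup>2"

text \<open>\<open>S_space\<close> with smoothness relaxed to \<open>C1\<close>: a class in which
  differences of approximating functions can be handled directly.\<close>

definition finite_energy :: "(real \<Rightarrow> real) \<Rightarrow> ('a::euclidean_space \<Rightarrow> real) \<Rightarrow> bool" where
  "finite_energy A u \<longleftrightarrow> C1 u \<and> radial u \<and> compact (closure {x. u x \<noteq> 0}) \<and>
     integrable lebesgue (energy_density A (grad u))"

lemma S_space_finite_energy: "u \<in> S_space A \<Longrightarrow> finite_energy A u"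
  by (auto simp: S_space_def finite_energy_def Cc_infinity_def intro: Cc_infinity_C1[of _ UNIV])

lemma norm_diff_squared_le:
  fixes a b :: "'a::real_inner"
  shows "(norm (a - b))\<^sup>2 \<le> 2 * (norm a)\<^sup>2 + 2 * (norm b)\<^sup>2"
proof -
  have "(norm (a - b))\<^sup>2 + (norm (a + b))\<^sup>2 = 2 * (norm a)\<^sup>2 + 2 * (norm b)\<^sup>2"
    by (simp add: power2_norm_eq_inner algebra_simps inner_commute)
  then show ?thesis using zero_le_power2[of "norm (a + b)"] by linarith
qed

lemma AE_norm_pos: "AE x in lebesgue. 0 < norm (x::'a::euclidean_space)"
proof -
  have "AE x in lebesgue. x \<notin> {0::'a}" by (rule AE_not_in) simp
  then show ?thesis by eventually_elim simp
qed

lemma A_energy_nonneg: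
  assumes "\<And>t. 0 < t \<Longrightarrow> 0 < A t"
  shows "0 \<le> A_energy A g"
  unfolding A_energy_def
proof (rule integral_nonneg_AE)
  show "AE x in lebesgue. 0 \<le> A (norm x) * (norm (g x))\<^sup>2"
    using AE_norm_pos by eventually_elim (simp add: assms less_imp_le)
qed

lemma continuous_on_pos_measurable_norm:
  fixes A :: "real \<Rightarrow> real"
  assumes "continuous_on {0<..} A"
  shows "(\<lambda>x::'a::euclidean_space. A (norm x)) \<in> borel_measurable lebesgue"
  by (intro measurable_norm_comp continuous_imp_measurable_on_sets_lebesgue assms) simp

text \<open>Integrability is proved along with the bound because the integral of a non-integrable
  function is 0 by convention, so an inequality between values of \<open>A_energy\<close> alone
  would say nothing. The factors 2 come from the parallelogram identity.\<close>

lemma energy_diff: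
  fixes f g :: "'a::euclidean_space \<Rightarrow> 'a"
  assumes A: "continuous_on {0<..} A" "\<And>t. 0 < t \<Longrightarrow> 0 < A t"
    and meas: "f \<in> borel_measurable lebesgue" "g \<in> borel_measurable lebesgue"
    and f: "integrable lebesgue (energy_density A f)"
    and g: "integrable lebesgue (energy_density A g)"
  shows "integrable lebesgue (energy_density A (\<lambda>x. f x - g x))"
    and "A_energy A (\<lambda>x. f x - g x) \<le> 2 * A_energy A f + 2 * A_energy A g"
proof -
  let ?B = "\<lambda>x. 2 * (A (norm x) * (norm (f x))\<^sup>2) + 2 * (A (norm x) * (norm (g x))\<^sup>2)"
  have Bi: "integrable lebesgue ?B" using f g by simp
  have le: "AE x in lebesgue. 0 \<le> A (norm x) * (norm (f x - g x))\<^sup>2 \<and> A (norm x) * (norm (f x - g x))\<^sup>2 \<le> ?B x"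
    using AE_norm_pos
  proof eventually_elim
    case (elim x)
    from mult_left_mono[OF norm_diff_squared_le[of "f x" "g x"] less_imp_le[OF A(2)[OF elim]]]
    show ?case using A(2)[OF elim] by (simp add: algebra_simps)
  qed
  show i: "integrable lebesgue (energy_density A (\<lambda>x. f x - g x))"
  proof (rule Bochner_Integration.integrable_bound[OF Bi])
    have "(\<lambda>x. (norm (f x - g x))\<^sup>2) \<in> borel_measurable lebesgue"
      using meas by measurable
    then show "energy_density A (\<lambda>x. f x - g x) \<in> borel_measurable lebesgue"
      by (intro borel_measurable_times continuous_on_pos_measurable_norm A)
    show "AE x in lebesgue. norm (A (norm x) * (norm (f x - g x))\<^sup>2) \<le> norm (?B x)"
      using le by eventually_elim (simp only: real_norm_def, linarith)
  qed
  have "A_energy A (\<lambda>x. f x - g x) \<le> integral\<^sup>L lebesgue ?B"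
    unfolding A_energy_def using le by (intro integral_mono_AE i Bi) (auto elim: eventually_mono)
  also have "\<dots> = 2 * A_energy A f + 2 * A_energy A g"
    unfolding A_energy_def using f g by simp
  finally show "A_energy A (\<lambda>x. f x - g x) \<le> 2 * A_energy A f + 2 * A_energy A g" .
qed

lemma compact_closure_subset:
  assumes "compact K" "closure S \<subseteq> K"
  shows "compact (closure S)"
  using compact_Int_closed[OF assms(1) closed_closure[of S]] Int_absorb1[OF assms(2)] by simp

lemma radialD: "radial u \<Longrightarrow> norm x = norm y \<Longrightarrow> u x = u y"
  unfolding radial_def by blast

lemma finite_energy_diff:
  assumes A: "continuous_on {0<..} A" "\<And>t. 0 < t \<Longrightarrow> 0 < A t"
    and u: "finite_energy A u" and v: "finite_energy A v"
  shows "finite_energy A (\<lambda>x. u x - v x)"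
proof -
  have 1: "C1 u" "C1 v" using u v by (auto simp: finite_energy_def)
  note d = C1_diff[OF 1]
  have "{x. u x - v x \<noteq> 0} \<subseteq> {x. u x \<noteq> 0} \<union> {x. v x \<noteq> 0}" by auto
  from closure_mono[OF this]
  have "closure {x. u x - v x \<noteq> 0} \<subseteq> closure {x. u x \<noteq> 0} \<union> closure {x. v x \<noteq> 0}"
    unfolding closure_Un .
  moreover have "compact (closure {x. u x \<noteq> 0} \<union> closure {x. v x \<noteq> 0})"
    using u v by (intro compact_Un) (auto simp: finite_energy_def)
  ultimately have "compact (closure {x. u x - v x \<noteq> 0})"
    by (rule compact_closure_subset[rotated])
  moreover have "radial (\<lambda>x. u x - v x)"
    unfolding radial_def
  proof (intro allI impI)
    fix x y :: 'a assume xy: "norm x = norm y"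
    have "radial u" "radial v" using u v by (simp_all add: finite_energy_def)
    then show "u x - v x = u y - v y" by (intro arg_cong2[where f = minus] radialD[OF _ xy])
  qed
  moreover have "integrable lebesgue (energy_density A (\<lambda>x. grad u x - grad v x))"
    using u v unfolding finite_energy_def
    by (intro energy_diff(1)[OF A] continuous_imp_lebesgue_measurable C1_grad_continuous 1) blast+
  ultimately show ?thesis unfolding finite_energy_def d by (simp add: d)
qed

lemma C1_DERIV_ray:
  assumes "C1 u"
  shows "DERIV (\<lambda>t. u (t *\<^sub>R b)) t :> b \<bullet> grad u (t *\<^sub>R b)"
proof -
  have "((\<lambda>t. t *\<^sub>R b) has_derivative (\<lambda>h. h *\<^sub>R b)) (at t)"
    by (auto intro!: derivative_eq_intros)
  moreover have "(u has_derivative (\<lambda>h. h \<bullet> grad u (t *\<^sub>R b))) (at (t *\<^sub>R b))"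
    using C1_GDERIV[OF assms, of "t *\<^sub>R b"] by (simp add: gderiv_def)
  ultimately have "((\<lambda>t. u (t *\<^sub>R b)) has_derivative (\<lambda>h. (h *\<^sub>R b) \<bullet> grad u (t *\<^sub>R b))) (at t)"
    by (rule has_derivative_compose)
  then show ?thesis
    by (simp add: has_real_derivative_iff_has_vector_derivative has_vector_derivative_def)
qed

text \<open>Takes the place of the Cauchy-Schwarz inequality: it is applied under the integral with
  a weight \<open>p\<close> that may depend on the point, and a free constant in \<open>p\<close> is
  adjusted afterwards.\<close>

lemma young_weight:
  fixes p y :: real
  assumes "0 < p"
  shows "\<bar>y\<bar> \<le> p * y\<^sup>2 / 2 + 1 / (2 * p)"
proof -
  have "0 \<le> (p * \<bar>y\<bar> - 1)\<^sup>2" by simp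
  then have "2 * p * \<bar>y\<bar> \<le> p * (p * y\<^sup>2) + 1" by (simp add: power2_eq_square algebra_simps)
  then show ?thesis using assms by (simp add: field_simps power2_eq_square)
qed

text \<open>The derivative of the profile is the derivative of \<open>u\<close> along whichever ray
  passes through \<open>x\<close>, so it is dominated by the gradient there. Polar coordinates turn
  the one-dimensional integral into one over a shell.\<close>

lemma finite_energy_radial_integral:
  fixes u :: "'a::euclidean_space \<Rightarrow> real" and e :: 'a
  assumes A: "continuous_on {0<..} A" "\<And>t. 0 < t \<Longrightarrow> 0 < A t"
    and u: "finite_energy A u" and e: "norm e = 1" and rs: "0 < r"
  defines "f' \<equiv> \<lambda>t. e \<bullet> grad u (t *\<^sub>R e)"
  shows "integral {r..s} (\<lambda>t. sphere_area DIM('a) * t ^ (DIM('a) - 1) * (A t * (f' t)\<^sup>2))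
    \<le> A_energy A (grad u)"
proof -
  let ?\<omega> = "sphere_area DIM('a)"
  have C1: "C1 u" and rad: "radial u" and int: "integrable lebesgue (energy_density A (grad u))"
    using u by (auto simp: finite_energy_def)
  have f'_cont: "continuous_on S f'" for S
    unfolding f'_def
    by (intro continuous_on_inner continuous_on_const
        continuous_on_compose2[OF C1_grad_continuous[OF C1, of UNIV]] continuous_intros) auto
  have f'_le: "\<bar>f' (norm x)\<bar> \<le> norm (grad u x)" if "x \<noteq> 0" for x
  proof -
    \<comment> \<open>Radial symmetry exchanges the fixed direction \<open>e\<close> for the
      direction of \<open>x\<close>.\<close>
    have "(\<lambda>t. u (t *\<^sub>R e)) = (\<lambda>t. u (t *\<^sub>R sgn x))"
      using that e by (intro ext radialD[OF rad]) (simp add: norm_sgn)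
    then have "DERIV (\<lambda>t. u (t *\<^sub>R e)) (norm x) :> sgn x \<bullet> grad u (norm x *\<^sub>R sgn x)"
      using C1_DERIV_ray[OF C1, of "sgn x" "norm x"] by simp
    then have "f' (norm x) = sgn x \<bullet> grad u x"
      using C1_DERIV_ray[OF C1, of e "norm x"] that unfolding f'_def
      by (auto dest: DERIV_unique simp: sgn_div_norm)
    then show ?thesis using Cauchy_Schwarz_ineq2[of "sgn x" "grad u x"] that by (simp add: norm_sgn)
  qed
  let ?h = "\<lambda>t. A t * (f' t)\<^sup>2"
  let ?G = "\<lambda>t. ?\<omega> * t ^ (DIM('a) - 1) * ?h t"
  have Ac: "continuous_on {r..s} A" using rs by (intro continuous_on_subset[OF A(1)]) auto
  have hc: "continuous_on {r..s} ?h" by (intro continuous_intros Ac f'_cont)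
  have Gc: "continuous_on {r..s} ?G" by (intro continuous_on_mult[OF _ hc] continuous_intros)
  have hm: "(\<lambda>t. indicator {r..s} t *\<^sub>R ?h t) \<in> borel_measurable borel"
    by (rule borel_measurable_continuous_on_indicator[OF _ hc]) simp
  have Gi: "set_integrable lborel {r..s} ?G" by (rule borel_integrable_atLeastAtMost'[OF Gc])
  have "ennreal (integral {r..s} ?G) = ennreal (LINT t|lborel. indicator {r..s} t *\<^sub>R ?G t)"
    using set_borel_integral_eq_integral(2)[OF Gi] by (simp add: set_lebesgue_integral_def)
  also have "\<dots> = (\<integral>\<^sup>+ t. ennreal (indicator {r..s} t *\<^sub>R ?G t) \<partial>lborel)"
    using Gi rs A(2) unfolding set_integrable_def
    by (intro nn_integral_eq_integral[symmetric]) (auto simp: indicator_def less_imp_le)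
  also have "\<dots> = (\<integral>\<^sup>+ t. ennreal (sphere_weight DIM('a) t) * ennreal (indicator {r..s} t *\<^sub>R ?h t) \<partial>lborel)"
    using rs by (intro nn_integral_cong)
      (auto simp: indicator_def sphere_weight_def ennreal_mult'[symmetric])
  also have "\<dots> = (\<integral>\<^sup>+ x. ennreal (indicator {r..s} (norm (x::'a)) *\<^sub>R ?h (norm x)) \<partial>lborel)"
    by (rule nn_integral_norm[symmetric, OF measurable_compose[OF hm measurable_ennreal]])
  also have "\<dots> = (\<integral>\<^sup>+ x. ennreal (indicator {r..s} (norm (x::'a)) *\<^sub>R ?h (norm x)) \<partial>lebesgue)"
    by (rule nn_integral_completion[symmetric])
  also have "\<dots> \<le> (\<integral>\<^sup>+ x. ennreal (A (norm x) * (norm (grad u x))\<^sup>2) \<partial>lebesgue)"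
  proof (intro nn_integral_mono_AE)
    show "AE x in lebesgue. ennreal (indicator {r..s} (norm (x::'a)) *\<^sub>R ?h (norm x))
        \<le> ennreal (A (norm x) * (norm (grad u x))\<^sup>2)"
      using AE_norm_pos
    proof eventually_elim
      case (elim x)
      then have "\<bar>f' (norm x)\<bar>\<^sup>2 \<le> (norm (grad u x))\<^sup>2" by (intro power_mono f'_le) auto
      then have "A (norm x) * (f' (norm x))\<^sup>2 \<le> A (norm x) * (norm (grad u x))\<^sup>2"
        using A(2)[OF elim] by (intro mult_left_mono) auto
      then show ?case using A(2)[OF elim] by (auto simp: indicator_def intro!: ennreal_leI)
    qed
  qed
  also have "\<dots> = ennreal (A_energy A (grad u))"
    unfolding A_energy_def
  proof (rule nn_integral_eq_integral[OF int])
    show "AE x in lebesgue. 0 \<le> A (norm x) * (norm (grad u x))\<^sup>2"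
      using AE_norm_pos by eventually_elim (simp add: A(2) less_imp_le)
  qed
  finally show ?thesis
    using A_energy_nonneg[of A "grad u", OF A(2)] by (simp add: ennreal_le_iff)
qed

text \<open>Fundamental theorem of calculus along a ray, with Young's inequality for the weight
  \<open>c * A t * t ^ (N - 1)\<close>. A positive \<open>L\<close> above the norm replaces the norm
  itself, since \<open>c\<close> divides by \<open>L\<close> and the energy may vanish; likewise
  \<open>J\<close> must be positive.\<close>

lemma finite_energy_profile_bound:
  fixes u :: "'a::euclidean_space \<Rightarrow> real" and e :: 'a
  assumes A: "continuous_on {0<..} A" "\<And>t. 0 < t \<Longrightarrow> 0 < A t"
    and u: "finite_energy A u" and e: "norm e = 1" and L: "0 < L" "A_energy A (grad u) \<le> L\<^sup>2"
  shows "profile_bound DIM('a) A (L / sqrt (sphere_area DIM('a))) (\<lambda>t. u (t *\<^sub>R e))"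
proof (rule profile_boundI)
  define \<omega> where "\<omega> = sphere_area DIM('a)"
  have \<omega>: "0 < \<omega>" by (simp add: \<omega>_def)
  have C1: "C1 u" and supp: "compact (closure {x. u x \<noteq> 0})"
    using u by (auto simp: finite_energy_def)
  define f' where "f' = (\<lambda>t. e \<bullet> grad u (t *\<^sub>R e))"
  have f'_cont: "continuous_on S f'" for S
    unfolding f'_def
    by (intro continuous_on_inner continuous_on_const
        continuous_on_compose2[OF C1_grad_continuous[OF C1, of UNIV]] continuous_intros) auto
  have main: "\<bar>u (r *\<^sub>R e) - u (s *\<^sub>R e)\<bar> \<le> L / sqrt \<omega> * sqrt J"
    if rs: "0 < r" "r \<le> s" "0 < J" "radial_gap DIM('a) A r s \<le> J" for r s J
  proof -
    let ?W = "\<lambda>t. A t * t ^ (DIM('a) - 1)"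
    let ?E = "\<lambda>t. \<omega> * t ^ (DIM('a) - 1) * (A t * (f' t)\<^sup>2)"
    \<comment> \<open>This value makes the energy term and the gap term equal, each being half of
      the final bound.\<close>
    define c where "c = sqrt J * sqrt \<omega> / L"
    have c: "0 < c" using rs(3) \<omega> L by (simp add: c_def)
    have Ac: "continuous_on {r..s} A" using rs by (intro continuous_on_subset[OF A(1)]) auto
    have f'_int: "(f' has_integral u (s *\<^sub>R e) - u (r *\<^sub>R e)) {r..s}"
      using C1_DERIV_ray[OF C1, of e] unfolding f'_def
      by (intro fundamental_theorem_of_calculus rs(2))
         (simp add: has_real_derivative_iff_has_vector_derivative has_vector_derivative_at_within)
    have Ei: "?E integrable_on {r..s}"
      by (intro integrable_continuous_interval continuous_intros Ac f'_cont)
    have Wi: "(\<lambda>t. 1 / ?W t) integrable_on {r..s}"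
      by (intro integrable_continuous_interval continuous_on_inverse_weight[OF A(1) rs(1)] A(2))
         (use rs in auto)
    have "\<bar>u (s *\<^sub>R e) - u (r *\<^sub>R e)\<bar> = norm (integral {r..s} f')"
      using integral_unique[OF f'_int] by simp
    also have "\<dots> \<le> integral {r..s} (\<lambda>t. c / (2 * \<omega>) * ?E t + 1 / (2 * c) * (1 / ?W t))"
    proof (rule integral_norm_bound_integral)
      show "f' integrable_on {r..s}" using f'_int by blast
      show "(\<lambda>t. c / (2 * \<omega>) * ?E t + 1 / (2 * c) * (1 / ?W t)) integrable_on {r..s}"
        by (intro integrable_add integrable_on_mult_right Ei Wi)
      fix t assume "t \<in> {r..s}"
      then have t: "0 < t" using rs by auto
      have W: "0 < ?W t" using A(2)[OF t] t by simp
      have "\<bar>f' t\<bar> \<le> (c * ?W t) * (f' t)\<^sup>2 / 2 + 1 / (2 * (c * ?W t))"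
        using c W by (intro young_weight) simp
      also have "\<dots> = c / (2 * \<omega>) * ?E t + 1 / (2 * c) * (1 / ?W t)"
        using \<omega> by (simp add: mult_ac)
      finally show "norm (f' t) \<le> c / (2 * \<omega>) * ?E t + 1 / (2 * c) * (1 / ?W t)" by simp
    qed
    also have "\<dots> = c / (2 * \<omega>) * integral {r..s} ?E + 1 / (2 * c) * radial_gap DIM('a) A r s"
      unfolding radial_gap_def
      by (subst Henstock_Kurzweil_Integration.integral_add)
         (intro integrable_on_mult_right Ei Wi, intro integrable_on_mult_right Ei Wi,
          simp only: Henstock_Kurzweil_Integration.integral_mult_right)
    also have "\<dots> \<le> c / (2 * \<omega>) * L\<^sup>2 + 1 / (2 * c) * J"
    proof -
      have "integral {r..s} ?E \<le> L\<^sup>2"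
        using finite_energy_radial_integral[OF A u e rs(1), of s] L(2) unfolding f'_def \<omega>_def by linarith
      then show ?thesis using c \<omega> rs(4) by (intro add_mono mult_left_mono) auto
    qed
    also have "\<dots> = L / sqrt \<omega> * sqrt J"
    proof -
      define j w where "j = sqrt J" and "w = sqrt \<omega>"
      have "J = j\<^sup>2" "\<omega> = w\<^sup>2" "0 < j" "0 < w" using rs(3) \<omega> by (auto simp: j_def w_def)
      then show ?thesis using L(1) unfolding c_def j_def[symmetric] w_def[symmetric]
        by (simp add: field_simps power2_eq_square)
    qed
    finally show ?thesis by (simp add: abs_minus_commute)
  qed
  show "\<bar>u (r *\<^sub>R e) - u (s *\<^sub>R e)\<bar> \<le> L / sqrt (sphere_area DIM('a)) * sqrt J"
    if "0 < r" "r \<le> s" "0 < J" "radial_gap DIM('a) A r s \<le> J" for r s J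
    using main[OF that] by (simp add: \<omega>_def)
  obtain \<rho> where \<rho>: "\<And>x. x \<in> closure {x. u x \<noteq> 0} \<Longrightarrow> norm x \<le> \<rho>"
    using compact_imp_bounded[OF supp] unfolding bounded_iff by blast
  fix r J assume r: "0 < r" "0 < J" "\<And>s. r \<le> s \<Longrightarrow> radial_gap DIM('a) A r s \<le> J"
  \<comment> \<open>Beyond the support the profile is 0, so the bound on the difference becomes a
    bound on the value at \<open>r\<close>.\<close>
  define s where "s = max r (\<rho> + 1)"
  have "u (s *\<^sub>R e) = 0"
  proof (rule ccontr)
    assume "u (s *\<^sub>R e) \<noteq> 0"
    then have "norm (s *\<^sub>R e) \<le> \<rho>" by (intro \<rho> subsetD[OF closure_subset]) simp
    then show False using e r(1) by (auto simp: s_def)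
  qed
  then show "\<bar>u (r *\<^sub>R e)\<bar> \<le> L / sqrt (sphere_area DIM('a)) * sqrt J"
    using main[of r s J] r by (simp add: \<omega>_def s_def)
qed

text \<open>Increments of energy at most \<open>(1 / 4) ^ k\<close> remain summable after
  multiplication by \<open>2 ^ k\<close>. So at almost every point the weighted squares are bounded,
  the increments decay like \<open>sqrt (1 / 2) ^ k\<close>, and the series of increments converges
  absolutely.\<close>

lemma geometric_energy_AE_convergent:
  fixes g :: "nat \<Rightarrow> 'a::euclidean_space \<Rightarrow> 'a"
  assumes A: "continuous_on {0<..} A" "\<And>t. 0 < t \<Longrightarrow> 0 < A t"
    and g: "\<And>k. g k \<in> borel_measurable lebesgue"
    and int: "\<And>k. integrable lebesgue (energy_density A (\<lambda>x. g (Suc k) x - g k x))"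
    and le: "\<And>k. A_energy A (\<lambda>x. g (Suc k) x - g k x) \<le> (1 / 4) ^ k"
  shows "AE x in lebesgue. convergent (\<lambda>k. g k x)"
proof -
  let ?D = "\<lambda>k x. A (norm x) * (norm (g (Suc k) x - g k x))\<^sup>2"
  have nn: "AE x in lebesgue. \<forall>k. 0 \<le> ?D k x"
    using AE_norm_pos by eventually_elim (simp add: A(2) less_imp_le)
  have "(\<integral>\<^sup>+ x. (\<Sum>k. ennreal (2 ^ k * ?D k x)) \<partial>lebesgue) = (\<Sum>k. \<integral>\<^sup>+ x. ennreal (2 ^ k * ?D k x) \<partial>lebesgue)"
    using int by (intro nn_integral_suminf) (auto dest!: borel_measurable_integrable)
  also have "\<dots> \<le> (\<Sum>k. ennreal ((1 / 2) ^ k))"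
  proof (intro suminf_le summableI)
    fix k
    have "(\<integral>\<^sup>+ x. ennreal (2 ^ k * ?D k x) \<partial>lebesgue) = ennreal (LINT x|lebesgue. 2 ^ k * ?D k x)"
      using nn int by (intro nn_integral_eq_integral) (auto elim!: eventually_mono)
    also have "(LINT x|lebesgue. 2 ^ k * ?D k x) \<le> 2 ^ k * (1 / 4) ^ k"
      using le[of k] by (simp add: A_energy_def)
    also have "2 ^ k * (1 / 4) ^ k = (1 / 2 :: real) ^ k"
      by (simp add: power_mult_distrib[symmetric])
    finally show "(\<integral>\<^sup>+ x. ennreal (2 ^ k * ?D k x) \<partial>lebesgue) \<le> ennreal ((1 / 2) ^ k)"
      by (simp add: ennreal_leI)
  qed
  also have "\<dots> < \<infinity>"
    by (subst suminf_ennreal2) (auto intro: summable_geometric)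
  finally have "(\<integral>\<^sup>+ x. (\<Sum>k. ennreal (2 ^ k * ?D k x)) \<partial>lebesgue) \<noteq> \<infinity>" by simp
  then have "AE x in lebesgue. (\<Sum>k. ennreal (2 ^ k * ?D k x)) \<noteq> \<infinity>"
    using int by (intro nn_integral_PInf_AE borel_measurable_suminf) (auto dest!: borel_measurable_integrable)
  then show ?thesis
    using AE_norm_pos
  proof eventually_elim
    case (elim x)
    have a: "0 < A (norm x)" using A(2) elim(2) by simp
    obtain B where B: "(\<Sum>k. ennreal (2 ^ k * ?D k x)) = ennreal B" "0 \<le> B"
      using elim(1) by (cases "\<Sum>k. ennreal (2 ^ k * ?D k x)") auto
    have bound: "norm (g (Suc k) x - g k x) \<le> sqrt (B / A (norm x)) * sqrt (1 / 2) ^ k" for k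
    proof -
      have "ennreal (2 ^ k * ?D k x) \<le> (\<Sum>k. ennreal (2 ^ k * ?D k x))"
        using sum_le_suminf[of "\<lambda>k. ennreal (2 ^ k * ?D k x)" "{k}"] by simp
      then have "2 ^ k * ?D k x \<le> B" using B by (simp add: ennreal_le_iff)
      then have "(norm (g (Suc k) x - g k x))\<^sup>2 \<le> B / A (norm x) * (1 / 2) ^ k"
        using a by (simp add: field_simps power_one_over)
      then have "sqrt ((norm (g (Suc k) x - g k x))\<^sup>2) \<le> sqrt (B / A (norm x) * (1 / 2) ^ k)"
        by (rule real_sqrt_le_mono)
      then have "norm (g (Suc k) x - g k x) \<le> sqrt (B / A (norm x) * (1 / 2) ^ k)"
        unfolding real_sqrt_abs abs_norm_cancel .
      then show ?thesis by (simp only: real_sqrt_mult real_sqrt_power)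
    qed
    have "summable (\<lambda>k. g (Suc k) x - g k x)"
    proof (rule summable_comparison_test'[OF summable_mult[OF summable_geometric]])
      show "norm (sqrt (1 / 2 :: real)) < 1" by (simp add: real_sqrt_lt_1_iff)
      show "norm (g (Suc k) x - g k x) \<le> sqrt (B / A (norm x)) * sqrt (1 / 2) ^ k" if "k \<ge> 0" for k
        by (rule bound)
    qed
    then have "convergent (\<lambda>n. \<Sum>k<n. g (Suc k) x - g k x)" by (simp add: summable_iff_convergent)
    then have "convergent (\<lambda>n. g n x - g 0 x)"
      by (simp only: sum_lessThan_telescope[of "\<lambda>n. g n x"])
    then have "convergent (\<lambda>n. (g n x - g 0 x) + g 0 x)" by (intro convergent_add convergent_const)
    then show ?case by simp
  qed
qed

subsection \<open>Completeness of the energy\<close>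

text \<open>The Riesz-Fischer argument for a weighted space: a fast subsequence converges almost
  everywhere, and Fatou's lemma turns the Cauchy condition into convergence of the energy. Only
  differences are assumed to have finite energy.\<close>

lemma energy_complete:
  fixes g :: "nat \<Rightarrow> 'a::euclidean_space \<Rightarrow> 'a"
  assumes A: "continuous_on {0<..} A" "\<And>t. 0 < t \<Longrightarrow> 0 < A t"
    and g: "\<And>k. g k \<in> borel_measurable lebesgue"
    and int: "\<And>j k. integrable lebesgue (energy_density A (\<lambda>x. g j x - g k x))"
    and Cauchy: "\<And>e. 0 < e \<Longrightarrow> \<exists>M. \<forall>m\<ge>M. \<forall>n\<ge>M. A_energy A (\<lambda>x. g m x - g n x) < e"
  shows "\<exists>G. G \<in> borel_measurable lebesgue \<and>
    (\<forall>k. integrable lebesgue (energy_density A (\<lambda>x. g k x - G x))) \<and>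
    (\<lambda>k. A_energy A (\<lambda>x. g k x - G x)) \<longlonglongrightarrow> 0"
proof -
  have "\<exists>M. \<forall>m\<ge>M. \<forall>n\<ge>M. A_energy A (\<lambda>x. g m x - g n x) < (1 / 4) ^ k" for k
    by (rule Cauchy) simp
  then obtain M where M: "\<And>k m n. M k \<le> m \<Longrightarrow> M k \<le> n \<Longrightarrow> A_energy A (\<lambda>x. g m x - g n x) < (1 / 4) ^ k"
    by metis
  \<comment> \<open>Summing the thresholds makes \<open>r\<close> monotone with
    \<open>M k \<le> r k\<close>; the summand \<open>k\<close> makes \<open>r\<close> exceed any
    given index eventually.\<close>
  define r where "r k = k + (\<Sum>i\<le>k. M i)" for k
  have r_ge: "M k \<le> r k" "k \<le> r k" for k
    using member_le_sum[of k "{..k}" M] by (auto simp: r_def)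
  have r_Suc: "r k \<le> r (Suc k)" for k by (simp add: r_def)
  define h where "h k = g (r k)" for k
  define G where "G x = lim (\<lambda>k. h k x)" for x
  have hm: "h k \<in> borel_measurable lebesgue" for k using g by (simp add: h_def)
  have Gm: "G \<in> borel_measurable lebesgue"
    unfolding G_def[abs_def] by (rule borel_measurable_lim_metric[OF hm])
  have "AE x in lebesgue. convergent (\<lambda>k. h k x)"
  proof (rule geometric_energy_AE_convergent[OF A hm])
    show "integrable lebesgue (energy_density A (\<lambda>x. h (Suc k) x - h k x))" for k
      unfolding h_def by (rule int)
    show "A_energy A (\<lambda>x. h (Suc k) x - h k x) \<le> (1 / 4) ^ k" for k
      unfolding h_def by (intro less_imp_le M order_trans[OF r_ge(1) r_Suc] r_ge(1))
  qed
  then have conv: "AE x in lebesgue. (\<lambda>k. h k x) \<longlonglongrightarrow> G x"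
    by eventually_elim (simp add: G_def convergent_LIMSEQ_iff)
  let ?F = "\<lambda>u x. A (norm x) * (norm (u x))\<^sup>2"
  have Fm: "?F u \<in> borel_measurable lebesgue" if "u \<in> borel_measurable lebesgue" for u :: "'a \<Rightarrow> 'a"
  proof -
    have "(\<lambda>x. (norm (u x))\<^sup>2) \<in> borel_measurable lebesgue" using that by measurable
    then show ?thesis by (intro borel_measurable_times continuous_on_pos_measurable_norm A)
  qed
  have nn: "AE x in lebesgue. 0 \<le> ?F u x" for u :: "'a \<Rightarrow> 'a"
    using AE_norm_pos by eventually_elim (simp add: A(2) less_imp_le)
  have diffm: "(\<lambda>x. g m x - G x) \<in> borel_measurable lebesgue" for m
    using g Gm by (rule borel_measurable_diff)
  \<comment> \<open>The limit along the fast subsequence inherits every Cauchy bound that holds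
    eventually against \<open>g m\<close>.\<close>
  have fatou: "(\<integral>\<^sup>+ x. ennreal (?F (\<lambda>x. g m x - G x) x) \<partial>lebesgue) \<le> ennreal e"
    if e: "0 < e" and M0: "\<And>n. M0 \<le> n \<Longrightarrow> A_energy A (\<lambda>x. g m x - g n x) < e" for m e M0
  proof -
    have "(\<integral>\<^sup>+ x. ennreal (?F (\<lambda>x. g m x - G x) x) \<partial>lebesgue)
        = (\<integral>\<^sup>+ x. liminf (\<lambda>k. ennreal (?F (\<lambda>x. g m x - h k x) x)) \<partial>lebesgue)"
    proof (rule nn_integral_cong_AE)
      show "AE x in lebesgue. ennreal (?F (\<lambda>x. g m x - G x) x) = liminf (\<lambda>k. ennreal (?F (\<lambda>x. g m x - h k x) x))"
        using conv
      proof eventually_elim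
        case (elim x)
        then have "(\<lambda>k. ennreal (?F (\<lambda>x. g m x - h k x) x)) \<longlonglongrightarrow> ennreal (?F (\<lambda>x. g m x - G x) x)"
          by (intro tendsto_ennrealI tendsto_intros)
        then show ?case by (intro lim_imp_Liminf[symmetric]) auto
      qed
    qed
    also have "\<dots> \<le> liminf (\<lambda>k. \<integral>\<^sup>+ x. ennreal (?F (\<lambda>x. g m x - h k x) x) \<partial>lebesgue)"
      by (intro nn_integral_liminf measurable_compose[OF Fm measurable_ennreal] borel_measurable_diff g hm)
    also have "\<dots> \<le> limsup (\<lambda>k. \<integral>\<^sup>+ x. ennreal (?F (\<lambda>x. g m x - h k x) x) \<partial>lebesgue)"
      by (intro Liminf_le_Limsup) simp
    also have "\<dots> \<le> ennreal e"
    proof (rule Limsup_bounded)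
      show "\<forall>\<^sub>F k in sequentially. (\<integral>\<^sup>+ x. ennreal (?F (\<lambda>x. g m x - h k x) x) \<partial>lebesgue) \<le> ennreal e"
        using eventually_ge_at_top[of M0]
      proof eventually_elim
        case (elim k)
        have "(\<integral>\<^sup>+ x. ennreal (?F (\<lambda>x. g m x - h k x) x) \<partial>lebesgue) = ennreal (A_energy A (\<lambda>x. g m x - h k x))"
          unfolding A_energy_def h_def by (rule nn_integral_eq_integral[OF int nn])
        also have "\<dots> \<le> ennreal e"
          unfolding h_def by (intro ennreal_leI less_imp_le M0 order_trans[OF elim r_ge(2)])
        finally show ?case .
      qed
    qed
    finally show ?thesis .
  qed
  have int1: "integrable lebesgue (?F (\<lambda>x. g m x - G x))" "A_energy A (\<lambda>x. g m x - G x) \<le> e"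
    if e: "0 < e" and M0: "\<And>n. M0 \<le> n \<Longrightarrow> A_energy A (\<lambda>x. g m x - g n x) < e" for m e M0
  proof -
    show i: "integrable lebesgue (?F (\<lambda>x. g m x - G x))"
    proof (rule integrableI_nonneg)
      show "(\<integral>\<^sup>+ x. ennreal (?F (\<lambda>x. g m x - G x) x) \<partial>lebesgue) < \<infinity>"
        by (rule le_less_trans[OF fatou[OF e M0]]) simp_all
    qed (intro Fm diffm nn)+
    have "ennreal (A_energy A (\<lambda>x. g m x - G x)) = (\<integral>\<^sup>+ x. ennreal (?F (\<lambda>x. g m x - G x) x) \<partial>lebesgue)"
      unfolding A_energy_def by (rule nn_integral_eq_integral[OF i nn, symmetric])
    also have "\<dots> \<le> ennreal e" by (rule fatou[OF e M0])
    finally show "A_energy A (\<lambda>x. g m x - G x) \<le> e" using e by (simp add: ennreal_le_iff)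
  qed
  show ?thesis
  proof (intro exI[of _ G] conjI allI Gm)
    \<comment> \<open>Fatou yields integrability of \<open>g m - G\<close> for late indices only.
      Any other index \<open>k\<close> is compared with the fixed late index
      \<open>M1\<close>.\<close>
    obtain M1 where M1: "\<And>m n. M1 \<le> m \<Longrightarrow> M1 \<le> n \<Longrightarrow> A_energy A (\<lambda>x. g m x - g n x) < 1"
      using Cauchy[of 1] by auto
    have iM: "integrable lebesgue (?F (\<lambda>x. g M1 x - G x))"
      by (rule int1(1)[of 1 M1]) (simp_all add: M1)
    have "?F (\<lambda>x. G x - g M1 x) = ?F (\<lambda>x. g M1 x - G x)"
      by (intro ext arg_cong2[where f = times] arg_cong[where f = "\<lambda>z. z\<^sup>2"] refl norm_minus_commute)
    then have iM': "integrable lebesgue (?F (\<lambda>x. G x - g M1 x))" using iM by (simp only:)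
    show "integrable lebesgue (?F (\<lambda>x. g k x - G x))" for k
    proof -
      have "integrable lebesgue (?F (\<lambda>x. (g k x - g M1 x) - (G x - g M1 x)))"
        by (rule energy_diff(1)[OF A borel_measurable_diff[OF g g] borel_measurable_diff[OF Gm g] int iM'])
      then show ?thesis by simp
    qed
    show "(\<lambda>k. A_energy A (\<lambda>x. g k x - G x)) \<longlonglongrightarrow> 0"
    proof (rule LIMSEQ_I)
      fix e :: real assume e: "0 < e"
      then obtain M2 where M2: "\<And>m n. M2 \<le> m \<Longrightarrow> M2 \<le> n \<Longrightarrow> A_energy A (\<lambda>x. g m x - g n x) < e / 2"
        using Cauchy[of "e / 2"] by auto
      show "\<exists>no. \<forall>n\<ge>no. norm (A_energy A (\<lambda>x. g n x - G x) - 0) < e"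
      proof (intro exI allI impI)
        fix n assume n: "M2 \<le> n"
        have "A_energy A (\<lambda>x. g n x - G x) \<le> e / 2"
          using e by (intro int1(2)[of _ M2] M2 n) simp
        then show "norm (A_energy A (\<lambda>x. g n x - G x) - 0) < e"
          using e A_energy_nonneg[of A "\<lambda>x. g n x - G x", OF A(2)] by simp
      qed
    qed
  qed
qed

section \<open>Almost everywhere convergent subsequences in sum spaces\<close>

lemma abs_diff_powr_le:
  fixes a b p :: real
  assumes "0 < p"
  shows "\<bar>a - b\<bar> powr p \<le> 2 powr p * (\<bar>a\<bar> powr p + \<bar>b\<bar> powr p)"
proof -
  have "\<bar>a - b\<bar> powr p \<le> (2 * max \<bar>a\<bar> \<bar>b\<bar>) powr p"
    using assms by (intro powr_mono2) auto
  also have "\<dots> = 2 powr p * max \<bar>a\<bar> \<bar>b\<bar> powr p" by (simp add: powr_mult)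
  also have "max \<bar>a\<bar> \<bar>b\<bar> powr p \<le> \<bar>a\<bar> powr p + \<bar>b\<bar> powr p" by (simp add: max_def)
  finally show ?thesis by simp
qed

lemma Lq_one_diff:
  assumes p: "0 < p" and f: "f \<in> Lq (\<lambda>_. 1) p" and g: "g \<in> Lq (\<lambda>_. 1) p"
  shows "(\<lambda>x. f x - g x) \<in> Lq (\<lambda>_. 1) p"
proof -
  have m: "f \<in> borel_measurable lebesgue" "g \<in> borel_measurable lebesgue"
    and i: "integrable lebesgue (\<lambda>x. \<bar>f x\<bar> powr p)" "integrable lebesgue (\<lambda>x. \<bar>g x\<bar> powr p)"
    using f g by (simp_all add: Lq_def)
  have "integrable lebesgue (\<lambda>x. \<bar>f x - g x\<bar> powr p)"
  proof (rule Bochner_Integration.integrable_bound)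
    show "integrable lebesgue (\<lambda>x. 2 powr p * (\<bar>f x\<bar> powr p + \<bar>g x\<bar> powr p))" using i by simp
    show "(\<lambda>x. \<bar>f x - g x\<bar> powr p) \<in> borel_measurable lebesgue" using m by measurable
    show "AE x in lebesgue. norm (\<bar>f x - g x\<bar> powr p) \<le> norm (2 powr p * (\<bar>f x\<bar> powr p + \<bar>g x\<bar> powr p))"
      using abs_diff_powr_le[OF p] by (intro AE_I2) simp
  qed
  then show ?thesis using m by (simp add: Lq_def)
qed

lemma continuous_compact_support_Lq_one:
  fixes w :: "'a::euclidean_space \<Rightarrow> real"
  assumes "continuous_on UNIV w" "compact (closure {x. w x \<noteq> 0})" "0 < p"
  shows "w \<in> Lq (\<lambda>_. 1) p"
proof -
  have "integrable lebesgue (\<lambda>x. \<bar>w x\<bar> powr p)"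
  proof (rule integrable_lebesgue_compact_support[OF _ assms(2)])
    show "continuous_on UNIV (\<lambda>x. \<bar>w x\<bar> powr p)"
      using assms by (intro continuous_on_powr' continuous_intros) auto
    show "\<bar>w x\<bar> powr p = 0" if "x \<notin> closure {x. w x \<noteq> 0}" for x
      using that closure_subset[of "{x. w x \<noteq> 0}"] by auto
  qed
  then show ?thesis using continuous_imp_lebesgue_measurable[OF assms(1)] by (simp add: Lq_def)
qed

text \<open>Membership in the sum space ensures that the infimum runs over a nonempty set, so a
  decomposition with value below \<open>e\<close> exists.\<close>

lemma Lsum_norm_decomposition:
  assumes "v \<in> Lsum K q1 q2" "Lsum_norm K q1 q2 v < e"
  obtains v1 v2 where "v1 \<in> Lq K q1" "v2 \<in> Lq K q2" "v = (\<lambda>x. v1 x + v2 x)"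
    "Lq_norm K q1 v1 < e" "Lq_norm K q2 v2 < e"
proof -
  let ?S = "{max (Lq_norm K q1 u1) (Lq_norm K q2 u2) | u1 u2. u1 \<in> Lq K q1 \<and> u2 \<in> Lq K q2 \<and> v = (\<lambda>x. u1 x + u2 x)}"
  have "?S \<noteq> {}" using assms(1) by (auto simp: Lsum_def)
  then have "\<exists>z\<in>?S. z < e"
    using assms(2) cInf_lessD[of ?S e] unfolding Lsum_norm_def by blast
  then obtain v1 v2 where "v1 \<in> Lq K q1" "v2 \<in> Lq K q2" "v = (\<lambda>x. v1 x + v2 x)"
    "max (Lq_norm K q1 v1) (Lq_norm K q2 v2) < e"
    by blast
  then show ?thesis by (intro that[of v1 v2]) simp_all
qed

lemma Lq_one_norm_tendsto_0_integral:
  fixes v :: "nat \<Rightarrow> 'a::euclidean_space \<Rightarrow> real"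
  assumes p: "0 < p" and norm: "(\<lambda>n. Lq_norm (\<lambda>_. 1) p (v n)) \<longlonglongrightarrow> 0"
  shows "(\<lambda>n. LINT x|lebesgue. \<bar>v n x\<bar> powr p) \<longlonglongrightarrow> 0"
proof -
  have "(\<lambda>n. Lq_norm (\<lambda>_. 1) p (v n) powr p) \<longlonglongrightarrow> 0 powr p"
    using p by (intro tendsto_powr' norm tendsto_const) (auto simp: Lq_norm_def)
  moreover have "Lq_norm (\<lambda>_. 1) p (v n) powr p = (LINT x|lebesgue. \<bar>v n x\<bar> powr p)" for n
  proof -
    have "0 \<le> (LINT x|lebesgue. \<bar>v n x\<bar> powr p)" by (intro Bochner_Integration.integral_nonneg) simp
    then show ?thesis using p by (simp add: Lq_norm_def powr_powr)
  qed
  ultimately show ?thesis using p by simp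
qed

lemma Lq_one_norm_AE_subseq:
  fixes v :: "nat \<Rightarrow> 'a::euclidean_space \<Rightarrow> real"
  assumes p: "0 < p" and v: "\<And>n. v n \<in> Lq (\<lambda>_. 1) p" and norm: "(\<lambda>n. Lq_norm (\<lambda>_. 1) p (v n)) \<longlonglongrightarrow> 0"
  shows "\<exists>r. strict_mono (r :: nat \<Rightarrow> nat) \<and> (AE x in lebesgue. (\<lambda>n. v (r n) x) \<longlonglongrightarrow> 0)"
proof -
  have "\<exists>r::nat \<Rightarrow> nat. strict_mono r \<and> (AE x in lebesgue. (\<lambda>n. \<bar>v (r n) x\<bar> powr p) \<longlonglongrightarrow> 0)"
  proof (rule tendsto_L1_AE_subseq)
    show "integrable lebesgue (\<lambda>x. \<bar>v n x\<bar> powr p)" for n using v[of n] by (simp add: Lq_def)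
    show "(\<lambda>n. LINT x|lebesgue. norm (\<bar>v n x\<bar> powr p)) \<longlonglongrightarrow> 0"
      using Lq_one_norm_tendsto_0_integral[OF p norm] by simp
  qed
  then obtain r :: "nat \<Rightarrow> nat" where r: "strict_mono r"
    "AE x in lebesgue. (\<lambda>n. \<bar>v (r n) x\<bar> powr p) \<longlonglongrightarrow> 0" by blast
  from r(2) have "AE x in lebesgue. (\<lambda>n. v (r n) x) \<longlonglongrightarrow> 0"
  proof eventually_elim
    case (elim x)
    then have "(\<lambda>n. (\<bar>v (r n) x\<bar> powr p) powr (1 / p)) \<longlonglongrightarrow> 0 powr (1 / p)"
      using p by (intro tendsto_powr' tendsto_const) auto
    then have "(\<lambda>n. \<bar>v (r n) x\<bar>) \<longlonglongrightarrow> 0" using p by (simp add: powr_powr)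
    then show ?case by (rule tendsto_rabs_zero_cancel)
  qed
  with r(1) show ?thesis by blast
qed

text \<open>The infimum need not be attained, so each function is decomposed with slack
  \<open>1 / (n + 1)\<close>. A subsequence is extracted for the first summands and a further one
  for the second.\<close>

lemma Lsum_one_norm_AE_subseq:
  fixes v :: "nat \<Rightarrow> 'a::euclidean_space \<Rightarrow> real"
  assumes p: "0 < p" "0 < q" and v: "\<And>n. v n \<in> Lsum (\<lambda>_. 1) p q"
    and norm: "(\<lambda>n. Lsum_norm (\<lambda>_. 1) p q (v n)) \<longlonglongrightarrow> 0"
  shows "\<exists>r. strict_mono (r :: nat \<Rightarrow> nat) \<and> (AE x in lebesgue. (\<lambda>n. v (r n) x) \<longlonglongrightarrow> 0)"
proof -
  let ?e = "\<lambda>n. Lsum_norm (\<lambda>_. 1) p q (v n) + inverse (real (Suc n))"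
  define Q where "Q n v1 v2 \<longleftrightarrow> v1 \<in> Lq (\<lambda>_. 1) p \<and> v2 \<in> Lq (\<lambda>_. 1) q \<and> v n = (\<lambda>x. v1 x + v2 x) \<and>
    Lq_norm (\<lambda>_. 1) p v1 < ?e n \<and> Lq_norm (\<lambda>_. 1) q v2 < ?e n" for n v1 v2
  have "\<forall>n. \<exists>v1 v2. Q n v1 v2"
  proof
    fix n
    have "Lsum_norm (\<lambda>_. 1) p q (v n) < ?e n" by simp
    from Lsum_norm_decomposition[OF v this] show "\<exists>v1 v2. Q n v1 v2" unfolding Q_def by blast
  qed
  from choice[OF this] obtain a where "\<forall>n. \<exists>v2. Q n (a n) v2" by (rule exE)
  from choice[OF this] obtain b where "\<forall>n. Q n (a n) (b n)" by (rule exE)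
  then have ab: "\<And>n. a n \<in> Lq (\<lambda>_. 1) p" "\<And>n. b n \<in> Lq (\<lambda>_. 1) q"
    "\<And>n. v n = (\<lambda>x. a n x + b n x)"
    "\<And>n. Lq_norm (\<lambda>_. 1) p (a n) < ?e n" "\<And>n. Lq_norm (\<lambda>_. 1) q (b n) < ?e n"
    unfolding Q_def by blast+
  have e0: "?e \<longlonglongrightarrow> 0" using tendsto_add[OF norm LIMSEQ_inverse_real_of_nat] by simp
  have a0: "(\<lambda>n. Lq_norm (\<lambda>_. 1) p (a n)) \<longlonglongrightarrow> 0"
    by (rule tendsto_sandwich[OF _ _ tendsto_const e0]) (use ab(4) in \<open>auto simp: Lq_norm_def intro!: always_eventually less_imp_le\<close>)
  have b0: "(\<lambda>n. Lq_norm (\<lambda>_. 1) q (b n)) \<longlonglongrightarrow> 0"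
    by (rule tendsto_sandwich[OF _ _ tendsto_const e0]) (use ab(5) in \<open>auto simp: Lq_norm_def intro!: always_eventually less_imp_le\<close>)
  obtain r :: "nat \<Rightarrow> nat" where r: "strict_mono r" "AE x in lebesgue. (\<lambda>n. a (r n) x) \<longlonglongrightarrow> 0"
    using Lq_one_norm_AE_subseq[OF p(1) ab(1) a0] by blast
  have "(\<lambda>n. Lq_norm (\<lambda>_. 1) q (b (r n))) \<longlonglongrightarrow> 0"
    using LIMSEQ_subseq_LIMSEQ[OF b0 r(1)] by (simp add: o_def)
  from Lq_one_norm_AE_subseq[OF p(2) ab(2) this]
  obtain s :: "nat \<Rightarrow> nat" where s: "strict_mono s" "AE x in lebesgue. (\<lambda>n. b (r (s n)) x) \<longlonglongrightarrow> 0"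
    by blast
  have "AE x in lebesgue. (\<lambda>n. v (r (s n)) x) \<longlonglongrightarrow> 0"
    using r(2) s(2)
  proof eventually_elim
    case (elim x)
    have "(\<lambda>n. a (r (s n)) x) \<longlonglongrightarrow> 0"
      using LIMSEQ_subseq_LIMSEQ[OF elim(1) s(1)] by (simp add: o_def)
    from tendsto_add[OF this elim(2)] show ?case by (simp add: ab(3))
  qed
  then show ?thesis using strict_mono_o[OF r(1) s(1)] by (intro exI[of _ "r \<circ> s"]) simp
qed

subsection \<open>Radial profiles of the energy space\<close>

text \<open>The second part of \<open>profile_bound\<close>, applied to differences, controls values
  outside a ball by the energy, because the gap from any \<open>r \<ge> a\<close> is bounded
  uniformly. The convergence is thus uniform away from the origin, to a function of the
  norm.\<close>

lemma energy_Cauchy_pointwise: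
  fixes w :: "nat \<Rightarrow> 'a::euclidean_space \<Rightarrow> real"
  assumes A: "hyp_A DIM('a) A a0 ainf" and w: "\<And>n. finite_energy A (w n)"
    and Cauchy: "\<And>e. 0 < e \<Longrightarrow> \<exists>M. \<forall>m\<ge>M. \<forall>n\<ge>M. A_energy A (\<lambda>x. grad (w m) x - grad (w n) x) < e"
  shows "\<exists>f. \<forall>a>0. \<forall>e>0. \<exists>M. \<forall>n\<ge>M. \<forall>x. a \<le> norm x \<longrightarrow> \<bar>w n x - f (norm x)\<bar> \<le> e"
proof -
  have cont: "continuous_on {0<..} A" and pos: "\<And>t. 0 < t \<Longrightarrow> 0 < A t"
    and g: "0 < real DIM('a) + ainf - 2"
    using A unfolding hyp_A_def by auto
  obtain b :: 'a where b: "b \<in> Basis" using nonempty_Basis by blast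
  then have nb: "norm b = 1" by simp
  define \<kappa> where "\<kappa> = sqrt (sphere_area DIM('a))"
  have \<kappa>: "0 < \<kappa>" by (simp add: \<kappa>_def)
  have ray: "w n x = w n (norm x *\<^sub>R b)" for n x
  proof -
    have "radial (w n)" using w[of n] by (simp add: finite_energy_def)
    then show ?thesis by (rule radialD[of "w n"]) (simp add: nb)
  qed
  have unif: "\<exists>M. \<forall>m\<ge>M. \<forall>n\<ge>M. \<forall>x. a \<le> norm x \<longrightarrow> \<bar>w m x - w n x\<bar> \<le> e"
    if a: "0 < a" and e: "0 < e" for a e
  proof -
    obtain C where C: "0 < C"
      "\<And>r s. a \<le> r \<Longrightarrow> r \<le> s \<Longrightarrow> radial_gap DIM('a) A r s \<le> C * r powr - (real DIM('a) + ainf - 2)"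
      by (rule radial_gap_bounds[OF A a]) (simp, blast intro: that)
    define J where "J = C * a powr - (real DIM('a) + ainf - 2)"
    have J: "0 < J" using C(1) a by (simp add: J_def)
    have gap: "radial_gap DIM('a) A r s \<le> J" if "a \<le> r" "r \<le> s" for r s
    proof -
      have "r powr - (real DIM('a) + ainf - 2) \<le> a powr - (real DIM('a) + ainf - 2)"
        using a that g by (intro powr_mono2') auto
      then show ?thesis
        unfolding J_def using C(1) by (intro order_trans[OF C(2)[OF that]] mult_left_mono) auto
    qed
    \<comment> \<open>Chosen so that the resulting bound
      \<open>\<epsilon> / \<kappa> * sqrt J\<close> is exactly \<open>e\<close>.\<close>
    define \<epsilon> where "\<epsilon> = e * \<kappa> / sqrt J"
    have \<epsilon>: "0 < \<epsilon>" using e \<kappa> J by (simp add: \<epsilon>_def)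
    obtain M where M: "\<And>m n. M \<le> m \<Longrightarrow> M \<le> n \<Longrightarrow> A_energy A (\<lambda>x. grad (w m) x - grad (w n) x) < \<epsilon>\<^sup>2"
      using Cauchy[of "\<epsilon>\<^sup>2"] \<epsilon> by auto
    have "\<bar>w m x - w n x\<bar> \<le> e" if mn: "M \<le> m" "M \<le> n" and x: "a \<le> norm x" for m n x
    proof -
      have "C1 (w m)" "C1 (w n)" using w by (simp_all add: finite_energy_def)
      then have "grad (\<lambda>x. w m x - w n x) = (\<lambda>x. grad (w m) x - grad (w n) x)" by (rule C1_diff(2))
      with M[OF mn] have "A_energy A (grad (\<lambda>x. w m x - w n x)) \<le> \<epsilon>\<^sup>2" by simp
      from finite_energy_profile_bound[OF cont pos finite_energy_diff[OF cont pos w w] nb \<epsilon> this]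
      have "profile_bound DIM('a) A (\<epsilon> / \<kappa>) (\<lambda>t. w m (t *\<^sub>R b) - w n (t *\<^sub>R b))"
        unfolding \<kappa>_def .
      moreover have "0 < norm x" using x a by linarith
      ultimately have "\<bar>w m (norm x *\<^sub>R b) - w n (norm x *\<^sub>R b)\<bar> \<le> \<epsilon> / \<kappa> * sqrt J"
        by (rule profile_boundD2[OF _ _ J gap[OF x]])
      also have "\<dots> = e" using \<kappa> J by (simp add: \<epsilon>_def)
      finally show ?thesis using ray[of m x] ray[of n x] by simp
    qed
    then show ?thesis by (intro exI[of _ M]) blast
  qed
  define f where "f t = lim (\<lambda>n. w n (t *\<^sub>R b))" for t
  have lim: "(\<lambda>n. w n x) \<longlonglongrightarrow> f (norm x)" if x: "0 < norm x" for x
  proof -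
    have "Cauchy (\<lambda>n. w n x)"
    proof (rule metric_CauchyI)
      fix e :: real assume e: "0 < e"
      obtain M where "\<forall>m\<ge>M. \<forall>n\<ge>M. \<forall>y. norm x \<le> norm y \<longrightarrow> \<bar>w m y - w n y\<bar> \<le> e / 2"
        using unif[OF x half_gt_zero[OF e]] by (rule exE)
      then have "\<bar>w m x - w n x\<bar> \<le> e / 2" if "M \<le> m" "M \<le> n" for m n using that by simp
      then show "\<exists>M. \<forall>m\<ge>M. \<forall>n\<ge>M. dist (w m x) (w n x) < e"
        using e by (intro exI[of _ M]) (force simp: dist_real_def)
    qed
    then have "convergent (\<lambda>n. w n x)" by (simp add: Cauchy_convergent_iff)
    moreover have "(\<lambda>n. w n x) = (\<lambda>n. w n (norm x *\<^sub>R b))" by (rule ext) (rule ray)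
    ultimately show ?thesis by (simp only: f_def convergent_LIMSEQ_iff)
  qed
  show ?thesis
  proof (rule exI[of _ f], intro allI impI)
    fix a e :: real assume a: "0 < a" and e: "0 < e"
    obtain M where M: "\<forall>m\<ge>M. \<forall>n\<ge>M. \<forall>y. a \<le> norm y \<longrightarrow> \<bar>w m y - w n y\<bar> \<le> e"
      using unif[OF a e] by (rule exE)
    have "\<bar>w n x - f (norm x)\<bar> \<le> e" if n: "M \<le> n" and x: "a \<le> norm x" for n x
    proof (rule tendsto_upperbound)
      show "(\<lambda>m. \<bar>w n x - w m x\<bar>) \<longlonglongrightarrow> \<bar>w n x - f (norm x)\<bar>"
        using less_le_trans[OF a x] by (intro tendsto_intros lim)
      show "\<forall>\<^sub>F m in sequentially. \<bar>w n x - w m x\<bar> \<le> e"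
        using eventually_ge_at_top[of M] by eventually_elim (use M n x in blast)
    qed simp
    then show "\<exists>M. \<forall>n\<ge>M. \<forall>x. a \<le> norm x \<longrightarrow> \<bar>w n x - f (norm x)\<bar> \<le> e" by blast
  qed
qed

lemma compact_away_from_zero:
  fixes C :: "'a::real_normed_vector set"
  assumes "compact C" "C \<subseteq> - {0}"
  obtains a b where "0 < a" "a \<le> b" "\<And>x. x \<in> C \<Longrightarrow> a \<le> norm x \<and> norm x \<le> b"
proof -
  have "open (- C)" "0 \<in> - C" using assms compact_imp_closed by auto
  then obtain a where a: "0 < a" "ball 0 a \<subseteq> - C" using open_contains_ball by blast
  obtain b where b: "\<And>x. x \<in> C \<Longrightarrow> norm x \<le> b"
    using compact_imp_bounded[OF assms(1)] unfolding bounded_iff by blast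
  show ?thesis
  proof (rule that[of a "max a b"])
    show "a \<le> norm x \<and> norm x \<le> max a b" if "x \<in> C" for x
    proof -
      have "x \<notin> ball 0 a" using a(2) that by blast
      then show ?thesis using b[OF that] by (auto simp: not_less)
    qed
  qed (use a in auto)
qed

lemma weight_lower_bound:
  fixes A :: "real \<Rightarrow> real"
  assumes A: "continuous_on {0<..} A" "\<And>t. 0 < t \<Longrightarrow> 0 < A t" and a: "0 < a" "a \<le> b"
  obtains c where "0 < c" "\<And>t. a \<le> t \<Longrightarrow> t \<le> b \<Longrightarrow> c \<le> A t"
proof -
  obtain c where c: "0 < c" "\<And>t. a \<le> t \<Longrightarrow> t \<le> b \<Longrightarrow> c * t powr 0 \<le> A t"
    by (rule lower_power_bound[OF A a, where a = 0]) (assumption, (rule that; blast))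
  show ?thesis
  proof (rule that[OF c(1)])
    show "c \<le> A t" if "a \<le> t" "t \<le> b" for t using c(2)[OF that] a that by simp
  qed
qed

text \<open>On a compact set off the origin \<open>A\<close> has a positive lower bound
  \<open>c\<close>, and Young's inequality with weight \<open>c\<close> bounds the norm by the
  energy density plus a constant.\<close>

lemma finite_energy_Lp_loc:
  fixes G :: "'a::euclidean_space \<Rightarrow> 'a"
  assumes A: "continuous_on {0<..} A" "\<And>t. 0 < t \<Longrightarrow> 0 < A t"
    and G: "G \<in> borel_measurable lebesgue" "integrable lebesgue (energy_density A G)"
  shows "Lp_loc 1 (- {0}) G"
  unfolding Lp_loc_def
proof (intro conjI allI impI; (elim conjE)?)
  show "G \<in> borel_measurable (lebesgue_on (- {0}))" using G(1) by (rule measurable_restrict_space1)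
  fix C :: "'a set" assume C: "compact C" "C \<subseteq> - {0}"
  obtain a b where ab: "0 < a" "a \<le> b" "\<And>x. x \<in> C \<Longrightarrow> a \<le> norm x \<and> norm x \<le> b"
    by (rule compact_away_from_zero[OF C]) (rule that; blast)
  obtain c where c: "0 < c" "\<And>t. a \<le> t \<Longrightarrow> t \<le> b \<Longrightarrow> c \<le> A t"
    by (rule weight_lower_bound[OF A ab(1,2)]) (assumption, (rule that; blast))
  have Cm: "C \<in> sets lebesgue" "emeasure lebesgue C < \<infinity>"
    using C(1) emeasure_compact_finite[OF C(1)] by (simp_all add: compact_imp_closed)
  show "set_integrable lebesgue C (\<lambda>x. norm (G x) powr 1)"
    unfolding set_integrable_def
  proof (rule Bochner_Integration.integrable_bound)
    show "integrable lebesgue (\<lambda>x. A (norm x) * (norm (G x))\<^sup>2 + indicator C x * (1 / (2 * c)))"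
      using G(2) Cm by (intro Bochner_Integration.integrable_add integrable_mult_left integrable_real_indicator)
    have "(\<lambda>x. norm (G x) powr 1) \<in> borel_measurable lebesgue" using G(1) by measurable
    then show "(\<lambda>x. indicator C x *\<^sub>R (norm (G x) powr 1)) \<in> borel_measurable lebesgue"
      by (intro borel_measurable_scaleR borel_measurable_indicator Cm)
    show "AE x in lebesgue. norm (indicator C x *\<^sub>R (norm (G x) powr 1))
        \<le> norm (A (norm x) * (norm (G x))\<^sup>2 + indicator C x * (1 / (2 * c)))"
      using AE_norm_pos
    proof eventually_elim
      case (elim x)
      have A0: "0 \<le> A (norm x) * (norm (G x))\<^sup>2" using A(2)[OF elim] by simp
      show ?case
      proof (cases "x \<in> C")
        case True
        have "norm (G x) \<le> c * (norm (G x))\<^sup>2 / 2 + 1 / (2 * c)"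
          using young_weight[OF c(1), of "norm (G x)"] by simp
        also have "c * (norm (G x))\<^sup>2 / 2 \<le> A (norm x) * (norm (G x))\<^sup>2"
        proof -
          have "c * (norm (G x))\<^sup>2 \<le> A (norm x) * (norm (G x))\<^sup>2"
            using ab(3)[OF True] by (intro mult_right_mono c(2)) auto
          moreover have "0 \<le> c * (norm (G x))\<^sup>2" using c(1) by simp
          ultimately show ?thesis by linarith
        qed
        finally show ?thesis using True A0 c(1) by simp
      qed (use A0 in simp)
    qed
  qed
qed

text \<open>Pairing with a function supported off the origin is continuous for the energy. Young's
  inequality with weight \<open>A / \<delta> n\<close> bounds the pairing by a term of order
  \<open>sqrt\<close> of the energy plus one of order \<open>\<delta> n\<close>.\<close>

lemma energy_weak_convergence:
  fixes h :: "nat \<Rightarrow> 'a::euclidean_space \<Rightarrow> 'a"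
  assumes A: "continuous_on {0<..} A" "\<And>t. 0 < t \<Longrightarrow> 0 < A t"
    and h: "\<And>n. h n \<in> borel_measurable lebesgue" "\<And>n. integrable lebesgue (energy_density A (h n))"
    and conv: "(\<lambda>n. A_energy A (h n)) \<longlonglongrightarrow> 0"
    and \<phi>: "continuous_on UNIV \<phi>" "compact C" "C \<subseteq> - {0}" "\<And>x. x \<notin> C \<Longrightarrow> \<phi> x = (0::real)"
  shows "\<And>n. integrable lebesgue (\<lambda>x. \<phi> x *\<^sub>R h n x)" "(\<lambda>n. LINT x|lebesgue. \<phi> x *\<^sub>R h n x) \<longlonglongrightarrow> 0"
proof -
  obtain a b where ab: "0 < a" "a \<le> b" "\<And>x. x \<in> C \<Longrightarrow> a \<le> norm x \<and> norm x \<le> b"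
    by (rule compact_away_from_zero[OF \<phi>(2,3)]) (rule that; blast)
  obtain c where c: "0 < c" "\<And>t. a \<le> t \<Longrightarrow> t \<le> b \<Longrightarrow> c \<le> A t"
    by (rule weight_lower_bound[OF A ab(1,2)]) (assumption, (rule that; blast))
  have Cm: "C \<in> sets lebesgue" "emeasure lebesgue C < \<infinity>"
    using \<phi>(2) emeasure_compact_finite[OF \<phi>(2)] by (simp_all add: compact_imp_closed)
  have "bounded (\<phi> ` C)"
    by (intro compact_imp_bounded compact_continuous_image continuous_on_subset[OF \<phi>(1)] \<phi>(2)) simp
  then obtain B0 where B0: "\<And>x. x \<in> C \<Longrightarrow> norm (\<phi> x) \<le> B0" unfolding bounded_iff by blast
  define B where "B = max B0 0"
  have B: "0 \<le> B" "\<And>x. \<bar>\<phi> x\<bar> \<le> B * indicator C x"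
  proof -
    show "\<bar>\<phi> x\<bar> \<le> B * indicator C x" for x
      using B0[of x] \<phi>(4)[of x] by (cases "x \<in> C") (auto simp: B_def)
  qed (simp add: B_def)
  \<comment> \<open>Comparable to the energy norm, with \<open>1 / (n + 1)\<close> added so that it
    stays positive when the energy is 0.\<close>
  define \<delta> where "\<delta> n = sqrt (A_energy A (h n)) + inverse (real (Suc n))" for n
  have E0: "0 \<le> A_energy A (h n)" for n by (rule A_energy_nonneg[of A, OF A(2)])
  have \<delta>: "0 < \<delta> n" for n unfolding \<delta>_def using E0[of n] by (intro add_nonneg_pos) auto
  let ?D = "\<lambda>n x. B * (A (norm x) * (norm (h n x))\<^sup>2 / (2 * \<delta> n) + \<delta> n / (2 * c) * indicator C x)"
  have Di: "integrable lebesgue (?D n)" for n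
    using h(2)[of n] Cm
    by (intro integrable_mult_right Bochner_Integration.integrable_add integrable_divide integrable_real_indicator)
  have le: "AE x in lebesgue. norm (\<phi> x *\<^sub>R h n x) \<le> ?D n x" for n
    using AE_norm_pos
  proof eventually_elim
    case (elim x)
    have a0: "0 < A (norm x)" using A(2)[OF elim] .
    show ?case
    proof (cases "x \<in> C")
      case True
      have cA: "c \<le> A (norm x)" using ab(3)[OF True] by (intro c(2)) auto
      have "norm (h n x) \<le> (A (norm x) / \<delta> n) * (norm (h n x))\<^sup>2 / 2 + 1 / (2 * (A (norm x) / \<delta> n))"
        using young_weight[of "A (norm x) / \<delta> n" "norm (h n x)"] a0 \<delta>[of n] by simp
      also have "1 / (2 * (A (norm x) / \<delta> n)) = \<delta> n / (2 * A (norm x))" by simp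
      also have "\<dots> \<le> \<delta> n / (2 * c)"
        using cA c(1) \<delta>[of n] by (intro divide_left_mono) auto
      finally have "norm (h n x) \<le> A (norm x) * (norm (h n x))\<^sup>2 / (2 * \<delta> n) + \<delta> n / (2 * c)"
        by (simp add: mult.commute)
      then have "\<bar>\<phi> x\<bar> * norm (h n x) \<le> B * (A (norm x) * (norm (h n x))\<^sup>2 / (2 * \<delta> n) + \<delta> n / (2 * c))"
        using B(1) B(2)[of x] True by (intro mult_mono) auto
      then show ?thesis using True by simp
    next
      case False
      then show ?thesis using \<phi>(4)[OF False] B(1) a0 \<delta>[of n] by simp
    qed
  qed
  show i: "integrable lebesgue (\<lambda>x. \<phi> x *\<^sub>R h n x)" for n
  proof (rule Bochner_Integration.integrable_bound[OF Di[of n]])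
    show "(\<lambda>x. \<phi> x *\<^sub>R h n x) \<in> borel_measurable lebesgue"
      by (intro borel_measurable_scaleR continuous_imp_lebesgue_measurable \<phi>(1) h(1))
    show "AE x in lebesgue. norm (\<phi> x *\<^sub>R h n x) \<le> norm (?D n x)"
      using le[of n] by eventually_elim (erule order_trans, simp only: real_norm_def abs_ge_self)
  qed
  have bound: "norm (LINT x|lebesgue. \<phi> x *\<^sub>R h n x)
      \<le> B * (sqrt (A_energy A (h n)) / 2 + \<delta> n / (2 * c) * measure lebesgue C)" for n
  proof -
    have "norm (LINT x|lebesgue. \<phi> x *\<^sub>R h n x) \<le> integral\<^sup>L lebesgue (?D n)"
      by (rule order_trans[OF Bochner_Integration.integral_norm_bound
            integral_mono_AE[OF integrable_norm[OF i] Di le]])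
    also have "\<dots> = B * (A_energy A (h n) / (2 * \<delta> n) + \<delta> n / (2 * c) * measure lebesgue C)"
      using h(2)[of n] Cm by (simp add: A_energy_def)
    also have "A_energy A (h n) / (2 * \<delta> n) \<le> sqrt (A_energy A (h n)) / 2"
    proof -
      have "A_energy A (h n) = sqrt (A_energy A (h n)) * sqrt (A_energy A (h n))" using E0 by simp
      also have "\<dots> \<le> sqrt (A_energy A (h n)) * \<delta> n"
        by (intro mult_left_mono) (auto simp: \<delta>_def E0)
      finally show ?thesis using \<delta>[of n] by (simp add: field_simps)
    qed
    finally show ?thesis using B(1) by (simp add: mult_left_mono)
  qed
  have s0: "(\<lambda>n. sqrt (A_energy A (h n))) \<longlonglongrightarrow> 0"
    using tendsto_real_sqrt[OF conv] by simp
  have "\<delta> \<longlonglongrightarrow> 0" unfolding \<delta>_def[abs_def] using tendsto_add[OF s0 LIMSEQ_inverse_real_of_nat] by simp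
  then have "(\<lambda>n. B * (sqrt (A_energy A (h n)) / 2 + \<delta> n / (2 * c) * measure lebesgue C))
      \<longlonglongrightarrow> B * (0 / 2 + 0 / (2 * c) * measure lebesgue C)"
    using c(1) by (intro tendsto_intros s0) auto
  then have lim0: "(\<lambda>n. B * (sqrt (A_energy A (h n)) / 2 + \<delta> n / (2 * c) * measure lebesgue C)) \<longlonglongrightarrow> 0"
    by simp
  show "(\<lambda>n. LINT x|lebesgue. \<phi> x *\<^sub>R h n x) \<longlonglongrightarrow> 0"
    by (rule Lim_null_comparison[OF _ lim0]) (intro always_eventually allI bound)
qed

text \<open>Test functions vanish near the origin, so the uniform convergence away from it handles
  the side containing \<open>w n\<close>, and \<open>energy_weak_convergence\<close> handles the
  side containing the gradients; the identity for \<open>w n\<close> passes to the limit.\<close>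

lemma weak_grad_limit:
  fixes w :: "nat \<Rightarrow> 'a::euclidean_space \<Rightarrow> real" and G :: "'a \<Rightarrow> 'a"
  assumes A: "continuous_on {0<..} A" "\<And>t. 0 < t \<Longrightarrow> 0 < A t"
    and w: "\<And>n. finite_energy A (w n)"
    and f: "\<And>a e. 0 < a \<Longrightarrow> 0 < e \<Longrightarrow> \<exists>M. \<forall>n\<ge>M. \<forall>x. a \<le> norm x \<longrightarrow> \<bar>w n x - f (norm x)\<bar> \<le> e"
    and u: "u \<in> borel_measurable lebesgue" "AE x in lebesgue. u x = f (norm x)"
    and G: "G \<in> borel_measurable lebesgue"
      "\<And>n. integrable lebesgue (energy_density A (\<lambda>x. grad (w n) x - G x))"
      "(\<lambda>n. A_energy A (\<lambda>x. grad (w n) x - G x)) \<longlonglongrightarrow> 0"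
      "integrable lebesgue (energy_density A G)"
  shows "is_weak_grad (- {0}) u G"
  unfolding is_weak_grad_def
proof (intro conjI ballI)
  have C1: "C1 (w n)" for n using w[of n] by (simp add: finite_energy_def)
  have gm: "grad (w n) \<in> borel_measurable lebesgue" for n
    by (intro continuous_imp_lebesgue_measurable C1_grad_continuous C1)
  have bound: "\<exists>M B. \<forall>n\<ge>M. \<forall>x\<in>C. \<bar>w n x\<bar> \<le> B \<and> \<bar>f (norm x)\<bar> \<le> B"
    if C: "compact C" "C \<subseteq> - {0}" for C :: "'a set"
  proof -
    obtain a b where ab: "0 < a" "\<And>x. x \<in> C \<Longrightarrow> a \<le> norm x \<and> norm x \<le> b"
      by (rule compact_away_from_zero[OF C]) (rule that; blast)
    obtain M where M: "\<forall>n\<ge>M. \<forall>x. a \<le> norm x \<longrightarrow> \<bar>w n x - f (norm x)\<bar> \<le> 1"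
      using f[OF ab(1) zero_less_one] by (rule exE)
    have "bounded (w M ` C)"
      by (intro compact_imp_bounded compact_continuous_image C1_continuous C1 C)
    then obtain B where B: "\<And>x. x \<in> C \<Longrightarrow> norm (w M x) \<le> B" unfolding bounded_iff by blast
    have "\<bar>w n x\<bar> \<le> B + 2 \<and> \<bar>f (norm x)\<bar> \<le> B + 2" if "M \<le> n" "x \<in> C" for n x
    proof -
      have "a \<le> norm x" using ab(2) that by blast
      then have "\<bar>w n x - f (norm x)\<bar> \<le> 1" "\<bar>w M x - f (norm x)\<bar> \<le> 1" using M that by auto
      then show ?thesis using B[OF that(2)] unfolding real_norm_def by linarith
    qed
    then show ?thesis by (intro exI[of _ M] exI[of _ "B + 2"]) blast
  qed
  have lim: "AE x in lebesgue. (\<lambda>n. w n x) \<longlonglongrightarrow> u x"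
    using u(2) AE_norm_pos
  proof eventually_elim
    case (elim x)
    show ?case
    proof (rule LIMSEQ_I)
      fix e :: real assume e: "0 < e"
      obtain M where M: "\<forall>n\<ge>M. \<forall>y. norm x \<le> norm y \<longrightarrow> \<bar>w n y - f (norm y)\<bar> \<le> e / 2"
        using f[OF elim(2) half_gt_zero[OF e]] by (rule exE)
      have "norm (w n x - u x) < e" if "M \<le> n" for n
      proof -
        have "\<bar>w n x - f (norm x)\<bar> \<le> e / 2" using M that by simp
        then show ?thesis using e elim(1) by simp
      qed
      then show "\<exists>M. \<forall>n\<ge>M. norm (w n x - u x) < e" by blast
    qed
  qed
  show "Lp_loc 1 (- {0}) G" by (rule finite_energy_Lp_loc[OF A G(1,4)])
  show "Lp_loc 1 (- {0}) u"
    unfolding Lp_loc_def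
  proof (intro conjI allI impI; (elim conjE)?)
    show "u \<in> borel_measurable (lebesgue_on (- {0}))" using u(1) by (rule measurable_restrict_space1)
    fix C :: "'a set" assume C: "compact C" "C \<subseteq> - {0}"
    obtain M B where B: "\<forall>n\<ge>M. \<forall>x\<in>C. \<bar>w n x\<bar> \<le> B \<and> \<bar>f (norm x)\<bar> \<le> B"
      using bound[OF C] by (elim exE)
    have Cm: "C \<in> sets lebesgue" "emeasure lebesgue C < \<infinity>"
      using C(1) emeasure_compact_finite[OF C(1)] by (simp_all add: compact_imp_closed)
    show "set_integrable lebesgue C (\<lambda>x. norm (u x) powr 1)"
      unfolding set_integrable_def
    proof (rule Bochner_Integration.integrable_bound)
      show "integrable lebesgue (\<lambda>x. indicator C x * B)"
        using Cm by (intro integrable_mult_left integrable_real_indicator)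
      have "(\<lambda>x. norm (u x) powr 1) \<in> borel_measurable lebesgue" using u(1) by measurable
      then show "(\<lambda>x. indicator C x *\<^sub>R (norm (u x) powr 1)) \<in> borel_measurable lebesgue"
        by (intro borel_measurable_scaleR borel_measurable_indicator Cm)
      show "AE x in lebesgue. norm (indicator C x *\<^sub>R (norm (u x) powr 1)) \<le> norm (indicator C x * B)"
        using u(2)
      proof eventually_elim
        case (elim x)
        show ?case
        proof (cases "x \<in> C")
          case True
          then have "\<bar>f (norm x)\<bar> \<le> B" using B by blast
          then show ?thesis using True elim by simp
        qed simp
      qed
    qed
  qed
  fix \<phi> :: "'a \<Rightarrow> real" assume \<phi>: "\<phi> \<in> Cc_infinity (- {0})"
  let ?C = "closure {x. \<phi> x \<noteq> 0}"
  have \<phi>1: "C1 \<phi>" using \<phi> by (rule Cc_infinity_C1)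
  have C: "compact ?C" "?C \<subseteq> - {0}" using \<phi> unfolding Cc_infinity_def by blast+
  have out: "\<phi> x = 0" "grad \<phi> x = 0" if "x \<notin> ?C" for x
    using that closure_subset[of "{x. \<phi> x \<noteq> 0}"] grad_zero_outside[of x \<phi>] by auto
  have ind: "indicat_real (- {0}) x *\<^sub>R c *\<^sub>R grad \<phi> x = c *\<^sub>R grad \<phi> x"
    "indicat_real (- {0}) x *\<^sub>R \<phi> x *\<^sub>R v = \<phi> x *\<^sub>R v" for x v :: 'a and c
    using out[of x] C(2) by (auto simp: indicator_def)
  have IBP: "(LINT x|lebesgue. w n x *\<^sub>R grad \<phi> x) = - (LINT x|lebesgue. \<phi> x *\<^sub>R grad (w n) x)" for n
    using is_weak_gradD[OF C1_weak_grad[OF C1 open_Compl[OF closed_singleton]] \<phi>, of n]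
    by (simp only: set_lebesgue_integral_def ind)
  have "(\<lambda>n. LINT x|lebesgue. w n x *\<^sub>R grad \<phi> x) \<longlonglongrightarrow> (LINT x|lebesgue. u x *\<^sub>R grad \<phi> x)"
  proof -
    \<comment> \<open>The common bound holds only from the index \<open>M\<close> on, hence the
      shift of the sequence in the dominated convergence.\<close>
    obtain M B where B: "\<forall>n\<ge>M. \<forall>x\<in>?C. \<bar>w n x\<bar> \<le> B \<and> \<bar>f (norm x)\<bar> \<le> B"
      using bound[OF C] by (elim exE)
    have "(\<lambda>n. LINT x|lebesgue. w (n + M) x *\<^sub>R grad \<phi> x) \<longlonglongrightarrow> (LINT x|lebesgue. u x *\<^sub>R grad \<phi> x)"
    proof (rule integral_dominated_convergence)
      show "(\<lambda>x. u x *\<^sub>R grad \<phi> x) \<in> borel_measurable lebesgue"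
        by (intro borel_measurable_scaleR u(1) continuous_imp_lebesgue_measurable C1_grad_continuous \<phi>1)
      show "(\<lambda>x. w (n + M) x *\<^sub>R grad \<phi> x) \<in> borel_measurable lebesgue" for n
        by (intro borel_measurable_scaleR continuous_imp_lebesgue_measurable C1_grad_continuous[OF \<phi>1]
            C1_continuous[OF C1])
      have "integrable lebesgue (grad \<phi>)"
        by (rule integrable_lebesgue_compact_support[OF C1_grad_continuous[OF \<phi>1] C(1) out(2)])
      then show "integrable lebesgue (\<lambda>x. B * norm (grad \<phi> x))" by simp
      show "AE x in lebesgue. (\<lambda>n. w (n + M) x *\<^sub>R grad \<phi> x) \<longlonglongrightarrow> u x *\<^sub>R grad \<phi> x"
        using lim
      proof eventually_elim
        case (elim x)
        from LIMSEQ_ignore_initial_segment[OF elim, of M] show ?case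
          by (rule tendsto_scaleR[OF _ tendsto_const])
      qed
      show "AE x in lebesgue. norm (w (n + M) x *\<^sub>R grad \<phi> x) \<le> B * norm (grad \<phi> x)" for n
      proof (rule AE_I2)
        fix x :: 'a
        show "norm (w (n + M) x *\<^sub>R grad \<phi> x) \<le> B * norm (grad \<phi> x)"
        proof (cases "x \<in> ?C")
          case True
          then have "\<bar>w (n + M) x\<bar> \<le> B" using B by simp
          then show ?thesis by (simp add: mult_right_mono)
        next
          case False
          then show ?thesis by (simp add: out(2))
        qed
      qed
    qed
    then show ?thesis by (rule LIMSEQ_offset)
  qed
  moreover have "(\<lambda>n. LINT x|lebesgue. w n x *\<^sub>R grad \<phi> x) \<longlonglongrightarrow> - (LINT x|lebesgue. \<phi> x *\<^sub>R G x)"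
  proof -
    have dm: "(\<lambda>x. grad (w n) x - G x) \<in> borel_measurable lebesgue" for n
      using gm G(1) by (rule borel_measurable_diff)
    note conv = energy_weak_convergence[OF A dm G(2,3) C1_continuous[OF \<phi>1] C out(1)]
    have i: "integrable lebesgue (\<lambda>x. \<phi> x *\<^sub>R grad (w n) x)" for n
    proof (rule integrable_lebesgue_compact_support[OF _ C(1)])
      show "continuous_on UNIV (\<lambda>x. \<phi> x *\<^sub>R grad (w n) x)"
        by (rule continuous_on_scaleR[OF C1_continuous[OF \<phi>1] C1_grad_continuous[OF C1]])
      show "\<phi> x *\<^sub>R grad (w n) x = 0" if "x \<notin> ?C" for x
        unfolding out(1)[OF that] by (rule scaleR_zero_left)
    qed
    have iG: "integrable lebesgue (\<lambda>x. \<phi> x *\<^sub>R G x)"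
      using Bochner_Integration.integrable_diff[OF i conv(1), of 0 0] by (simp add: scaleR_diff_right)
    have "(LINT x|lebesgue. \<phi> x *\<^sub>R (grad (w n) x - G x))
        = - (LINT x|lebesgue. w n x *\<^sub>R grad \<phi> x) - (LINT x|lebesgue. \<phi> x *\<^sub>R G x)" for n
      using i[of n] iG by (simp add: scaleR_diff_right IBP)
    then have "(\<lambda>n. - (LINT x|lebesgue. w n x *\<^sub>R grad \<phi> x) - (LINT x|lebesgue. \<phi> x *\<^sub>R G x)) \<longlonglongrightarrow> 0"
      using conv(2) by simp
    from tendsto_minus[OF tendsto_add[OF this tendsto_const[of "LINT x|lebesgue. \<phi> x *\<^sub>R G x"]]]
    show ?thesis by simp
  qed
  ultimately have "(LINT x|lebesgue. u x *\<^sub>R grad \<phi> x) = - (LINT x|lebesgue. \<phi> x *\<^sub>R G x)"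
    by (rule LIMSEQ_unique)
  then show "(LINT x:- {0}|lebesgue. u x *\<^sub>R grad \<phi> x) = - (LINT x:- {0}|lebesgue. \<phi> x *\<^sub>R G x)"
    by (simp only: set_lebesgue_integral_def ind)
qed

text \<open>Measurability of \<open>h\<close> is deduced from the equality almost everywhere. This
  suits \<open>wgrad\<close>, a choice about which only its defining property is known.\<close>

lemma A_energy_cong_AE:
  assumes A: "continuous_on {0<..} A"
    and g: "g \<in> borel_measurable lebesgue" and eq: "AE x in lebesgue. x \<in> - {0} \<longrightarrow> h x = g x"
  shows "A_energy A h = A_energy A (g :: 'a::euclidean_space \<Rightarrow> 'a)"
  unfolding A_energy_def
proof (rule integral_cong_AE)
  let ?F = "\<lambda>u x. A (norm x) * (norm (u x :: 'a))\<^sup>2"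
  have "(\<lambda>x. (norm (g x))\<^sup>2) \<in> borel_measurable lebesgue" using g by measurable
  then show m: "?F g \<in> borel_measurable lebesgue"
    by (intro borel_measurable_times continuous_on_pos_measurable_norm A)
  show ae: "AE x in lebesgue. ?F h x = ?F g x"
    using eq AE_norm_pos by eventually_elim simp
  then have "AE x in lebesgue. ?F g x = ?F h x" by eventually_elim (rule sym)
  then show "?F h \<in> borel_measurable lebesgue" by (rule borel_measurable_AE[OF m])
qed

lemma LsumI: "u1 \<in> Lq K p \<Longrightarrow> u2 \<in> Lq K q \<Longrightarrow> u = (\<lambda>x. u1 x + u2 x) \<Longrightarrow> u \<in> Lsum K p q"
  unfolding Lsum_def by blast

lemma Lsum_one_measurable: "u \<in> Lsum K p q \<Longrightarrow> u \<in> borel_measurable lebesgue"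
  by (auto simp: Lsum_def Lq_def)

lemma p_exp_pos:
  assumes "hyp_A N A a0 ainf" "0 < N"
  shows "0 < p_exp N a0" "0 < p_exp N ainf"
  using assms by (auto simp: hyp_A_def p_exp_def)

text \<open>The approximating sequence has two limits: a radial profile pointwise, and
  \<open>G\<close> for the gradients. Convergence in the sum space identifies \<open>u\<close> with
  the first, uniqueness of weak gradients identifies \<open>wgrad u\<close> with the second. The
  strict inequality for \<open>t\<close> ensures \<open>t > 0\<close> even when the energy is
  0.\<close>

lemma D_space_profile:
  fixes u :: "'a::euclidean_space \<Rightarrow> real"
  assumes A: "hyp_A DIM('a) A a0 ainf" and u: "u \<in> D_space A a0 ainf"
  shows "\<exists>f. (AE x in lebesgue. u x = f (norm x)) \<and>
    (\<forall>t. sqrt (A_energy A (wgrad u)) < t \<longrightarrow>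
      profile_bound DIM('a) A (2 * t / sqrt (sphere_area DIM('a))) f)"
proof -
  let ?p = "p_exp DIM('a) a0" and ?q = "p_exp DIM('a) ainf"
  have cont: "continuous_on {0<..} A" and pos: "\<And>t. 0 < t \<Longrightarrow> 0 < A t"
    using A unfolding hyp_A_def by auto
  have pq: "0 < ?p" "0 < ?q" using p_exp_pos[OF A] by simp_all
  have uL: "u \<in> Lsum (\<lambda>_. 1) ?p ?q" using u by (simp add: D_space_def Let_def)
  then have um: "u \<in> borel_measurable lebesgue" by (rule Lsum_one_measurable)
  obtain w where wS': "\<forall>n. w n \<in> S_space A"
    and wlim: "(\<lambda>n. Lsum_norm (\<lambda>_. 1) ?p ?q (\<lambda>x. w n x - u x)) \<longlonglongrightarrow> 0"
    and wC: "\<forall>e>0. \<exists>M::nat. \<forall>m\<ge>M. \<forall>n\<ge>M. S_norm A (\<lambda>x. w m x - w n x) < e"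
    using u unfolding D_space_def Let_def mem_Collect_eq by (elim conjE exE) (rule that)
  from wS' have wS: "w n \<in> S_space A" for n ..
  have fe: "finite_energy A (w n)" for n by (rule S_space_finite_energy[OF wS])
  then have C1: "C1 (w n)" and supp: "compact (closure {x. w n x \<noteq> 0})"
    and gi: "integrable lebesgue (energy_density A (grad (w n)))" for n
    by (simp_all add: finite_energy_def)
  have gm: "grad (w n) \<in> borel_measurable lebesgue" for n
    by (intro continuous_imp_lebesgue_measurable C1_grad_continuous C1)
  have Cauchy: "\<exists>M. \<forall>m\<ge>M. \<forall>n\<ge>M. A_energy A (\<lambda>x. grad (w m) x - grad (w n) x) < e" if e: "0 < e" for e
  proof -
    obtain M where M: "\<forall>m\<ge>M. \<forall>n\<ge>M. S_norm A (\<lambda>x. w m x - w n x) < sqrt e"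
      using wC[rule_format, of "sqrt e"] e by auto
    have "A_energy A (\<lambda>x. grad (w m) x - grad (w n) x) < e" if mn: "M \<le> m" "M \<le> n" for m n
    proof -
      have "sqrt (A_energy A (grad (\<lambda>x. w m x - w n x))) < sqrt e"
        using M mn by (simp add: S_norm_def)
      then show ?thesis using C1_diff(2)[OF C1 C1, of m n] by simp
    qed
    then show ?thesis by blast
  qed
  have "\<exists>f. \<forall>a>0. \<forall>e>0. \<exists>M. \<forall>n\<ge>M. \<forall>x. a \<le> norm x \<longrightarrow> \<bar>w n x - f (norm x)\<bar> \<le> e"
    by (rule energy_Cauchy_pointwise[OF A fe Cauchy])
  then obtain f where f0: "\<forall>a>0. \<forall>e>0. \<exists>M. \<forall>n\<ge>M. \<forall>x. a \<le> norm x \<longrightarrow> \<bar>w n x - f (norm x)\<bar> \<le> e"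
    by (rule exE)
  have f: "\<exists>M. \<forall>n\<ge>M. \<forall>x. a \<le> norm x \<longrightarrow> \<bar>w n x - f (norm x)\<bar> \<le> e" if "0 < a" "0 < e" for a e
    using f0 that by simp
  have flim: "(\<lambda>n. w n x) \<longlonglongrightarrow> f (norm x)" if x: "0 < norm x" for x :: 'a
  proof (rule LIMSEQ_I)
    fix e :: real assume e: "0 < e"
    obtain M where M: "\<forall>n\<ge>M. \<forall>y. norm x \<le> norm y \<longrightarrow> \<bar>w n y - f (norm y)\<bar> \<le> e / 2"
      using f[OF x half_gt_zero[OF e]] by (rule exE)
    have "norm (w n x - f (norm x)) < e" if "M \<le> n" for n
    proof -
      have "\<bar>w n x - f (norm x)\<bar> \<le> e / 2" using M that by simp
      then show ?thesis using e by simp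
    qed
    then show "\<exists>M. \<forall>n\<ge>M. norm (w n x - f (norm x)) < e" by blast
  qed
  have uf: "AE x in lebesgue. u x = f (norm x)"
  proof -
    obtain u1 u2 where u12: "u1 \<in> Lq (\<lambda>_. 1) ?p" "u2 \<in> Lq (\<lambda>_. 1) ?q" "u = (\<lambda>x. u1 x + u2 x)"
      using uL unfolding Lsum_def by blast
    have "(\<lambda>x. w n x - u x) \<in> Lsum (\<lambda>_. 1) ?p ?q" for n
    proof -
      have "w n \<in> Lq (\<lambda>_. 1) ?p"
        by (rule continuous_compact_support_Lq_one[OF C1_continuous[OF C1] supp pq(1)])
      then have "(\<lambda>x. w n x - u1 x) \<in> Lq (\<lambda>_. 1) ?p" by (rule Lq_one_diff[OF pq(1) _ u12(1)])
      moreover have "(\<lambda>x. - u2 x) \<in> Lq (\<lambda>_. 1) ?q" using u12(2) by (simp add: Lq_def)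
      moreover have "(\<lambda>x. w n x - u x) = (\<lambda>x. (w n x - u1 x) + - u2 x)"
        by (rule ext) (simp add: u12(3))
      ultimately show ?thesis by (rule LsumI)
    qed
    from Lsum_one_norm_AE_subseq[OF pq this wlim]
    obtain r :: "nat \<Rightarrow> nat" where r: "strict_mono r" "AE x in lebesgue. (\<lambda>n. w (r n) x - u x) \<longlonglongrightarrow> 0"
      by blast
    from r(2) AE_norm_pos show ?thesis
    proof eventually_elim
      case (elim x)
      have "(\<lambda>n. w (r n) x) \<longlonglongrightarrow> f (norm x)"
        using LIMSEQ_subseq_LIMSEQ[OF flim[OF elim(2)] r(1)] by (simp add: o_def)
      moreover have "(\<lambda>n. w (r n) x) \<longlonglongrightarrow> u x" using elim(1) by (rule LIM_zero_cancel)
      ultimately show ?case by (rule LIMSEQ_unique[symmetric])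
    qed
  qed
  obtain G where G0: "G \<in> borel_measurable lebesgue \<and>
    (\<forall>n. integrable lebesgue (energy_density A (\<lambda>x. grad (w n) x - G x))) \<and>
    (\<lambda>n. A_energy A (\<lambda>x. grad (w n) x - G x)) \<longlonglongrightarrow> 0"
    using energy_complete[OF cont pos gm energy_diff(1)[OF cont pos gm gm gi gi] Cauchy] by (rule exE)
  then have G: "G \<in> borel_measurable lebesgue"
    "\<And>n. integrable lebesgue (energy_density A (\<lambda>x. grad (w n) x - G x))"
    "(\<lambda>n. A_energy A (\<lambda>x. grad (w n) x - G x)) \<longlonglongrightarrow> 0"
    by simp_all
  have dm: "(\<lambda>x. grad (w n) x - G x) \<in> borel_measurable lebesgue" for n
    using gm G(1) by (rule borel_measurable_diff)
  have Gi: "integrable lebesgue (energy_density A G)"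
    using energy_diff(1)[OF cont pos gm dm gi G(2), of 0 0] by simp
  have Gw: "is_weak_grad (- {0}) u G"
    by (rule weak_grad_limit[OF cont pos fe f um uf G Gi])
  \<comment> \<open>\<open>G\<close> witnesses that a weak gradient exists, so the chosen
    \<open>wgrad u\<close> really is one.\<close>
  from this have wg: "is_weak_grad (- {0}) u (wgrad u)"
    unfolding wgrad_def by (rule someI[of "is_weak_grad (- {0}) u" G])
  have "AE x in lebesgue. x \<in> - {0} \<longrightarrow> wgrad u x = G x"
    by (rule weak_grad_unique[OF open_Compl[OF closed_singleton] wg Gw])
  then have EG: "A_energy A (wgrad u) = A_energy A G" by (rule A_energy_cong_AE[OF cont G(1)])
  obtain b :: 'a where b: "b \<in> Basis" using nonempty_Basis by blast
  then have nb: "norm b = 1" by simp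
  show ?thesis
  proof (intro exI[of _ f] conjI allI impI uf)
    fix t assume t: "sqrt (A_energy A (wgrad u)) < t"
    have E0: "0 \<le> A_energy A G" by (rule A_energy_nonneg[of A, OF pos])
    then have t0: "0 < t" using t EG by (metis le_less_trans real_sqrt_ge_zero)
    have Et: "A_energy A G < t\<^sup>2"
      using t EG t0 by (metis real_less_lsqrt real_sqrt_less_iff real_sqrt_abs abs_of_pos)
    have "\<forall>\<^sub>F n in sequentially. A_energy A (\<lambda>x. grad (w n) x - G x) < t\<^sup>2"
      using t0 by (intro order_tendstoD(2)[OF G(3)]) simp
    then obtain M where M: "\<And>n. M \<le> n \<Longrightarrow> A_energy A (\<lambda>x. grad (w n) x - G x) < t\<^sup>2"
      unfolding eventually_sequentially by blast
    \<comment> \<open>From some index on, \<open>grad (w n)\<close> differs from \<open>G\<close> by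
      energy below the square of \<open>t\<close>, and so does \<open>G\<close> from 0;
      \<open>energy_diff\<close> then gives four times that square, whence the factor 2.\<close>
    have pb: "profile_bound DIM('a) A (2 * t / sqrt (sphere_area DIM('a)))
        (\<lambda>r. w (n + M) (r *\<^sub>R b))" for n
    proof (rule finite_energy_profile_bound[OF cont pos fe nb])
      have neg: "(\<lambda>x. - G x) \<in> borel_measurable lebesgue" using G(1) by measurable
      have "A_energy A (\<lambda>x. (grad (w (n + M)) x - G x) - - G x)
          \<le> 2 * A_energy A (\<lambda>x. grad (w (n + M)) x - G x) + 2 * A_energy A (\<lambda>x. - G x)"
        by (rule energy_diff(2)[OF cont pos dm neg G(2)]) (simp_all add: Gi)
      moreover have "A_energy A (\<lambda>x. - G x) = A_energy A G" by (simp add: A_energy_def)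
      ultimately have "A_energy A (grad (w (n + M))) \<le> 4 * t\<^sup>2"
        using M[of "n + M"] Et by simp
      then show "A_energy A (grad (w (n + M))) \<le> (2 * t)\<^sup>2" by (simp add: power_mult_distrib)
    qed (use t0 in simp_all)
    show "profile_bound DIM('a) A (2 * t / sqrt (sphere_area DIM('a))) f"
    proof (rule profile_bound_limit[OF pb _ tendsto_const])
      fix r :: real assume r: "0 < r"
      then have "(\<lambda>n. w n (r *\<^sub>R b)) \<longlonglongrightarrow> f r" using flim[of "r *\<^sub>R b"] nb by simp
      then show "(\<lambda>n. w (n + M) (r *\<^sub>R b)) \<longlonglongrightarrow> f r" by (rule LIMSEQ_ignore_initial_segment)
    qed
  qed
qed

subsection \<open>Weighted integrals\<close>

text \<open>A crude form of the weighted arithmetic-geometric inequality: both factors are bounded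
  by powers of the maximum. The case distinction implements the convention that the power with
  exponent 0 is 1, also at \<open>a = 0\<close>.\<close>

lemma interpolation_le_sum:
  fixes a z \<beta> :: real
  assumes "0 \<le> a" "0 < z" "0 \<le> \<beta>" "\<beta> \<le> 1"
  shows "(if \<beta> = 0 then 1 else a powr \<beta>) * z powr (1 - \<beta>) \<le> a + z"
proof (cases "\<beta> = 0")
  case False
  define m where "m = max a z"
  have m: "0 < m" "a \<le> m" "z \<le> m" "m \<le> a + z" using assms by (auto simp: m_def)
  have "a powr \<beta> * z powr (1 - \<beta>) \<le> m powr \<beta> * m powr (1 - \<beta>)"
    using assms m by (intro mult_mono powr_mono2) auto
  also have "\<dots> = m" using m by (simp add: powr_add[symmetric])
  finally show ?thesis using False m by simp
qed (use assms in simp)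

text \<open>\<open>\<delta>\<close> solves \<open>\<delta> + (\<delta> - N) (1 - \<beta>) = \<alpha> - \<gamma> (q - 2 \<beta>)\<close>, so that one factor \<open>\<rho>\<^sup>\<delta>\<close> is
  left over after the interpolation.\<close>

lemma weighted_power_pointwise:
  fixes N \<rho> V \<beta> y C \<gamma> q k M \<alpha> :: real
  assumes \<rho>: "0 < \<rho>" and V: "0 \<le> V" and \<beta>: "0 \<le> \<beta>" "\<beta> \<le> 1" and y: "0 \<le> y" "y \<le> C * \<rho> powr - \<gamma>"
    and C: "0 < C" and q: "2 * \<beta> < q" and M: "0 \<le> M"
    and k: "k \<le> M * (\<rho> powr \<alpha> * (if \<beta> = 0 then 1 else V powr \<beta>))"
  defines "\<delta> \<equiv> (\<alpha> - \<gamma> * (q - 2 * \<beta>) + N * (1 - \<beta>)) / (2 - \<beta>)"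
  shows "k * y powr q \<le> M * C powr (q - 2 * \<beta>) * (\<rho> powr \<delta> * (V * y\<^sup>2 + \<rho> powr (\<delta> - N)))"
proof (cases "y = 0")
  case True
  then show ?thesis using M C \<rho> by simp
next
  case False
  with y have y0: "0 < y" by simp
  let ?V = "if \<beta> = 0 then 1 else V powr \<beta>" and ?W = "if \<beta> = 0 then 1 else (V * y\<^sup>2) powr \<beta>"
  have W: "?V * y powr (2 * \<beta>) = ?W"
    using y0 V by (simp add: powr_mult powr_powr flip: powr_numeral)
  have V0: "0 \<le> ?V" by simp
  have W0: "0 \<le> ?W" by simp
  have exps: "\<delta> + (\<delta> - N) * (1 - \<beta>) = \<alpha> - \<gamma> * (q - 2 * \<beta>)"
  proof -
    have "\<delta> * (2 - \<beta>) = \<alpha> - \<gamma> * (q - 2 * \<beta>) + N * (1 - \<beta>)" using \<beta> by (simp add: \<delta>_def)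
    then show ?thesis by (simp add: algebra_simps)
  qed
  \<comment> \<open>The pointwise decay of \<open>y\<close> is spent on the exponent
    \<open>q - 2 * \<beta>\<close>, positive by assumption; the remaining exponent
    \<open>2 * \<beta>\<close> combines with the power of \<open>V\<close> into a power of
    \<open>V * y\<close> squared times... the integrable quantity
    \<open>V * y\<^sup>2\<close>.\<close>
  have yq: "y powr q = y powr (q - 2 * \<beta>) * y powr (2 * \<beta>)" by (simp add: powr_add[symmetric])
  have "k * y powr q \<le> M * (\<rho> powr \<alpha> * ?V) * (y powr (q - 2 * \<beta>) * y powr (2 * \<beta>))"
    unfolding yq[symmetric] using k by (intro mult_right_mono) auto
  also have "M * (\<rho> powr \<alpha> * ?V) * (y powr (q - 2 * \<beta>) * y powr (2 * \<beta>)) =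
      M * \<rho> powr \<alpha> * y powr (q - 2 * \<beta>) * ?W"
    unfolding W[symmetric] by (simp only: mult_ac)
  also have "\<dots> \<le> M * \<rho> powr \<alpha> * (C * \<rho> powr - \<gamma>) powr (q - 2 * \<beta>) * ?W"
    using y y0 q M W0 by (intro mult_right_mono mult_left_mono powr_mono2) auto
  also have "(C * \<rho> powr - \<gamma>) powr (q - 2 * \<beta>) = C powr (q - 2 * \<beta>) * \<rho> powr (- \<gamma> * (q - 2 * \<beta>))"
    using C by (simp add: powr_mult powr_powr)
  also have "M * \<rho> powr \<alpha> * (C powr (q - 2 * \<beta>) * \<rho> powr (- \<gamma> * (q - 2 * \<beta>))) * ?W
      = M * C powr (q - 2 * \<beta>) * (\<rho> powr (\<alpha> + - \<gamma> * (q - 2 * \<beta>)) * ?W)"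
    by (simp only: powr_add mult_ac)
  also have "\<alpha> + - \<gamma> * (q - 2 * \<beta>) = \<delta> + (\<delta> - N) * (1 - \<beta>)" using exps by simp
  also have "\<rho> powr (\<delta> + (\<delta> - N) * (1 - \<beta>)) * ?W = \<rho> powr \<delta> * (?W * (\<rho> powr (\<delta> - N)) powr (1 - \<beta>))"
    by (simp only: powr_add powr_powr mult_ac)
  also have "M * C powr (q - 2 * \<beta>) * \<dots> \<le> M * C powr (q - 2 * \<beta>) * (\<rho> powr \<delta> * (V * y\<^sup>2 + \<rho> powr (\<delta> - N)))"
    using M V \<rho> \<beta> by (intro mult_left_mono interpolation_le_sum) auto
  finally show ?thesis .
qed

abbreviation (input) K_power ::
  "(real \<Rightarrow> real) \<Rightarrow> real \<Rightarrow> 'a::euclidean_space set \<Rightarrow> ('a \<Rightarrow> real) \<Rightarrow> 'a \<Rightarrow> real" where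
  "K_power K q S v \<equiv> \<lambda>x. indicator S x * (K (norm x) * \<bar>v x\<bar> powr q)"

text \<open>Integrates the pointwise estimate. \<open>D\<close> bounds the leftover factor on
  \<open>S\<close> and carries all the smallness; the bracket \<open>1 + P\<close> stays bounded
  when \<open>S\<close> shrinks.\<close>

lemma weighted_power_integral:
  fixes v :: "'a::euclidean_space \<Rightarrow> real"
  assumes S: "S \<in> sets lebesgue"
    and K: "(\<lambda>x::'a. K (norm x)) \<in> borel_measurable lebesgue" "\<And>r. 0 < r \<Longrightarrow> 0 \<le> K r"
    and V: "\<And>r. 0 < r \<Longrightarrow> 0 \<le> V r"
    and \<beta>: "0 \<le> \<beta>" "\<beta> \<le> 1" and q: "2 * \<beta> < q" and M: "0 \<le> M" and C: "0 < C"
    and KV: "AE x in lebesgue. x \<in> S \<longrightarrow>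
      K (norm x) \<le> M * (norm x powr \<alpha> * (if \<beta> = 0 then 1 else V (norm x) powr \<beta>))"
    and v: "v \<in> borel_measurable lebesgue" "AE x in lebesgue. x \<in> S \<longrightarrow> \<bar>v x\<bar> \<le> C * norm x powr - \<gamma>"
    and Vv: "integrable lebesgue (\<lambda>x. V (norm x) * (v x)\<^sup>2)" "(LINT x|lebesgue. V (norm x) * (v x)\<^sup>2) \<le> 1"
    and \<delta>: "\<delta> = (\<alpha> - \<gamma> * (q - 2 * \<beta>) + real DIM('a) * (1 - \<beta>)) / (2 - \<beta>)"
    and D: "0 \<le> D" "\<And>x. x \<in> S \<Longrightarrow> x \<noteq> 0 \<Longrightarrow> norm x powr \<delta> \<le> D"
    and P: "integrable lebesgue (\<lambda>x::'a. indicator S x * norm x powr (\<delta> - real DIM('a)))"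
      "(LINT x|lebesgue. indicator S x * norm (x::'a) powr (\<delta> - real DIM('a))) \<le> P"
  shows "integrable lebesgue (K_power K q S v)"
    and "(LINT x|lebesgue. K_power K q S v x) \<le> M * C powr (q - 2 * \<beta>) * D * (1 + P)"
proof -
  let ?c = "M * C powr (q - 2 * \<beta>) * D"
  let ?B = "\<lambda>x. ?c * (V (norm x) * (v x)\<^sup>2 + indicator S x * norm x powr (\<delta> - real DIM('a)))"
  have c0: "0 \<le> ?c" using M D by simp
  have Bi: "integrable lebesgue ?B" using Vv(1) P(1) by simp
  have le: "AE x in lebesgue. 0 \<le> K_power K q S v x \<and>
      K_power K q S v x \<le> ?B x"
    using KV v(2) AE_norm_pos
  proof eventually_elim
    case (elim x)
    have V0: "0 \<le> V (norm x)" "0 \<le> K (norm x)" using V K(2) elim(3) by simp_all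
    show ?case
    proof (cases "x \<in> S")
      case True
      have "K (norm x) * \<bar>v x\<bar> powr q \<le> M * C powr (q - 2 * \<beta>) *
          (norm x powr \<delta> * (V (norm x) * \<bar>v x\<bar>\<^sup>2 + norm x powr (\<delta> - real DIM('a))))"
        unfolding \<delta> using elim True
        by (intro weighted_power_pointwise V0 \<beta> C q M) auto
      also have "\<dots> \<le> M * C powr (q - 2 * \<beta>) * (D * (V (norm x) * \<bar>v x\<bar>\<^sup>2 + norm x powr (\<delta> - real DIM('a))))"
        using D(2)[OF True] elim(3) M V0 by (intro mult_left_mono mult_right_mono) auto
      finally show ?thesis using True V0 by (simp add: mult.assoc)
    next
      case False
      then show ?thesis using c0 V0 by simp
    qed
  qed
  show i: "integrable lebesgue (K_power K q S v)"
  proof (rule Bochner_Integration.integrable_bound[OF Bi])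
    have "(\<lambda>x. \<bar>v x\<bar> powr q) \<in> borel_measurable lebesgue" using v(1) by measurable
    then show "(K_power K q S v) \<in> borel_measurable lebesgue"
      by (intro borel_measurable_times borel_measurable_indicator S K(1))
    show "AE x in lebesgue. norm (K_power K q S v x) \<le> norm (?B x)"
      using le by eventually_elim (simp only: real_norm_def, linarith)
  qed
  have "(LINT x|lebesgue. K_power K q S v x) \<le> integral\<^sup>L lebesgue ?B"
    using le by (intro integral_mono_AE i Bi) (auto elim: eventually_mono)
  also have "\<dots> = ?c * ((LINT x|lebesgue. V (norm x) * (v x)\<^sup>2)
      + (LINT x|lebesgue. indicator S x * norm x powr (\<delta> - real DIM('a))))"
    using Vv(1) P(1) by simp
  also have "\<dots> \<le> ?c * (1 + P)"
    using Vv(2) P(2) c0 by (intro mult_left_mono add_mono) auto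
  finally show "(LINT x|lebesgue. K_power K q S v x) \<le> M * C powr (q - 2 * \<beta>) * D * (1 + P)" .
qed

text \<open>The area of spheres raises the exponent from \<open>\<delta> - N\<close> to
  \<open>\<delta> - 1\<close>, so integrability at 0 and at infinity is decided by the sign of
  \<open>\<delta>\<close>.\<close>

lemma integrable_norm_powr_radial:
  fixes \<delta> :: real
  assumes S: "S \<in> sets borel" "S \<subseteq> {0..}" and I: "((\<lambda>t. t powr (\<delta> - 1)) has_integral I) S"
  shows "integrable lebesgue (\<lambda>x::'a::euclidean_space. indicator S (norm x) * norm x powr (\<delta> - real DIM('a)))"
proof -
  let ?\<omega> = "sphere_area DIM('a)"
  have m: "(\<lambda>t. indicat_real S t * t powr (\<delta> - real DIM('a))) \<in> borel_measurable borel"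
    using S(1) by measurable
  have "(\<integral>\<^sup>+ x. ennreal (indicator S (norm (x::'a)) * norm x powr (\<delta> - real DIM('a))) \<partial>lborel)
     = (\<integral>\<^sup>+ t. ennreal (sphere_weight DIM('a) t) * ennreal (indicator S t * t powr (\<delta> - real DIM('a))) \<partial>lborel)"
    by (rule nn_integral_norm[OF measurable_compose[OF m measurable_ennreal]])
  also have "\<dots> = (\<integral>\<^sup>+ t. ennreal ?\<omega> * ennreal (indicator S t * t powr (\<delta> - 1)) \<partial>lborel)"
  proof (rule nn_integral_cong)
    fix t :: real
    show "ennreal (sphere_weight DIM('a) t) * ennreal (indicator S t * t powr (\<delta> - real DIM('a)))
        = ennreal ?\<omega> * ennreal (indicator S t * t powr (\<delta> - 1))"
    proof (cases "0 < t")
      case True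
      have "t ^ (DIM('a) - 1) * t powr (\<delta> - real DIM('a)) = t powr (\<delta> - 1)"
        using True by (simp add: powr_realpow[symmetric] powr_add[symmetric] of_nat_diff Suc_leI)
      then have "?\<omega> * t ^ (DIM('a) - 1) * (indicator S t * t powr (\<delta> - real DIM('a)))
          = ?\<omega> * (indicator S t * t powr (\<delta> - 1))" by (simp add: mult_ac)
      then show ?thesis using True by (simp add: sphere_weight_def ennreal_mult'[symmetric])
    next
      case False
      then show ?thesis using S(2) by (auto simp: sphere_weight_def indicator_def)
    qed
  qed
  also have "\<dots> = ennreal ?\<omega> * (\<integral>\<^sup>+ t. ennreal (indicator S t * t powr (\<delta> - 1)) \<partial>lborel)"
  proof (intro nn_integral_cmult)
    have "(\<lambda>t. indicat_real S t * t powr (\<delta> - 1)) \<in> borel_measurable borel" using S(1) by measurable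
    then show "(\<lambda>t. ennreal (indicat_real S t * t powr (\<delta> - 1))) \<in> borel_measurable lborel"
      by (intro measurable_compose[OF _ measurable_ennreal]) simp
  qed
  also have "(\<integral>\<^sup>+ t. ennreal (indicator S t * t powr (\<delta> - 1)) \<partial>lborel) = ennreal I"
  proof (rule nn_integral_has_integral_lborel)
    show "(\<lambda>t. indicat_real S t * t powr (\<delta> - 1)) \<in> borel_measurable borel"
      using S(1) by measurable
    have "(\<lambda>t. indicat_real S t * t powr (\<delta> - 1)) = (\<lambda>t. if t \<in> S then t powr (\<delta> - 1) else 0)"
      by (auto simp: fun_eq_iff)
    then show "((\<lambda>t. indicat_real S t * t powr (\<delta> - 1)) has_integral I) UNIV"
      using I by (simp only: has_integral_restrict_UNIV)
  qed simp
  finally have fin: "(\<integral>\<^sup>+ x. ennreal (indicator S (norm (x::'a)) * norm x powr (\<delta> - real DIM('a))) \<partial>lborel) < \<infinity>"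
    by (simp add: ennreal_mult_less_top)
  have m': "(\<lambda>x::'a. indicat_real S (norm x) * norm x powr (\<delta> - real DIM('a))) \<in> borel_measurable lborel"
    using S(1) by measurable
  have "integrable lborel (\<lambda>x::'a. indicator S (norm x) * norm x powr (\<delta> - real DIM('a)))"
    using fin by (intro integrableI_nonneg m') simp_all
  then show ?thesis using m' by (simp only: integrable_completion)
qed

lemma norm_less_eq_ball: "{x::'a::real_normed_vector. norm x < R} = ball 0 R"
  by auto

lemma integrable_norm_powr_ball:
  assumes "0 < \<delta>" "0 < R"
  shows "integrable lebesgue (\<lambda>x::'a::euclidean_space. indicator {x. norm x < R} x * norm x powr (\<delta> - real DIM('a)))"
proof -
  have "((\<lambda>t. t powr (\<delta> - 1)) has_integral R powr (\<delta> - 1 + 1) / (\<delta> - 1 + 1)) {0..R}"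
    using assms by (intro has_integral_powr_from_0) auto
  then have "integrable lebesgue (\<lambda>x::'a. indicator {0..R} (norm x) * norm x powr (\<delta> - real DIM('a)))"
    by (intro integrable_norm_powr_radial) auto
  from integrable_mult_indicator[OF _ this, of "{x. norm x < R}"]
  have "integrable lebesgue (\<lambda>x::'a. indicator {x. norm x < R} x *\<^sub>R (indicator {0..R} (norm x) * norm x powr (\<delta> - real DIM('a))))"
    by (simp add: norm_less_eq_ball)
  also have "(\<lambda>x::'a. indicator {x. norm x < R} x *\<^sub>R (indicator {0..R} (norm x) * norm x powr (\<delta> - real DIM('a))))
      = (\<lambda>x. indicator {x. norm x < R} x * norm x powr (\<delta> - real DIM('a)))"
    by (auto simp: fun_eq_iff indicator_def)
  finally show ?thesis .
qed

lemma integrable_norm_powr_outside: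
  assumes "\<delta> < 0" "0 < R"
  shows "integrable lebesgue (\<lambda>x::'a::euclidean_space. indicator {x. R \<le> norm x} x * norm x powr (\<delta> - real DIM('a)))"
proof -
  have "((\<lambda>t. t powr (\<delta> - 1)) has_integral - (R powr (\<delta> - 1 + 1)) / (\<delta> - 1 + 1)) {R..}"
    using assms by (intro has_integral_powr_to_inf) auto
  then have "integrable lebesgue (\<lambda>x::'a. indicator {R..} (norm x) * norm x powr (\<delta> - real DIM('a)))"
    using assms by (intro integrable_norm_powr_radial) auto
  also have "(\<lambda>x::'a. indicator {R..} (norm x) * norm x powr (\<delta> - real DIM('a)))
      = (\<lambda>x. indicator {x. R \<le> norm x} x * norm x powr (\<delta> - real DIM('a)))"
    by (auto simp: fun_eq_iff indicator_def)
  finally show ?thesis .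
qed

section \<open>Normalised functions and their uniform bounds\<close>

text \<open>A normalised class that retains from a bounded set of \<open>X_space\<close> only what
  the estimates use. No gradient occurs, and so the class is stable under pointwise limits of
  profiles and under half differences.\<close>

definition admissible :: "(real \<Rightarrow> real) \<Rightarrow> (real \<Rightarrow> real) \<Rightarrow> ('a::euclidean_space \<Rightarrow> real) \<Rightarrow> bool" where
  "admissible A V v \<longleftrightarrow> v \<in> borel_measurable lebesgue \<and>
     (\<exists>f. (AE x in lebesgue. v x = f (norm x)) \<and> profile_bound DIM('a) A 1 f) \<and>
     integrable lebesgue (\<lambda>x. V (norm x) * (v x)\<^sup>2) \<and> (LINT x|lebesgue. V (norm x) * (v x)\<^sup>2) \<le> 1"

lemma sqrt_powr_uminus:
  fixes r g :: real
  assumes "0 < r"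
  shows "sqrt (r powr - g) = r powr - (g / 2)"
  using assms by (simp add: powr_half_sqrt[symmetric] powr_powr)

text \<open>The second part of \<open>profile_bound\<close> with the power bound of the radial gap
  for \<open>J\<close>; the square root halves the exponent. The constant is chosen before
  \<open>v\<close>, and all later uniformity rests on this order.\<close>

lemma admissible_decay:
  assumes A: "hyp_A DIM('a::euclidean_space) A a0 ainf" and R: "0 < R"
  shows "\<exists>C>0. \<forall>v::'a \<Rightarrow> real. admissible A V v \<longrightarrow>
      (AE x in lebesgue. norm x < R \<longrightarrow> \<bar>v x\<bar> \<le> C * norm x powr - ((real DIM('a) + a0 - 2) / 2))"
    and "\<exists>C>0. \<forall>v::'a \<Rightarrow> real. admissible A V v \<longrightarrow>
      (AE x in lebesgue. R \<le> norm x \<longrightarrow> \<bar>v x\<bar> \<le> C * norm x powr - ((real DIM('a) + ainf - 2) / 2))"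
proof -
  obtain C where C: "0 < C"
    "\<And>r s. 0 < r \<Longrightarrow> r \<le> R \<Longrightarrow> r \<le> s \<Longrightarrow> radial_gap DIM('a) A r s \<le> C * r powr - (real DIM('a) + a0 - 2)"
    "\<And>r s. R \<le> r \<Longrightarrow> r \<le> s \<Longrightarrow> radial_gap DIM('a) A r s \<le> C * r powr - (real DIM('a) + ainf - 2)"
    by (rule radial_gap_bounds[OF A R]) (simp, (rule that; blast))
  have decay: "AE x in lebesgue. P (norm x) \<longrightarrow> \<bar>v x\<bar> \<le> sqrt C * norm x powr - (g / 2)"
    if v: "admissible A V v"
      and gap: "\<And>r s. 0 < r \<Longrightarrow> P r \<Longrightarrow> r \<le> s \<Longrightarrow> radial_gap DIM('a) A r s \<le> C * r powr - g"
    for v :: "'a \<Rightarrow> real" and P g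
  proof -
    obtain f where f: "AE x in lebesgue. v x = f (norm x)" "profile_bound DIM('a) A 1 f"
      using v unfolding admissible_def by blast
    show ?thesis
      using f(1) AE_norm_pos
    proof eventually_elim
      case (elim x)
      have "\<bar>f (norm x)\<bar> \<le> 1 * sqrt (C * norm x powr - g)" if "P (norm x)"
        using elim(2) C(1) by (intro profile_boundD2[OF f(2)] gap that) simp_all
      then show ?case unfolding elim(1) real_sqrt_mult sqrt_powr_uminus[OF elim(2)] mult_1 by blast
    qed
  qed
  show "\<exists>C>0. \<forall>v::'a \<Rightarrow> real. admissible A V v \<longrightarrow>
      (AE x in lebesgue. norm x < R \<longrightarrow> \<bar>v x\<bar> \<le> C * norm x powr - ((real DIM('a) + a0 - 2) / 2))"
    using C(1,2) by (intro exI[of _ "sqrt C"] conjI allI impI decay) simp_all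
  show "\<exists>C>0. \<forall>v::'a \<Rightarrow> real. admissible A V v \<longrightarrow>
      (AE x in lebesgue. R \<le> norm x \<longrightarrow> \<bar>v x\<bar> \<le> C * norm x powr - ((real DIM('a) + ainf - 2) / 2))"
    using C(1,3) by (intro exI[of _ "sqrt C"] conjI allI impI decay) simp_all
qed

text \<open>The decay estimate at infinity may start at any positive radius, and its right-hand side
  is largest there.\<close>

lemma admissible_bounded:
  assumes A: "hyp_A DIM('a::euclidean_space) A a0 ainf" and a: "0 < a"
  shows "\<exists>C>0. \<forall>v::'a \<Rightarrow> real. admissible A V v \<longrightarrow> (AE x in lebesgue. a \<le> norm x \<longrightarrow> \<bar>v x\<bar> \<le> C)"
proof -
  let ?g = "(real DIM('a) + ainf - 2) / 2"
  have g: "0 < ?g" using A by (simp add: hyp_A_def)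
  obtain C where C: "0 < C" "\<forall>v::'a \<Rightarrow> real. admissible A V v \<longrightarrow>
      (AE x in lebesgue. a \<le> norm x \<longrightarrow> \<bar>v x\<bar> \<le> C * norm x powr - ?g)"
    using admissible_decay(2)[OF A a, of V] by (elim exE conjE)
  have "AE x in lebesgue. a \<le> norm x \<longrightarrow> \<bar>v x\<bar> \<le> C * a powr - ?g" if "admissible A V v" for v :: "'a \<Rightarrow> real"
    using C(2)[rule_format, OF that]
  proof eventually_elim
    case (elim x)
    have "C * norm x powr - ?g \<le> C * a powr - ?g" if "a \<le> norm x"
      using C(1) a g that by (intro mult_left_mono powr_mono2') auto
    then show ?case using elim by (meson order_trans)
  qed
  then show ?thesis using C(1) a by (intro exI[of _ "C * a powr - ?g"]) simp
qed

lemma hyp_K_measurable: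
  assumes "hyp_K N a0 ainf K"
  shows "(\<lambda>x::'a::euclidean_space. K (norm x)) \<in> borel_measurable lebesgue"
  using assms by (intro measurable_norm_comp) (auto simp: hyp_K_def Lp_loc_def)

lemma annulus_sets: "{x::'a::euclidean_space. a \<le> norm x \<and> norm x \<le> b} \<in> sets lebesgue"
proof -
  have "{x::'a. a \<le> norm x \<and> norm x \<le> b} = cball 0 b - ball 0 a" by auto
  then show ?thesis by simp
qed

text \<open>On an annulus the area of spheres is bounded, so the claim reduces to local
  integrability of \<open>K\<close> on the half-line.\<close>

lemma hyp_K_annulus:
  assumes A: "hyp_A DIM('a) A a0 ainf" and K: "hyp_K DIM('a) a0 ainf K" and a: "0 < a"
  shows "integrable lebesgue (\<lambda>x::'a::euclidean_space. indicator {x. a \<le> norm x \<and> norm x \<le> b} x * K (norm x))"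
proof -
  let ?N = "real DIM('a)"
  obtain s where s: "2 * ?N / (?N - a0 + 2) < s" "Lp_loc s {0<..} K"
    using K by (auto simp: hyp_K_def)
  have s1: "1 < s"
  proof -
    \<comment> \<open>The condition \<open>a0 > 2 - N\<close> says that
      \<open>N - a0 + 2 < 2 * N\<close>, so the exponent \<open>s\<close> exceeds 1.\<close>
    have "0 < ?N - a0 + 2" "?N - a0 + 2 < 2 * ?N" using A by (auto simp: hyp_A_def)
    then have "1 < 2 * ?N / (?N - a0 + 2)" by (simp add: less_divide_eq)
    then show ?thesis using s(1) by linarith
  qed
  have Km: "K \<in> borel_measurable (lebesgue_on {0<..})" using s(2) by (simp add: Lp_loc_def)
  obtain g where g: "g \<in> borel_measurable borel" "AE t in lborel. 0 < t \<longrightarrow> K t = g t"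
    "AE x in lborel. K (norm (x::'a)) = g (norm x)"
    by (rule borel_modification_norm[OF Km, where 'a = 'a])
  \<comment> \<open>A bound for the area of spheres with radius in \<open>{a..b}\<close>;
    \<open>max b 0\<close> keeps it nonnegative when that interval is empty.\<close>
  define W where "W = ?N * unit_ball_vol ?N * (max b 0) ^ (DIM('a) - 1)"
  have W: "0 \<le> W" by (simp add: W_def)
  let ?H = "\<lambda>t. indicat_real {a..b} t * \<bar>g t\<bar>"
  let ?B = "\<lambda>t. W * (indicat_real {a..b} t + indicat_real {a..b} t * norm (K t) powr s)"
  have Hm: "?H \<in> borel_measurable borel" using g(1) by measurable
  have "set_integrable lebesgue {a..b} (\<lambda>t. norm (K t) powr s)"
  proof -
    have "{a..b} \<subseteq> {0<..}" using a by auto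
    then show ?thesis using s(2) compact_Icc[of a b] unfolding Lp_loc_def by blast
  qed
  moreover have "integrable lebesgue (indicat_real {a..b})"
    using emeasure_compact_finite[OF compact_Icc[of a b]] by (intro integrable_real_indicator) simp_all
  ultimately have Bi: "integrable lebesgue ?B"
    unfolding set_integrable_def by (intro integrable_mult_right Bochner_Integration.integrable_add) simp_all
  have "(\<integral>\<^sup>+ x. ennreal (?H (norm (x::'a))) \<partial>lborel) = (\<integral>\<^sup>+ t. ennreal (sphere_weight DIM('a) t) * ennreal (?H t) \<partial>lborel)"
    by (rule nn_integral_norm[OF measurable_compose[OF Hm measurable_ennreal]])
  also have "\<dots> \<le> (\<integral>\<^sup>+ t. ennreal (?B t) \<partial>lborel)"
  proof (rule nn_integral_mono_AE)
    show "AE t in lborel. ennreal (sphere_weight DIM('a) t) * ennreal (?H t) \<le> ennreal (?B t)"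
      using g(2)
    proof eventually_elim
      case (elim t)
      show ?case
      proof (cases "t \<in> {a..b}")
        case True
        then have t: "0 < t" using a by auto
        have "sphere_weight DIM('a) t \<le> W"
          using t True by (auto simp: sphere_weight_def W_def intro!: mult_left_mono power_mono)
        moreover have "\<bar>K t\<bar> \<le> 1 + norm (K t) powr s"
        proof (cases "\<bar>K t\<bar> \<le> 1")
          case False
          then have "\<bar>K t\<bar> powr 1 \<le> \<bar>K t\<bar> powr s" using s1 by (intro powr_mono) auto
          then show ?thesis using False by simp
        next
          case True
          then show ?thesis by (intro order_trans[OF True]) simp
        qed
        ultimately have "sphere_weight DIM('a) t * \<bar>g t\<bar> \<le> W * (1 + norm (K t) powr s)"
          using elim t sphere_weight_nonneg W by (intro mult_mono) auto
        then show ?thesis using True sphere_weight_nonneg[of "DIM('a)" t]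
          by (simp add: ennreal_mult'[symmetric] ennreal_leI)
      qed simp
    qed
  qed
  also have "\<dots> = (\<integral>\<^sup>+ t. ennreal (?B t) \<partial>lebesgue)" by (rule nn_integral_completion[symmetric])
  also have "\<dots> = ennreal (integral\<^sup>L lebesgue ?B)"
    using Bi W by (intro nn_integral_eq_integral) auto
  finally have fin: "(\<integral>\<^sup>+ x. ennreal (?H (norm (x::'a))) \<partial>lborel) < \<infinity>"
    by (rule le_less_trans) simp
  have Hnm: "(\<lambda>x::'a. ?H (norm x)) \<in> borel_measurable lborel"
    using measurable_compose[OF _ Hm, of norm lborel] by simp
  have "integrable lborel (\<lambda>x::'a. ?H (norm x))"
    using fin by (intro integrableI_nonneg Hnm) simp_all
  then have Hi: "integrable lebesgue (\<lambda>x::'a. ?H (norm x))" using Hnm by (simp only: integrable_completion)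
  show ?thesis
  proof (rule Bochner_Integration.integrable_bound[OF Hi])
    show "(\<lambda>x::'a. indicator {x. a \<le> norm x \<and> norm x \<le> b} x * K (norm x)) \<in> borel_measurable lebesgue"
      by (intro borel_measurable_times borel_measurable_indicator annulus_sets hyp_K_measurable[OF K])
    show "AE x in lebesgue. norm (indicator {x. a \<le> norm x \<and> norm x \<le> b} x * K (norm (x::'a))) \<le> norm (?H (norm x))"
      using AE_completion[OF g(3)] by eventually_elim (simp add: indicator_def)
  qed
qed

section \<open>Uniformly small integrals near the origin and near infinity\<close>

text \<open>A uniform integrability condition. \<open>T\<close> contains the end of \<open>S\<close>
  at the origin or at infinity and does not depend on \<open>v\<close>; what remains of
  \<open>S\<close> lies in an annulus bounded away from the origin.\<close>

definition small_tails ::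
  "(real \<Rightarrow> real) \<Rightarrow> (real \<Rightarrow> real) \<Rightarrow> (real \<Rightarrow> real) \<Rightarrow> real \<Rightarrow> 'a::euclidean_space set \<Rightarrow> bool" where
  "small_tails A V K q S \<longleftrightarrow> (\<forall>\<epsilon>>0. \<exists>T a b. T \<in> sets lebesgue \<and> 0 < a \<and>
     (\<forall>x\<in>S - T. a \<le> norm x \<and> norm x \<le> b) \<and>
     (\<forall>v::'a \<Rightarrow> real. admissible A V v \<longrightarrow>
        integrable lebesgue (K_power K q T v) \<and>
        (LINT x|lebesgue. K_power K q T v x) \<le> \<epsilon>))"

text \<open>On the annulus \<open>U\<close> the functions have a common bound \<open>C\<close>, so
  \<open>C powr q\<close> times \<open>K\<close> is an integrable majorant \<open>B\<close>. This
  serves both as a bound and for dominated convergence.\<close>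

lemma small_tails_split:
  fixes S :: "'a::euclidean_space set"
  assumes A: "hyp_A DIM('a) A a0 ainf" and K: "hyp_K DIM('a) a0 ainf K" and q: "0 < q"
    and S: "S \<in> sets lebesgue" and tails: "small_tails A V K q S" and \<epsilon>: "0 < \<epsilon>"
  obtains T U B where "U \<in> sets lebesgue" "integrable lebesgue (B :: 'a \<Rightarrow> real)"
    "\<And>v. admissible A V v \<Longrightarrow> integrable lebesgue (K_power K q S v)"
    "\<And>v. admissible A V v \<Longrightarrow> AE x in lebesgue. \<bar>K_power K q U v x\<bar> \<le> B x"
    "\<And>v. admissible A V v \<Longrightarrow> (LINT x|lebesgue. K_power K q S v x)
      \<le> \<epsilon> + (LINT x|lebesgue. K_power K q U v x)"
proof -
  obtain T a b where T: "T \<in> sets lebesgue" and a: "0 < a"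
    and ab: "\<forall>x\<in>S - T. a \<le> norm x \<and> norm x \<le> b"
    and Tv: "\<forall>v::'a \<Rightarrow> real. admissible A V v \<longrightarrow>
        integrable lebesgue (K_power K q T v) \<and>
        (LINT x|lebesgue. K_power K q T v x) \<le> \<epsilon>"
    using tails[unfolded small_tails_def, rule_format, OF \<epsilon>] by (elim exE conjE)
  obtain C where C: "0 < C" "\<forall>v::'a \<Rightarrow> real. admissible A V v \<longrightarrow> (AE x in lebesgue. a \<le> norm x \<longrightarrow> \<bar>v x\<bar> \<le> C)"
    using admissible_bounded[OF A a, of V] by (elim exE conjE)
  define U where "U = {x::'a. a \<le> norm x \<and> norm x \<le> b}"
  define B where "B x = C powr q * (indicator U x * K (norm x))" for x :: 'a
  have U: "U \<in> sets lebesgue" unfolding U_def by (rule annulus_sets)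
  have Bi: "integrable lebesgue B"
    unfolding B_def[abs_def] U_def by (intro integrable_mult_right hyp_K_annulus[OF A K a])
  have K0: "0 \<le> K r" if "0 < r" for r using K that by (auto simp: hyp_K_def less_imp_le)
  have Fm: "(K_power K q Y v) \<in> borel_measurable lebesgue"
    if "admissible A V v" "Y \<in> sets lebesgue" for v :: "'a \<Rightarrow> real" and Y
  proof -
    have "v \<in> borel_measurable lebesgue" using that(1) by (simp add: admissible_def)
    then have "(\<lambda>x. \<bar>v x\<bar> powr q) \<in> borel_measurable lebesgue" by measurable
    then show ?thesis by (intro borel_measurable_times borel_measurable_indicator that(2) hyp_K_measurable[OF K])
  qed
  have dom: "AE x in lebesgue. \<bar>K_power K q U v x\<bar> \<le> B x" if v: "admissible A V v" for v
  proof -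
    have "AE x in lebesgue. a \<le> norm x \<longrightarrow> \<bar>v x\<bar> \<le> C" using C(2) v by simp
    then show ?thesis
      using AE_norm_pos
    proof eventually_elim
      case (elim x)
      show ?case
      proof (cases "x \<in> U")
        case True
        then have "\<bar>v x\<bar> powr q \<le> C powr q" using elim(1) q by (intro powr_mono2) (auto simp: U_def)
        then have "K (norm x) * \<bar>v x\<bar> powr q \<le> K (norm x) * C powr q"
          using K0[OF elim(2)] by (intro mult_left_mono) auto
        then show ?thesis using True K0[OF elim(2)] by (simp add: B_def mult.commute)
      qed (simp add: B_def)
    qed
  qed
  have Ui: "integrable lebesgue (K_power K q U v)" if v: "admissible A V v" for v
  proof (rule Bochner_Integration.integrable_bound[OF Bi Fm[OF v U]])
    show "AE x in lebesgue. norm (K_power K q U v x) \<le> norm (B x)"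
      unfolding real_norm_def using dom[OF v] by eventually_elim linarith
  qed
  have le: "AE x in lebesgue. \<bar>K_power K q S v x\<bar>
      \<le> K_power K q T v x + K_power K q U v x" for v :: "'a \<Rightarrow> real"
    using AE_norm_pos
  proof eventually_elim
    case (elim x)
    have "0 \<le> K (norm x) * \<bar>v x\<bar> powr q" using K0[OF elim] by simp
    then show ?case using ab by (auto simp: indicator_def U_def)
  qed
  have TU: "integrable lebesgue (\<lambda>x. K_power K q T v x + K_power K q U v x)"
    if v: "admissible A V v" for v
    using Tv v by (intro Bochner_Integration.integrable_add Ui) blast+
  have Si: "integrable lebesgue (K_power K q S v)" if v: "admissible A V v" for v
  proof (rule Bochner_Integration.integrable_bound[OF TU[OF v] Fm[OF v S]])
    show "AE x in lebesgue. norm (K_power K q S v x)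
      \<le> norm (K_power K q T v x + K_power K q U v x)"
      unfolding real_norm_def using le[of v] by eventually_elim linarith
  qed
  have "(LINT x|lebesgue. K_power K q S v x)
      \<le> \<epsilon> + (LINT x|lebesgue. K_power K q U v x)" if v: "admissible A V v" for v
  proof -
    have "AE x in lebesgue. K_power K q S v x
      \<le> K_power K q T v x + K_power K q U v x"
      using le[of v] by eventually_elim linarith
    from integral_mono_AE[OF Si[OF v] TU[OF v] this]
    have "(LINT x|lebesgue. K_power K q S v x)
      \<le> (LINT x|lebesgue. K_power K q T v x) + (LINT x|lebesgue. K_power K q U v x)"
      using Tv v Ui[OF v] by simp
    then show ?thesis using Tv v by fastforce
  qed
  from that[OF U Bi Si dom this] show ?thesis .
qed

lemma small_tails_bounded:
  fixes S :: "'a::euclidean_space set"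
  assumes A: "hyp_A DIM('a) A a0 ainf" and K: "hyp_K DIM('a) a0 ainf K" and q: "0 < q"
    and S: "S \<in> sets lebesgue" and tails: "small_tails A V K q S"
  shows "\<exists>B. \<forall>v. admissible A V v \<longrightarrow> integrable lebesgue (K_power K q S v) \<and>
    (LINT x|lebesgue. K_power K q S v x) \<le> B"
proof (rule small_tails_split[OF A K q S tails zero_less_one])
  fix U and B :: "'a \<Rightarrow> real"
  assume U: "U \<in> sets lebesgue" and B: "integrable lebesgue B"
    and i: "\<And>v. admissible A V v \<Longrightarrow> integrable lebesgue (K_power K q S v)"
    and dom: "\<And>v. admissible A V v \<Longrightarrow> AE x in lebesgue. \<bar>K_power K q U v x\<bar> \<le> B x"
    and le: "\<And>v. admissible A V v \<Longrightarrow> (LINT x|lebesgue. K_power K q S v x)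
      \<le> 1 + (LINT x|lebesgue. K_power K q U v x)"
  show ?thesis
  proof (rule exI[of _ "1 + \<bar>integral\<^sup>L lebesgue B\<bar>"], intro allI impI conjI)
    fix v :: "'a \<Rightarrow> real" assume v: "admissible A V v"
    show "integrable lebesgue (K_power K q S v)" by (rule i[OF v])
    have "(LINT x|lebesgue. K_power K q U v x) \<le> \<bar>integral\<^sup>L lebesgue B\<bar>"
    \<comment> \<open>If the integrand is not integrable, its integral is 0 by convention and the
      bound holds as well.\<close>
    proof (cases "integrable lebesgue (K_power K q U v)")
      case True
      have "(LINT x|lebesgue. K_power K q U v x) \<le> integral\<^sup>L lebesgue B"
        using dom[OF v] by (intro integral_mono_AE True B) (auto elim: eventually_mono)
      then show ?thesis by linarith
    qed (simp add: not_integrable_integral_eq)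
    then show "(LINT x|lebesgue. K_power K q S v x) \<le> 1 + \<bar>integral\<^sup>L lebesgue B\<bar>"
      using le[OF v] by linarith
  qed
qed

text \<open>Half of \<open>e\<close> covers the tail for all \<open>n\<close> at once; on the
  annulus dominated convergence applies.\<close>

lemma small_tails_tendsto:
  fixes S :: "'a::euclidean_space set" and z :: "nat \<Rightarrow> 'a \<Rightarrow> real"
  assumes A: "hyp_A DIM('a) A a0 ainf" and K: "hyp_K DIM('a) a0 ainf K" and q: "0 < q"
    and S: "S \<in> sets lebesgue" and tails: "small_tails A V K q S"
    and z: "\<And>n. admissible A V (z n)" "AE x in lebesgue. (\<lambda>n. z n x) \<longlonglongrightarrow> 0"
  shows "(\<lambda>n. LINT x|lebesgue. K_power K q S (z n) x) \<longlonglongrightarrow> 0"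
proof (rule LIMSEQ_I)
  fix e :: real assume e: "0 < e"
  have K0: "0 \<le> K r" if "0 < r" for r using K that by (auto simp: hyp_K_def less_imp_le)
  have nonneg: "0 \<le> (LINT x|lebesgue. K_power K q S (z n) x)" for n
  proof (rule integral_nonneg_AE)
    show "AE x in lebesgue. 0 \<le> K_power K q S (z n) x"
      using AE_norm_pos by eventually_elim (simp add: K0)
  qed
  show "\<exists>no. \<forall>n\<ge>no. norm ((LINT x|lebesgue. K_power K q S (z n) x) - 0) < e"
  proof (rule small_tails_split[OF A K q S tails half_gt_zero[OF e]])
    fix U and B :: "'a \<Rightarrow> real"
    assume U: "U \<in> sets lebesgue" and B: "integrable lebesgue B"
      and dom: "\<And>v. admissible A V v \<Longrightarrow> AE x in lebesgue. \<bar>K_power K q U v x\<bar> \<le> B x"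
      and le: "\<And>v. admissible A V v \<Longrightarrow> (LINT x|lebesgue. K_power K q S v x)
        \<le> e / 2 + (LINT x|lebesgue. K_power K q U v x)"
    have "(\<lambda>n. LINT x|lebesgue. K_power K q U (z n) x) \<longlonglongrightarrow> integral\<^sup>L (lebesgue :: 'a measure) (\<lambda>_. 0 :: real)"
    proof (rule integral_dominated_convergence[where f = "\<lambda>_. 0" and w = B])
      show "(K_power K q U (z n)) \<in> borel_measurable lebesgue" for n
      proof -
        have "z n \<in> borel_measurable lebesgue" using z(1)[of n] by (simp add: admissible_def)
        then have "(\<lambda>x. \<bar>z n x\<bar> powr q) \<in> borel_measurable lebesgue" by measurable
        then show ?thesis by (intro borel_measurable_times borel_measurable_indicator U hyp_K_measurable[OF K])
      qed
      show "AE x in lebesgue. (\<lambda>n. K_power K q U (z n) x) \<longlonglongrightarrow> 0"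
        using z(2)
      proof eventually_elim
        case (elim x)
        have "(\<lambda>n. \<bar>z n x\<bar> powr q) \<longlonglongrightarrow> 0 powr q"
          using q by (intro tendsto_powr' tendsto_rabs_zero elim tendsto_const) auto
        then have "(\<lambda>n. K_power K q U (z n) x) \<longlonglongrightarrow> indicator U x * (K (norm x) * 0)"
          using q by (intro tendsto_intros) simp
        then show ?case by simp
      qed
      show "AE x in lebesgue. norm (K_power K q U (z n) x) \<le> B x" for n
        using dom[OF z(1)[of n]] by simp
    qed (simp_all add: B)
    then have "(\<lambda>n. LINT x|lebesgue. K_power K q U (z n) x) \<longlonglongrightarrow> 0" by simp
    from order_tendstoD(2)[OF this half_gt_zero[OF e]]
    obtain M where M: "\<And>n. M \<le> n \<Longrightarrow> (LINT x|lebesgue. K_power K q U (z n) x) < e / 2"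
      unfolding eventually_sequentially by blast
    show ?thesis
    proof (intro exI[of _ M] allI impI)
      fix n assume "M \<le> n"
      then show "norm ((LINT x|lebesgue. K_power K q S (z n) x) - 0) < e"
        using le[OF z(1)[of n]] M[of n] nonneg[of n] by simp
    qed
  qed
qed

text \<open>A function is almost everywhere at most its essential supremum; since that is finite, it
  can be read as a real number and the quotient cleared.\<close>

lemma esssup_quotient_bound:
  fixes S :: "'a::euclidean_space set"
  assumes S: "S \<in> sets lebesgue" and K: "\<And>r. 0 < r \<Longrightarrow> 0 < K r"
    and sup: "esssup (lebesgue_on S) (\<lambda>x. quotient_KV K V \<alpha> \<beta> (norm x)) < \<infinity>"
  obtains M where "0 \<le> M" "AE x in lebesgue. x \<in> S \<longrightarrow>
      K (norm x) \<le> M * (norm x powr \<alpha> * (if \<beta> = 0 then 1 else V (norm x) powr \<beta>))"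
proof -
  let ?E = "esssup (lebesgue_on S) (\<lambda>x. quotient_KV K V \<alpha> \<beta> (norm x))"
  define M where "M = enn2real ?E"
  have M: "0 \<le> M" "?E = ennreal M" using sup by (simp_all add: M_def)
  have "AE x in lebesgue_on S. quotient_KV K V \<alpha> \<beta> (norm x) \<le> ennreal M"
    unfolding M(2)[symmetric] by (rule esssup_AE)
  then have "AE x in lebesgue. x \<in> S \<longrightarrow> quotient_KV K V \<alpha> \<beta> (norm x) \<le> ennreal M"
    using S by (simp add: AE_restrict_space_iff)
  then have "AE x in lebesgue. x \<in> S \<longrightarrow>
      K (norm x) \<le> M * (norm x powr \<alpha> * (if \<beta> = 0 then 1 else V (norm x) powr \<beta>))"
    using AE_norm_pos
  proof eventually_elim
    case (elim x)
    define b where "b = norm x powr \<alpha> * (if \<beta> = 0 then 1 else V (norm x) powr \<beta>)"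
    have b0: "0 \<le> b" by (simp add: b_def)
    have k: "0 < K (norm x)" using K elim(2) by simp
    show ?case
    proof
      assume "x \<in> S"
      then have le: "ennreal (K (norm x)) / ennreal b \<le> ennreal M"
        using elim(1) by (simp add: quotient_KV_def b_def)
      \<comment> \<open>A zero denominator would make the quotient infinite because \<open>K\<close>
        is positive, contradicting the finite bound.\<close>
      have "b \<noteq> 0"
      proof
        assume "b = 0"
        then have "ennreal (K (norm x)) / ennreal b = top"
          using k by (simp add: ennreal_divide_zero)
        then show False using le by (simp add: top_unique)
      qed
      then have "0 < b" using b0 by simp
      then have "K (norm x) / b \<le> M" using le k M(1) by (simp add: divide_ennreal)
      then show "K (norm x) \<le> M * (norm x powr \<alpha> * (if \<beta> = 0 then 1 else V (norm x) powr \<beta>))"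
        using \<open>0 < b\<close> unfolding b_def[symmetric] by (simp add: divide_le_eq)
    qed
  qed
  from that[OF M(1) this] show ?thesis .
qed

text \<open>With \<open>g\<close> half of \<open>N + a - 2\<close>, the number
  \<open>\<delta>\<close> equals \<open>g * (q_star N a \<alpha> \<beta> - q)\<close> divided by the
  positive number \<open>2 - \<beta>\<close>. The critical exponent is thus the value of
  \<open>q\<close> at which the leftover power disappears.\<close>

lemma q_star_sign:
  fixes a \<alpha> \<beta> q :: real
  assumes "0 < real N + a - 2" "\<beta> \<le> 1"
  defines "\<delta> \<equiv> (\<alpha> - (real N + a - 2) / 2 * (q - 2 * \<beta>) + real N * (1 - \<beta>)) / (2 - \<beta>)"
  shows "q < q_star N a \<alpha> \<beta> \<Longrightarrow> 0 < \<delta>" "q_star N a \<alpha> \<beta> < q \<Longrightarrow> \<delta> < 0"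
proof -
  define X where "X = \<alpha> - 2 * \<beta> + real N + a * \<beta>"
  define g where "g = (real N + a - 2) / 2"
  have g: "0 < g" using assms(1) by (simp add: g_def)
  have q: "q_star N a \<alpha> \<beta> = X / g" by (simp add: q_star_def X_def g_def)
  have d: "\<delta> = (X - g * q) / (2 - \<beta>)"
    unfolding \<delta>_def X_def g_def by (rule arg_cong[where f = "\<lambda>z. z / (2 - \<beta>)"]) (simp add: field_simps)
  show "q < q_star N a \<alpha> \<beta> \<Longrightarrow> 0 < \<delta>" "q_star N a \<alpha> \<beta> < q \<Longrightarrow> \<delta> < 0"
    using g assms(2) unfolding q d by (simp_all add: field_simps)
qed

text \<open>The hypothesis on \<open>K\<close> holds on \<open>S\<close>, the conclusion is about
  \<open>S'\<close>. The two differ in the exterior case, where the hypothesis starts at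
  \<open>R2\<close> and the cut is at \<open>R1\<close>. Smallness of the leftover power on
  \<open>T\<close> is all that has to be supplied.\<close>

lemma small_tails_if_power_weight_small:
  fixes S S' :: "'a::euclidean_space set"
  assumes V: "hyp_V V" and K: "hyp_K DIM('a) a0 ainf K"
    and \<beta>: "0 \<le> \<beta>" "\<beta> \<le> 1" and q: "2 * \<beta> < q" and M: "0 \<le> M"
    and KV: "AE x in lebesgue. x \<in> S \<longrightarrow>
      K (norm x) \<le> M * (norm x powr \<alpha> * (if \<beta> = 0 then 1 else V (norm x) powr \<beta>))"
    and decay: "\<exists>C>0. \<forall>v. admissible A V v \<longrightarrow> (AE x in lebesgue. x \<in> S \<longrightarrow> \<bar>v x\<bar> \<le> C * norm x powr - \<gamma>)"
    and \<delta>: "\<delta> = (\<alpha> - \<gamma> * (q - 2 * \<beta>) + real DIM('a) * (1 - \<beta>)) / (2 - \<beta>)"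
    and P: "integrable lebesgue (\<lambda>x. indicator S x * norm x powr (\<delta> - real DIM('a)))"
    and T: "\<And>\<eta>. 0 < \<eta> \<Longrightarrow> \<exists>T a b. T \<in> sets lebesgue \<and> T \<subseteq> S \<and> 0 < a \<and>
      (\<forall>x\<in>S' - T. a \<le> norm x \<and> norm x \<le> b) \<and> (\<forall>x\<in>T. x \<noteq> 0 \<longrightarrow> norm x powr \<delta> \<le> \<eta>)"
  shows "small_tails A V K q S'"
  unfolding small_tails_def
proof (intro allI impI)
  fix \<epsilon> :: real assume \<epsilon>: "0 < \<epsilon>"
  let ?N = "real DIM('a)"
  obtain C where C: "0 < C"
    "\<forall>v. admissible A V v \<longrightarrow> (AE x in lebesgue. x \<in> S \<longrightarrow> \<bar>v x\<bar> \<le> C * norm x powr - \<gamma>)"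
    using decay by (elim exE conjE)
  define P where "P = (LINT x|lebesgue. indicator S x * norm x powr (\<delta> - ?N))"
  have P0: "0 \<le> P" unfolding P_def by (intro Bochner_Integration.integral_nonneg) simp
  define c where "c = M * C powr (q - 2 * \<beta>) * (1 + P)"
  have c: "0 \<le> c" using M P0 by (simp add: c_def)
  \<comment> \<open>The integral will be at most \<open>c * D\<close>; adding 1 in the denominator
    allows \<open>c = 0\<close>.\<close>
  define D where "D = \<epsilon> / (c + 1)"
  have D: "0 < D" using \<epsilon> c by (simp add: D_def)
  have cD: "c * D \<le> \<epsilon>" using c \<epsilon> by (simp add: D_def field_simps)
  obtain T a b where T: "T \<in> sets lebesgue" "T \<subseteq> S" "0 < a" "\<forall>x\<in>S' - T. a \<le> norm x \<and> norm x \<le> b"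
    "\<forall>x\<in>T. x \<noteq> 0 \<longrightarrow> norm x powr \<delta> \<le> D"
    using T[OF D] by (elim exE conjE)
  have i: "integrable lebesgue (\<lambda>x. indicator T x * norm x powr (\<delta> - ?N))"
  proof -
    have "indicator T x *\<^sub>R (indicator S x * norm x powr (\<delta> - ?N)) = indicator T x * norm x powr (\<delta> - ?N)" for x
      using T(2) by (auto simp: indicator_def)
    with integrable_mult_indicator[OF T(1) P] show ?thesis by (simp only:)
  qed
  have iP: "(LINT x|lebesgue. indicator T x * norm x powr (\<delta> - ?N)) \<le> P"
    unfolding P_def using T(2) by (intro integral_mono i P) (auto simp: indicator_def)
  have "integrable lebesgue (K_power K q T v) \<and>
      (LINT x|lebesgue. K_power K q T v x) \<le> \<epsilon>"
    if v: "admissible A V v" for v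
  proof -
    have vm: "v \<in> borel_measurable lebesgue" and Vv: "integrable lebesgue (\<lambda>x. V (norm x) * (v x)\<^sup>2)"
      "(LINT x|lebesgue. V (norm x) * (v x)\<^sup>2) \<le> 1" using v by (auto simp: admissible_def)
    have KT: "AE x in lebesgue. x \<in> T \<longrightarrow>
      K (norm x) \<le> M * (norm x powr \<alpha> * (if \<beta> = 0 then 1 else V (norm x) powr \<beta>))"
      using KV by eventually_elim (use T(2) in auto)
    have "AE x in lebesgue. x \<in> S \<longrightarrow> \<bar>v x\<bar> \<le> C * norm x powr - \<gamma>" using C(2) v by simp
    then have dec: "AE x in lebesgue. x \<in> T \<longrightarrow> \<bar>v x\<bar> \<le> C * norm x powr - \<gamma>"
      by eventually_elim (use T(2) in auto)
    have D': "norm x powr \<delta> \<le> D" if "x \<in> T" "x \<noteq> 0" for x using T(5) that by simp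
    have Knn: "0 \<le> K t" and Vnn: "0 \<le> V t" if "0 < t" for t
      using that K V by (auto simp: hyp_K_def hyp_V_def less_imp_le)
    note main = weighted_power_integral[OF T(1) hyp_K_measurable[OF K] Knn Vnn \<beta> q M C(1) KT vm dec Vv
        \<delta> less_imp_le[OF D] D' i iP]
    have "(LINT x|lebesgue. K_power K q T v x) \<le> c * D"
      using main(2) by (simp add: c_def mult_ac)
    then show ?thesis using main(1) cD by auto
  qed
  then show "\<exists>T a b. T \<in> sets lebesgue \<and> 0 < a \<and>
     (\<forall>x\<in>S' - T. a \<le> norm x \<and> norm x \<le> b) \<and>
     (\<forall>v::'a \<Rightarrow> real. admissible A V v \<longrightarrow>
        integrable lebesgue (K_power K q T v) \<and>
        (LINT x|lebesgue. K_power K q T v x) \<le> \<epsilon>)"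
    using T(1,3,4) by (intro exI[of _ T] exI[of _ a] exI[of _ b]) simp
qed

lemma small_tails_ball:
  assumes A: "hyp_A DIM('a::euclidean_space) A a0 ainf" and V: "hyp_V V" and K: "hyp_K DIM('a) a0 ainf K"
    and R: "0 < R" and \<beta>: "0 \<le> \<beta>" "\<beta> \<le> 1" and q: "2 * \<beta> < q" "q < q_star DIM('a) a0 \<alpha> \<beta>"
    and M: "0 \<le> M" "AE x in lebesgue. x \<in> {x::'a. norm x < R} \<longrightarrow>
      K (norm x) \<le> M * (norm x powr \<alpha> * (if \<beta> = 0 then 1 else V (norm x) powr \<beta>))"
  shows "small_tails A V K q {x::'a. norm x < R}"
proof -
  let ?\<gamma> = "(real DIM('a) + a0 - 2) / 2"
  define \<delta> where "\<delta> = (\<alpha> - ?\<gamma> * (q - 2 * \<beta>) + real DIM('a) * (1 - \<beta>)) / (2 - \<beta>)"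
  have "0 < real DIM('a) + a0 - 2" using A by (simp add: hyp_A_def)
  then have \<delta>: "0 < \<delta>" unfolding \<delta>_def using \<beta>(2) q(2) by (intro q_star_sign(1)) auto
  show ?thesis
  proof (rule small_tails_if_power_weight_small[OF V K \<beta> q(1) M _ \<delta>_def integrable_norm_powr_ball[OF \<delta> R]])
    show "\<exists>C>0. \<forall>v::'a \<Rightarrow> real. admissible A V v \<longrightarrow>
        (AE x in lebesgue. x \<in> {x. norm x < R} \<longrightarrow> \<bar>v x\<bar> \<le> C * norm x powr - ?\<gamma>)"
      using admissible_decay(1)[OF A R, of V] by simp
    fix \<eta> :: real assume \<eta>: "0 < \<eta>"
    \<comment> \<open>Solves \<open>r powr \<delta> \<le> \<eta>\<close>; as \<open>\<delta>\<close>
      is positive, the power is small inside a small ball, and the part of the ball of radius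
      \<open>R\<close> outside it is an annulus.\<close>
    define r where "r = min R (\<eta> powr (1 / \<delta>))"
    have r: "0 < r" "r \<le> R" "r \<le> \<eta> powr (1 / \<delta>)" using R \<eta> by (auto simp: r_def)
    have "norm x powr \<delta> \<le> \<eta>" if "norm x < r" for x :: 'a
    proof -
      have "norm x powr \<delta> \<le> (\<eta> powr (1 / \<delta>)) powr \<delta>" using that \<delta> r by (intro powr_mono2) auto
      then show ?thesis using \<delta> \<eta> by (simp add: powr_powr)
    qed
    then show "\<exists>T a b. T \<in> sets lebesgue \<and> T \<subseteq> {x::'a. norm x < R} \<and> 0 < a \<and>
        (\<forall>x\<in>{x. norm x < R} - T. a \<le> norm x \<and> norm x \<le> b) \<and> (\<forall>x\<in>T. x \<noteq> 0 \<longrightarrow> norm x powr \<delta> \<le> \<eta>)"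
      using r by (intro exI[of _ "{x. norm x < r}"] exI[of _ r] exI[of _ R]) (auto simp: norm_less_eq_ball)
  qed
qed

lemma norm_ge_sets: "{x::'a::euclidean_space. r \<le> norm x} \<in> sets lebesgue"
proof -
  have "{x::'a. r \<le> norm x} = - ball 0 r" by auto
  then show ?thesis by simp
qed

text \<open>Here \<open>\<delta>\<close> is negative, so its power is small far out. The remaining
  region from \<open>R\<close> to the large radius is an annulus whatever the order of
  \<open>R\<close> and \<open>R'\<close>.\<close>

lemma small_tails_outside:
  assumes A: "hyp_A DIM('a::euclidean_space) A a0 ainf" and V: "hyp_V V" and K: "hyp_K DIM('a) a0 ainf K"
    and R: "0 < R" "0 < R'" and \<beta>: "0 \<le> \<beta>" "\<beta> \<le> 1" and q: "2 * \<beta> < q" "q_star DIM('a) ainf \<alpha> \<beta> < q"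
    and M: "0 \<le> M" "AE x in lebesgue. x \<in> {x::'a. R' \<le> norm x} \<longrightarrow>
      K (norm x) \<le> M * (norm x powr \<alpha> * (if \<beta> = 0 then 1 else V (norm x) powr \<beta>))"
  shows "small_tails A V K q {x::'a. R \<le> norm x}"
proof -
  let ?\<gamma> = "(real DIM('a) + ainf - 2) / 2"
  define \<delta> where "\<delta> = (\<alpha> - ?\<gamma> * (q - 2 * \<beta>) + real DIM('a) * (1 - \<beta>)) / (2 - \<beta>)"
  have "0 < real DIM('a) + ainf - 2" using A by (simp add: hyp_A_def)
  then have \<delta>: "\<delta> < 0" unfolding \<delta>_def using \<beta>(2) q(2) by (intro q_star_sign(2)) auto
  show ?thesis
  proof (rule small_tails_if_power_weight_small[OF V K \<beta> q(1) M _ \<delta>_def integrable_norm_powr_outside[OF \<delta> R(2)]])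
    show "\<exists>C>0. \<forall>v::'a \<Rightarrow> real. admissible A V v \<longrightarrow>
        (AE x in lebesgue. x \<in> {x. R' \<le> norm x} \<longrightarrow> \<bar>v x\<bar> \<le> C * norm x powr - ?\<gamma>)"
      using admissible_decay(2)[OF A R(2), of V] by simp
    fix \<eta> :: real assume \<eta>: "0 < \<eta>"
    define r where "r = max (max R R') (\<eta> powr (1 / \<delta>))"
    have r: "R \<le> r" "R' \<le> r" "\<eta> powr (1 / \<delta>) \<le> r" by (auto simp: r_def)
    have "norm x powr \<delta> \<le> \<eta>" if "r \<le> norm x" for x :: 'a
    proof -
      have "norm x powr \<delta> \<le> (\<eta> powr (1 / \<delta>)) powr \<delta>" using that \<delta> \<eta> r by (intro powr_mono2') auto
      then show ?thesis using \<delta> \<eta> by (simp add: powr_powr)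
    qed
    then show "\<exists>T a b. T \<in> sets lebesgue \<and> T \<subseteq> {x::'a. R' \<le> norm x} \<and> 0 < a \<and>
        (\<forall>x\<in>{x. R \<le> norm x} - T. a \<le> norm x \<and> norm x \<le> b) \<and> (\<forall>x\<in>T. x \<noteq> 0 \<longrightarrow> norm x powr \<delta> \<le> \<eta>)"
      using r R by (intro exI[of _ "{x. r \<le> norm x}"] exI[of _ R] exI[of _ r]) (auto simp: norm_ge_sets)
  qed
qed

section \<open>Selection of a pointwise convergent subsequence of profiles\<close>

text \<open>The Arzela-Ascoli argument on the half-line: a diagonal sequence converges at positive
  rationals, and the common Hoelder bound carries the Cauchy property to every positive
  radius.\<close>

lemma profile_bound_subsequence:
  assumes A: "hyp_A N A a0 ainf" and N: "1 \<le> N" and f: "\<And>n. profile_bound N A 1 (f n)"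
  shows "\<exists>r g. strict_mono (r :: nat \<Rightarrow> nat) \<and> (\<forall>t>0. (\<lambda>n. f (r n) t) \<longlonglongrightarrow> g t)"
proof -
  have cont: "continuous_on {0<..} A" and pos: "\<And>t. 0 < t \<Longrightarrow> 0 < A t"
    using A unfolding hyp_A_def by auto
  have "\<exists>J>0. \<forall>n. \<bar>f n t\<bar> \<le> sqrt J" if t: "0 < t" for t
  proof (rule radial_gap_bounds[OF A t N])
    fix C assume C: "0 < C"
      "\<And>r s. t \<le> r \<Longrightarrow> r \<le> s \<Longrightarrow> radial_gap N A r s \<le> C * r powr - (real N + ainf - 2)"
    have J: "0 < C * t powr - (real N + ainf - 2)" using C(1) t by simp
    have "\<bar>f n t\<bar> \<le> 1 * sqrt (C * t powr - (real N + ainf - 2))" for n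
      by (intro profile_boundD2[OF f t J] C(2)) simp_all
    then show ?thesis using J by (intro exI[of _ "C * t powr - (real N + ainf - 2)"]) simp
  qed
  then have "\<forall>t. \<exists>J. 0 < t \<longrightarrow> 0 < J \<and> (\<forall>n. \<bar>f n t\<bar> \<le> sqrt J)" by blast
  from choice[OF this] obtain J where J: "\<And>t. 0 < t \<Longrightarrow> 0 < J t" "\<And>t n. 0 < t \<Longrightarrow> \<bar>f n t\<bar> \<le> sqrt (J t)"
    by blast
  have S: "countable {t \<in> \<rat>. 0 < (t::real)}"
    by (rule countable_subset[OF _ countable_rat]) auto
  \<comment> \<open>The bound on the profiles varies with the radius, while the selection principle
    asks for one bound at all points; hence the division by \<open>sqrt (J t)\<close>.\<close>
  have "\<exists>r. strict_mono (r :: nat \<Rightarrow> nat) \<and> (\<forall>t\<in>{t \<in> \<rat>. 0 < t}. \<exists>l. (\<lambda>n. f (r n) t / sqrt (J t)) \<longlonglongrightarrow> l)"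
  proof (rule function_convergent_subsequence[where f = "\<lambda>n t. f n t / sqrt (J t)" and M = 1, OF S])
    show "norm (f n t / sqrt (J t)) \<le> 1" if "t \<in> {t \<in> \<rat>. 0 < t}" for n t
      using J(1)[of t] J(2)[of t n] that by simp
    fix k :: "nat \<Rightarrow> nat"
    assume "strict_mono k" "\<And>t. t \<in> {t \<in> \<rat>. 0 < t} \<Longrightarrow> \<exists>l. (\<lambda>n. f (k n) t / sqrt (J t)) \<longlonglongrightarrow> l"
    then show ?thesis by (intro exI[of _ k] conjI ballI)
  qed
  then obtain r :: "nat \<Rightarrow> nat" where r: "strict_mono r"
    "\<forall>t\<in>{t \<in> \<rat>. 0 < t}. \<exists>l. (\<lambda>n. f (r n) t / sqrt (J t)) \<longlonglongrightarrow> l"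
    by (elim exE conjE)
  have rat: "Cauchy (\<lambda>n. f (r n) t)" if t: "t \<in> \<rat>" "0 < t" for t
  proof -
    obtain l where l: "(\<lambda>n. f (r n) t / sqrt (J t)) \<longlonglongrightarrow> l" using r(2) t by blast
    have "(\<lambda>n. f (r n) t / sqrt (J t) * sqrt (J t)) \<longlonglongrightarrow> l * sqrt (J t)"
      by (intro tendsto_mult l tendsto_const)
    then have "(\<lambda>n. f (r n) t) \<longlonglongrightarrow> l * sqrt (J t)" using J(1)[OF t(2)] by simp
    then show ?thesis by (rule LIMSEQ_imp_Cauchy)
  qed
  have "convergent (\<lambda>n. f (r n) t)" if t: "0 < t" for t
  proof (rule radial_gap_le_linear[OF cont pos t, of "t + 1" N])
    fix M assume M: "0 < M" "\<And>a b. t \<le> a \<Longrightarrow> a \<le> b \<Longrightarrow> b \<le> t + 1 \<Longrightarrow> radial_gap N A a b \<le> M * (b - a)"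
    have "Cauchy (\<lambda>n. f (r n) t)"
    proof (rule metric_CauchyI)
      fix e :: real assume e: "0 < e"
      \<comment> \<open>Within distance \<open>d\<close> the profiles oscillate by at most
        \<open>e / 3\<close>; the minimum with 1 keeps \<open>s\<close> in the interval where the
        linear gap bound holds.\<close>
      define d where "d = min 1 ((e / 3)\<^sup>2 / M)"
      have d: "0 < d" using e M(1) by (simp add: d_def)
      obtain s where s: "s \<in> \<rat>" "t < s" "s < t + d" using Rats_dense_in_real[of t "t + d"] d by auto
      have Ms: "0 < M * (s - t)" using M(1) s(2) by simp
      have "M * (s - t) \<le> (e / 3)\<^sup>2"
      proof -
        have "s - t \<le> (e / 3)\<^sup>2 / M" using s(3) by (simp add: d_def)
        then show ?thesis using M(1) by (simp add: le_divide_eq mult.commute)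
      qed
      then have sq: "sqrt (M * (s - t)) \<le> e / 3" using e by (intro real_le_lsqrt) auto
      have near: "\<bar>f n t - f n s\<bar> \<le> e / 3" for n
      proof -
        have "radial_gap N A t s \<le> M * (s - t)" using s by (intro M(2)) (auto simp: d_def)
        from profile_boundD1[OF f t less_imp_le[OF s(2)] Ms this, of n] show ?thesis using sq by simp
      qed
      have "0 < s" using t s(2) by simp
      from metric_CauchyD[OF rat[OF s(1) this], of "e / 3"] e
      obtain m where m: "\<And>i j. m \<le> i \<Longrightarrow> m \<le> j \<Longrightarrow> dist (f (r i) s) (f (r j) s) < e / 3" by auto
      have "dist (f (r i) t) (f (r j) t) < e" if "m \<le> i" "m \<le> j" for i j
        using m[OF that] near[of "r i"] near[of "r j"] unfolding dist_real_def by linarith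
      then show "\<exists>M. \<forall>m\<ge>M. \<forall>n\<ge>M. dist (f (r m) t) (f (r n) t) < e" by blast
    qed
    then show ?thesis by (simp add: Cauchy_convergent_iff)
  qed auto
  then show ?thesis
    using r(1) by (intro exI[of _ r] exI[of _ "\<lambda>t. lim (\<lambda>n. f (r n) t)"]) (simp add: convergent_LIMSEQ_iff)
qed

subsection \<open>Compactness\<close>

lemma admissibleI:
  fixes v :: "'a::euclidean_space \<Rightarrow> real"
  assumes "v \<in> borel_measurable lebesgue" "AE x in lebesgue. v x = f (norm x)" "profile_bound DIM('a) A 1 f"
    "integrable lebesgue (\<lambda>x. V (norm x) * (v x)\<^sup>2)" "(LINT x|lebesgue. V (norm x) * (v x)\<^sup>2) \<le> 1"
  shows "admissible A V v"
  unfolding admissible_def using assms by (intro conjI exI[of _ f])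

lemma hyp_V_measurable:
  assumes "hyp_V V"
  shows "(\<lambda>x::'a::euclidean_space. V (norm x)) \<in> borel_measurable lebesgue"
  using assms by (intro measurable_norm_comp) (auto simp: hyp_V_def Lp_loc_def)

lemma profile_bound_scale:
  assumes "profile_bound N A L f" "0 \<le> s"
  shows "profile_bound N A (s * L) (\<lambda>r. s * f r)"
proof (rule profile_boundI)
  fix r t J :: real assume *: "0 < r" "r \<le> t" "0 < J" "radial_gap N A r t \<le> J"
  have "\<bar>s * f r - s * f t\<bar> = s * \<bar>f r - f t\<bar>"
    using assms(2) by (simp add: abs_mult right_diff_distrib[symmetric])
  also have "\<dots> \<le> s * (L * sqrt J)" by (intro mult_left_mono profile_boundD1[OF assms(1) *] assms(2))
  finally show "\<bar>s * f r - s * f t\<bar> \<le> s * L * sqrt J" by (simp add: mult.assoc)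
next
  fix r J :: real assume *: "0 < r" "0 < J" "\<And>t. r \<le> t \<Longrightarrow> radial_gap N A r t \<le> J"
  have "\<bar>s * f r\<bar> = s * \<bar>f r\<bar>" using assms(2) by (simp add: abs_mult)
  also have "\<dots> \<le> s * (L * sqrt J)" by (intro mult_left_mono profile_boundD2[OF assms(1) *] assms(2))
  finally show "\<bar>s * f r\<bar> \<le> s * L * sqrt J" by (simp add: mult.assoc)
qed

lemma D_space_measurable: "u \<in> D_space A a0 ainf \<Longrightarrow> u \<in> borel_measurable lebesgue"
  by (auto simp: D_space_def Let_def intro: Lsum_one_measurable)

text \<open>Normalisation by any \<open>t\<close> strictly above the norm; the strictness allows
  functions of norm 0, for which \<open>t\<close> must still be positive.\<close>

lemma X_space_admissible:
  assumes A: "hyp_A DIM('a::euclidean_space) A a0 ainf" and V: "hyp_V V"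
  shows "\<exists>c>0. \<forall>u\<in>X_space A V a0 ainf. \<forall>t>X_norm A V (u :: 'a \<Rightarrow> real). admissible A V (\<lambda>x. u x / (c * t))"
proof -
  have pos: "\<And>t. 0 < t \<Longrightarrow> 0 < A t" using A by (auto simp: hyp_A_def)
  define \<kappa> where "\<kappa> = sqrt (sphere_area DIM('a))"
  have \<kappa>: "0 < \<kappa>" by (simp add: \<kappa>_def)
  \<comment> \<open>The second entry normalises the profile constant
    \<open>2 * t / \<kappa>\<close>, the first keeps the integral of \<open>V\<close> times the
    square below 1.\<close>
  define c where "c = max 1 (2 / \<kappa>)"
  have c: "1 \<le> c" "2 / \<kappa> \<le> c" by (simp_all add: c_def)
  have "admissible A V (\<lambda>x. u x / (c * t))" if u: "u \<in> X_space A V a0 ainf" and t: "X_norm A V u < t" for u :: "'a \<Rightarrow> real" and t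
  proof -
    define E where "E = A_energy A (wgrad u)"
    define F where "F = (LINT x|lebesgue. V (norm x) * (u x)\<^sup>2)"
    have Vi: "integrable lebesgue (\<lambda>x. V (norm x) * (u x)\<^sup>2)" and uD: "u \<in> D_space A a0 ainf"
      using u by (auto simp: X_space_def)
    have E0: "0 \<le> E" unfolding E_def by (rule A_energy_nonneg[of A, OF pos])
    have F0: "0 \<le> F" unfolding F_def
    proof (rule integral_nonneg_AE)
      show "AE x in lebesgue. 0 \<le> V (norm x) * (u x)\<^sup>2"
        using AE_norm_pos by eventually_elim (use V in \<open>simp add: hyp_V_def\<close>)
    qed
    have Xn: "sqrt (E + F) < t" using t by (simp add: X_norm_def E_def F_def)
    have t0: "0 < t" using le_less_trans[OF real_sqrt_ge_zero Xn] E0 F0 by simp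
    have EF: "E + F < t\<^sup>2"
      using Xn t0 real_sqrt_less_iff[of "E + F" "t\<^sup>2"] by simp
    have ct: "0 < c * t" using c(1) t0 by simp
    have "sqrt (A_energy A (wgrad u)) < t"
      unfolding E_def[symmetric] by (rule le_less_trans[OF real_sqrt_le_mono Xn]) (use F0 in simp)
    then obtain f where f: "AE x in lebesgue. u x = f (norm x)" "profile_bound DIM('a) A (2 * t / \<kappa>) f"
      using D_space_profile[OF A uD] unfolding \<kappa>_def by blast
    have le: "2 * t / \<kappa> \<le> c * t" using mult_right_mono[OF c(2) less_imp_le[OF t0]] by simp
    have one: "1 / (c * t) * (c * t) = 1" using c(1) t0 by simp
    from profile_bound_scale[OF profile_bound_mono[OF f(2) le], of "1 / (c * t)", unfolded one]
    have pf: "profile_bound DIM('a) A 1 (\<lambda>r. f r / (c * t))" using ct by simp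
    have "(LINT x|lebesgue. V (norm x) * (u x / (c * t))\<^sup>2) = F / (c * t)\<^sup>2"
      by (simp add: F_def power_divide)
    also have "\<dots> \<le> 1"
    proof -
      have "F \<le> 1\<^sup>2 * t\<^sup>2" using EF E0 by simp
      also have "\<dots> \<le> c\<^sup>2 * t\<^sup>2" using c(1) by (intro mult_right_mono power_mono) auto
      finally have "F \<le> (c * t)\<^sup>2" unfolding power_mult_distrib .
      then show ?thesis using zero_less_power[OF ct, of 2] by (simp only: divide_le_eq_1_pos)
    qed
    finally have le1: "(LINT x|lebesgue. V (norm x) * (u x / (c * t))\<^sup>2) \<le> 1" .
    have i: "integrable lebesgue (\<lambda>x. V (norm x) * (u x / (c * t))\<^sup>2)"
      using integrable_divide[OF Vi, of "(c * t)\<^sup>2"] by (simp add: power_divide)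
    have "(\<lambda>x. u x / (c * t)) \<in> borel_measurable lebesgue"
      using D_space_measurable[OF uD] by measurable
    moreover have "AE x in lebesgue. u x / (c * t) = f (norm x) / (c * t)"
      using f(1) by eventually_elim simp
    ultimately show ?thesis using pf i le1 by (rule admissibleI)
  qed
  then show ?thesis using c(1) by (intro exI[of _ c]) auto
qed

text \<open>The factor 1/2 compensates both the addition of the two profile constants and the factor
  2 in the square of a difference, so that differences stay in the normalised class.\<close>

lemma admissible_half_diff:
  assumes V: "hyp_V V" and v: "admissible A V v" and w: "admissible A V w"
  shows "admissible A V (\<lambda>x::'a::euclidean_space. (v x - w x) / 2)"
proof -
  obtain f g where f: "AE x in lebesgue. v x = f (norm x)" "profile_bound DIM('a) A 1 f"
    and g: "AE x in lebesgue. w x = g (norm x)" "profile_bound DIM('a) A 1 g"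
    using v w unfolding admissible_def by blast
  have vm: "v \<in> borel_measurable lebesgue" and wm: "w \<in> borel_measurable lebesgue"
    using v w by (simp_all add: admissible_def)
  have Vv: "integrable lebesgue (\<lambda>x. V (norm x) * (v x)\<^sup>2)" "(LINT x|lebesgue. V (norm x) * (v x)\<^sup>2) \<le> 1"
    and Vw: "integrable lebesgue (\<lambda>x. V (norm x) * (w x)\<^sup>2)" "(LINT x|lebesgue. V (norm x) * (w x)\<^sup>2) \<le> 1"
    using v w by (simp_all add: admissible_def)
  let ?B = "\<lambda>x. (V (norm x) * (v x)\<^sup>2 + V (norm x) * (w x)\<^sup>2) / 2"
  have Bi: "integrable lebesgue ?B" using Vv(1) Vw(1) by simp
  have le: "AE x in lebesgue. 0 \<le> V (norm x) * ((v x - w x) / 2)\<^sup>2 \<and> V (norm x) * ((v x - w x) / 2)\<^sup>2 \<le> ?B x"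
    using AE_norm_pos
  proof eventually_elim
    case (elim x)
    have V0: "0 \<le> V (norm x)" using V elim by (simp add: hyp_V_def)
    have "((v x - w x) / 2)\<^sup>2 \<le> ((v x)\<^sup>2 + (w x)\<^sup>2) / 2"
      using norm_diff_squared_le[of "v x" "w x"] by (simp add: power_divide)
    from mult_left_mono[OF this V0] show ?case using V0 by (simp add: algebra_simps)
  qed
  have i: "integrable lebesgue (\<lambda>x. V (norm x) * ((v x - w x) / 2)\<^sup>2)"
  proof (rule Bochner_Integration.integrable_bound[OF Bi])
    have "(\<lambda>x. ((v x - w x) / 2)\<^sup>2) \<in> borel_measurable lebesgue" using vm wm by measurable
    then show "(\<lambda>x. V (norm x) * ((v x - w x) / 2)\<^sup>2) \<in> borel_measurable lebesgue"
      by (intro borel_measurable_times hyp_V_measurable[OF V])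
    show "AE x in lebesgue. norm (V (norm x) * ((v x - w x) / 2)\<^sup>2) \<le> norm (?B x)"
      unfolding real_norm_def using le by eventually_elim linarith
  qed
  have "(LINT x|lebesgue. V (norm x) * ((v x - w x) / 2)\<^sup>2) \<le> integral\<^sup>L lebesgue ?B"
    using le by (intro integral_mono_AE i Bi) (auto elim: eventually_mono)
  also have "\<dots> \<le> 1" using Vv Vw by simp
  finally have le1: "(LINT x|lebesgue. V (norm x) * ((v x - w x) / 2)\<^sup>2) \<le> 1" .
  have "(\<lambda>x. (v x - w x) / 2) \<in> borel_measurable lebesgue" using vm wm by measurable
  moreover have "AE x in lebesgue. (v x - w x) / 2 = (f (norm x) - g (norm x)) / 2"
    using f(1) g(1) by eventually_elim simp
  moreover have "profile_bound DIM('a) A 1 (\<lambda>r. (f r - g r) / 2)"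
    using profile_bound_scale[OF profile_bound_diff[OF f(2) g(2)], of "1 / 2"] by simp
  ultimately show ?thesis using i le1 by (rule admissibleI)
qed

text \<open>The profile bound passes to the limit pointwise, the integral of \<open>V\<close> times
  the square by Fatou's lemma.\<close>

lemma admissible_limit:
  fixes v :: "nat \<Rightarrow> 'a::euclidean_space \<Rightarrow> real"
  assumes V: "hyp_V V" and v: "\<And>n. admissible A V (v n)"
    and f: "\<And>n. AE x in lebesgue. v n x = f n (norm x)" "\<And>n. profile_bound DIM('a) A 1 (f n)"
    and g: "\<And>t. 0 < t \<Longrightarrow> (\<lambda>n. f n t) \<longlonglongrightarrow> g t"
  shows "admissible A V (\<lambda>x::'a. g (norm x))" "AE x in lebesgue. (\<lambda>n. v n x) \<longlonglongrightarrow> g (norm x)"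
proof -
  have "AE x in lebesgue. \<forall>n. v n x = f n (norm x)" using f(1) by (simp add: AE_all_countable)
  then show lim: "AE x in lebesgue. (\<lambda>n. v n x) \<longlonglongrightarrow> g (norm x)"
    using AE_norm_pos by eventually_elim (simp add: g)
  have vm: "v n \<in> borel_measurable lebesgue" for n using v by (simp add: admissible_def)
  \<comment> \<open>\<open>g\<close> is known only as a pointwise limit at positive radii, so its
    measurability along the norm comes from the functions \<open>v n\<close>.\<close>
  have "(\<lambda>x. lim (\<lambda>n. v n x)) \<in> borel_measurable lebesgue" by (rule borel_measurable_lim_metric[OF vm])
  moreover have "AE x in lebesgue. lim (\<lambda>n. v n x) = g (norm x)"
    using lim by eventually_elim (rule limI)
  ultimately have gm: "(\<lambda>x::'a. g (norm x)) \<in> borel_measurable lebesgue" by (rule borel_measurable_AE)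
  let ?F = "\<lambda>w x::'a. V (norm x) * (w x)\<^sup>2"
  have Fm: "?F w \<in> borel_measurable lebesgue" if "w \<in> borel_measurable lebesgue" for w
  proof -
    have "(\<lambda>x. (w x)\<^sup>2) \<in> borel_measurable lebesgue" using that by measurable
    then show ?thesis by (intro borel_measurable_times hyp_V_measurable[OF V])
  qed
  have nn: "AE x in lebesgue. 0 \<le> ?F w x" for w :: "'a \<Rightarrow> real"
    using AE_norm_pos by eventually_elim (use V in \<open>simp add: hyp_V_def\<close>)
  have "(\<integral>\<^sup>+ x. ennreal (?F (\<lambda>x. g (norm x)) x) \<partial>lebesgue) = (\<integral>\<^sup>+ x. liminf (\<lambda>n. ennreal (?F (v n) x)) \<partial>lebesgue)"
  proof (rule nn_integral_cong_AE)
    show "AE x in lebesgue. ennreal (?F (\<lambda>x. g (norm x)) x) = liminf (\<lambda>n. ennreal (?F (v n) x))"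
      using lim
    proof eventually_elim
      case (elim x)
      then have "(\<lambda>n. ennreal (?F (v n) x)) \<longlonglongrightarrow> ennreal (?F (\<lambda>x. g (norm x)) x)"
        by (intro tendsto_ennrealI tendsto_intros)
      then show ?case by (intro lim_imp_Liminf[symmetric]) auto
    qed
  qed
  also have "\<dots> \<le> liminf (\<lambda>n. \<integral>\<^sup>+ x. ennreal (?F (v n) x) \<partial>lebesgue)"
    by (intro nn_integral_liminf measurable_compose[OF Fm measurable_ennreal] vm)
  also have "\<dots> \<le> limsup (\<lambda>n. \<integral>\<^sup>+ x. ennreal (?F (v n) x) \<partial>lebesgue)"
    by (intro Liminf_le_Limsup) simp
  also have "\<dots> \<le> ennreal 1"
  proof (intro Limsup_bounded always_eventually allI)
    fix n
    have "(\<integral>\<^sup>+ x. ennreal (?F (v n) x) \<partial>lebesgue) = ennreal (integral\<^sup>L lebesgue (?F (v n)))"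
      using v[of n] by (intro nn_integral_eq_integral nn) (simp add: admissible_def)
    also have "\<dots> \<le> ennreal 1" using v[of n] by (intro ennreal_leI) (simp add: admissible_def)
    finally show "(\<integral>\<^sup>+ x. ennreal (?F (v n) x) \<partial>lebesgue) \<le> ennreal 1" .
  qed
  finally have fin: "(\<integral>\<^sup>+ x. ennreal (?F (\<lambda>x. g (norm x)) x) \<partial>lebesgue) \<le> ennreal 1" .
  have i: "integrable lebesgue (?F (\<lambda>x. g (norm x)))"
    by (intro integrableI_nonneg Fm gm nn le_less_trans[OF fin]) simp
  have "ennreal (integral\<^sup>L lebesgue (?F (\<lambda>x. g (norm x)))) \<le> ennreal 1"
    using fin nn_integral_eq_integral[OF i nn] by simp
  then have le1: "integral\<^sup>L lebesgue (?F (\<lambda>x. g (norm x))) \<le> 1" by (subst (asm) ennreal_le_iff) simp_all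
  have "profile_bound DIM('a) A 1 g"
    by (rule profile_bound_limit[OF f(2) g tendsto_const])
  from admissibleI[where f = g, OF gm _ this i le1]
  show "admissible A V (\<lambda>x::'a. g (norm x))" by simp
qed

section \<open>Norm estimates in the sum space and the embeddings\<close>

lemma Lsum_norm_le:
  assumes "u1 \<in> Lq K q1" "u2 \<in> Lq K q2" "u = (\<lambda>x. u1 x + u2 x)"
  shows "Lsum_norm K q1 q2 u \<le> max (Lq_norm K q1 u1) (Lq_norm K q2 u2)"
  unfolding Lsum_norm_def
proof (rule cInf_lower)
  show "max (Lq_norm K q1 u1) (Lq_norm K q2 u2) \<in> {max (Lq_norm K q1 u1) (Lq_norm K q2 u2) | u1 u2.
     u1 \<in> Lq K q1 \<and> u2 \<in> Lq K q2 \<and> u = (\<lambda>x. u1 x + u2 x)}" using assms by blast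
  show "bdd_below {max (Lq_norm K q1 u1) (Lq_norm K q2 u2) | u1 u2.
     u1 \<in> Lq K q1 \<and> u2 \<in> Lq K q2 \<and> u = (\<lambda>x. u1 x + u2 x)}"
    by (rule bdd_belowI[of _ 0]) (auto simp: Lq_norm_def le_max_iff_disj)
qed

lemma Lsum_norm_nonneg:
  assumes "u \<in> Lsum K q1 q2"
  shows "0 \<le> Lsum_norm K q1 q2 u"
  unfolding Lsum_norm_def
proof (rule cInf_greatest)
  show "{max (Lq_norm K q1 u1) (Lq_norm K q2 u2) | u1 u2.
     u1 \<in> Lq K q1 \<and> u2 \<in> Lq K q2 \<and> u = (\<lambda>x. u1 x + u2 x)} \<noteq> {}"
    using assms by (auto simp: Lsum_def)
qed (auto simp: Lq_norm_def le_max_iff_disj)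

lemma scaled_restriction_Lq:
  fixes v :: "'a::euclidean_space \<Rightarrow> real"
  assumes K: "\<And>r. 0 < r \<Longrightarrow> 0 \<le> K r" and q: "0 < q" and s: "0 \<le> s"
    and S: "S \<in> sets lebesgue" and v: "v \<in> borel_measurable lebesgue"
    and i: "integrable lebesgue (K_power K q S v)"
  shows "(\<lambda>x. indicator S x * (s * v x)) \<in> Lq K q"
    and "Lq_norm K q (\<lambda>x. indicator S x * (s * v x))
      = s * (LINT x|lebesgue. K_power K q S v x) powr (1 / q)"
proof -
  let ?I = "LINT x|lebesgue. K_power K q S v x"
  have eq: "K (norm x) * \<bar>indicator S x * (s * v x)\<bar> powr q
      = s powr q * (K_power K q S v x)" for x
    using s q by (cases "x \<in> S") (simp_all add: abs_mult powr_mult)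
  have "(\<lambda>x. indicator S x * (s * v x)) \<in> borel_measurable lebesgue"
    by (intro borel_measurable_times borel_measurable_indicator borel_measurable_const S v)
  moreover have "integrable lebesgue (\<lambda>x. K (norm x) * \<bar>indicator S x * (s * v x)\<bar> powr q)"
    unfolding eq using i by simp
  ultimately show "(\<lambda>x. indicator S x * (s * v x)) \<in> Lq K q"
    by (simp only: Lq_def mem_Collect_eq)
  have I0: "0 \<le> ?I"
  proof (rule integral_nonneg_AE)
    show "AE x in lebesgue. 0 \<le> K_power K q S v x"
      using AE_norm_pos by eventually_elim (simp add: K)
  qed
  show "Lq_norm K q (\<lambda>x. indicator S x * (s * v x)) = s * ?I powr (1 / q)"
    unfolding Lq_norm_def eq using I0 s q by (simp add: powr_mult powr_powr)
qed

text \<open>The restrictions of a function to \<open>S\<close> and to its complement form one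
  decomposition, which bounds the infimum in the sum norm from above.\<close>

lemma scaled_Lsum:
  fixes v :: "'a::euclidean_space \<Rightarrow> real"
  assumes K: "\<And>r. 0 < r \<Longrightarrow> 0 \<le> K r" and q: "0 < q1" "0 < q2" and s: "0 \<le> s"
    and S: "S \<in> sets lebesgue" and v: "v \<in> borel_measurable lebesgue"
    and i: "integrable lebesgue (K_power K q1 S v)"
      "integrable lebesgue (K_power K q2 (- S) v)"
  shows "(\<lambda>x. s * v x) \<in> Lsum K q1 q2"
    and "Lsum_norm K q1 q2 (\<lambda>x. s * v x) \<le>
      s * max ((LINT x|lebesgue. K_power K q1 S v x) powr (1 / q1))
        ((LINT x|lebesgue. K_power K q2 (- S) v x) powr (1 / q2))"
proof -
  have S': "- S \<in> sets lebesgue" using sets.compl_sets[OF S] by (simp add: Compl_eq_Diff_UNIV)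
  have a: "(\<lambda>x. indicator S x * (s * v x)) \<in> Lq K q1"
    "Lq_norm K q1 (\<lambda>x. indicator S x * (s * v x))
      = s * (LINT x|lebesgue. K_power K q1 S v x) powr (1 / q1)"
    by (rule scaled_restriction_Lq[OF K q(1) s S v i(1)]; assumption)+
  have b: "(\<lambda>x. indicator (- S) x * (s * v x)) \<in> Lq K q2"
    "Lq_norm K q2 (\<lambda>x. indicator (- S) x * (s * v x))
      = s * (LINT x|lebesgue. K_power K q2 (- S) v x) powr (1 / q2)"
    by (rule scaled_restriction_Lq[OF K q(2) s S' v i(2)]; assumption)+
  have eq: "(\<lambda>x. s * v x) = (\<lambda>x. indicator S x * (s * v x) + indicator (- S) x * (s * v x))"
    by (auto simp: indicator_def fun_eq_iff)
  show "(\<lambda>x. s * v x) \<in> Lsum K q1 q2" by (rule LsumI[OF a(1) b(1) eq])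
  have "Lsum_norm K q1 q2 (\<lambda>x. s * v x) \<le> max (Lq_norm K q1 (\<lambda>x. indicator S x * (s * v x)))
      (Lq_norm K q2 (\<lambda>x. indicator (- S) x * (s * v x)))" by (rule Lsum_norm_le[OF a(1) b(1) eq])
  also have "\<dots> = s * max ((LINT x|lebesgue. K_power K q1 S v x) powr (1 / q1))
        ((LINT x|lebesgue. K_power K q2 (- S) v x) powr (1 / q2))"
    unfolding a(2) b(2) using s by (simp add: max_mult_distrib_left)
  finally show "Lsum_norm K q1 q2 (\<lambda>x. s * v x) \<le>
      s * max ((LINT x|lebesgue. K_power K q1 S v x) powr (1 / q1))
        ((LINT x|lebesgue. K_power K q2 (- S) v x) powr (1 / q2))" .
qed

text \<open>Boundedness of both integrals over the normalised class gives continuity. For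
  compactness, the normalised sequence has a subsequence with an admissible limit, and the half
  differences, being admissible and tending to 0, have integrals tending to 0 on both sides of the
  cut.\<close>

lemma admissible_embeddings:
  fixes S :: "'a::euclidean_space set"
  assumes A: "hyp_A DIM('a) A a0 ainf" and V: "hyp_V V" and K: "hyp_K DIM('a) a0 ainf K"
    and q: "0 < q1" "0 < q2" and S: "S \<in> sets lebesgue"
    and tails: "small_tails A V K q1 S" "small_tails A V K q2 (- S)"
  shows "continuous_embedding (X_space A V a0 ainf :: ('a \<Rightarrow> real) set) (X_norm A V) (Lsum K q1 q2) (Lsum_norm K q1 q2)"
    and "compact_embedding (X_space A V a0 ainf :: ('a \<Rightarrow> real) set) (X_norm A V) (Lsum K q1 q2) (Lsum_norm K q1 q2)"
proof -
  let ?I = "\<lambda>v::'a \<Rightarrow> real. (LINT x|lebesgue. K_power K q1 S v x)"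
  let ?J = "\<lambda>v::'a \<Rightarrow> real. (LINT x|lebesgue. K_power K q2 (- S) v x)"
  have K0: "0 \<le> K r" if "0 < r" for r using K that by (auto simp: hyp_K_def less_imp_le)
  have S': "- S \<in> sets lebesgue" using sets.compl_sets[OF S] by (simp add: Compl_eq_Diff_UNIV)
  obtain c where c: "0 < c" "\<forall>u\<in>X_space A V a0 ainf. \<forall>t>X_norm A V (u :: 'a \<Rightarrow> real). admissible A V (\<lambda>x. u x / (c * t))"
    using X_space_admissible[OF A V] by (elim exE conjE)
  obtain B1 where B1: "\<forall>v::'a \<Rightarrow> real. admissible A V v \<longrightarrow>
      integrable lebesgue (K_power K q1 S v) \<and> ?I v \<le> B1"
    using small_tails_bounded[OF A K q(1) S tails(1)] by (elim exE)
  obtain B2 where B2: "\<forall>v::'a \<Rightarrow> real. admissible A V v \<longrightarrow>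
      integrable lebesgue (K_power K q2 (- S) v) \<and> ?J v \<le> B2"
    using small_tails_bounded[OF A K q(2) S' tails(2)] by (elim exE)
  have sL: "(\<lambda>x. s * v x) \<in> Lsum K q1 q2"
    "Lsum_norm K q1 q2 (\<lambda>x. s * v x) \<le> s * max (?I v powr (1 / q1)) (?J v powr (1 / q2))"
    if "admissible A V v" "0 \<le> s" for v s
  proof -
    have "v \<in> borel_measurable lebesgue" using that(1) by (simp add: admissible_def)
    moreover have "integrable lebesgue (K_power K q1 S v)"
      "integrable lebesgue (K_power K q2 (- S) v)"
      using B1 B2 that(1) by blast+
    ultimately show "(\<lambda>x. s * v x) \<in> Lsum K q1 q2"
      "Lsum_norm K q1 q2 (\<lambda>x. s * v x) \<le> s * max (?I v powr (1 / q1)) (?J v powr (1 / q2))"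
      using scaled_Lsum[of K q1 q2 s S v] K0 q that(2) S by blast+
  qed
  have nonneg: "0 \<le> ?I v" "0 \<le> ?J v" for v
    by (rule integral_nonneg_AE, use AE_norm_pos in eventually_elim, simp add: K0)+
  have normX: "0 \<le> X_norm A V (u :: 'a \<Rightarrow> real)" for u
  proof -
    have "0 \<le> A_energy A (wgrad u)"
      by (rule A_energy_nonneg) (use A in \<open>simp add: hyp_A_def\<close>)
    moreover have "0 \<le> (LINT x|lebesgue. V (norm x) * \<bar>u x\<bar>\<^sup>2)"
      by (rule integral_nonneg_AE, use AE_norm_pos in eventually_elim) (use V in \<open>simp add: hyp_V_def\<close>)
    ultimately show ?thesis by (simp add: X_norm_def)
  qed
  define B where "B = c * max (B1 powr (1 / q1)) (B2 powr (1 / q2))"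
  have Xt: "u \<in> Lsum K q1 q2 \<and> Lsum_norm K q1 q2 u \<le> B * t"
    if u: "u \<in> X_space A V a0 ainf" and t: "X_norm A V u < t" for u :: "'a \<Rightarrow> real" and t
  proof -
    have t0: "0 < t" using normX[of u] t by linarith
    define v where "v x = u x / (c * t)" for x
    have v: "admissible A V v" unfolding v_def[abs_def] using c(2) u t by blast
    have uv: "u = (\<lambda>x. (c * t) * v x)" using c(1) t0 by (simp add: v_def)
    have ct: "0 \<le> c * t" using c(1) t0 by simp
    have "Lsum_norm K q1 q2 u \<le> (c * t) * max (?I v powr (1 / q1)) (?J v powr (1 / q2))"
      unfolding uv by (rule sL(2)[OF v ct])
    also have "\<dots> \<le> (c * t) * max (B1 powr (1 / q1)) (B2 powr (1 / q2))"
    proof (intro mult_left_mono max.mono powr_mono2 ct nonneg)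
      show "?I v \<le> B1" "?J v \<le> B2" using B1 B2 v by blast+
    qed (use q in simp_all)
    finally have "Lsum_norm K q1 q2 u \<le> B * t" by (simp add: B_def mult_ac)
    moreover have "u \<in> Lsum K q1 q2" unfolding uv by (rule sL(1)[OF v ct])
    ultimately show ?thesis by simp
  qed
  have sub: "(X_space A V a0 ainf :: ('a \<Rightarrow> real) set) \<subseteq> Lsum K q1 q2"
    using Xt less_add_one by blast
  \<comment> \<open>The estimate is available for every \<open>t\<close> above the norm; letting
    \<open>t\<close> decrease to the norm includes the case of norm 0.\<close>
  have "Lsum_norm K q1 q2 u \<le> B * X_norm A V u" if u: "u \<in> X_space A V a0 ainf" for u :: "'a \<Rightarrow> real"
  proof (rule tendsto_lowerbound)
    show "(\<lambda>n. B * (X_norm A V u + inverse (real (Suc n)))) \<longlonglongrightarrow> B * X_norm A V u"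
      using tendsto_mult[OF tendsto_const[of B] tendsto_add[OF tendsto_const[of "X_norm A V u"] LIMSEQ_inverse_real_of_nat]]
      by simp
    show "\<forall>\<^sub>F n in sequentially. Lsum_norm K q1 q2 u \<le> B * (X_norm A V u + inverse (real (Suc n)))"
      by (intro always_eventually allI conjunct2[OF Xt[OF u]]) simp
  qed simp
  then show "continuous_embedding (X_space A V a0 ainf :: ('a \<Rightarrow> real) set) (X_norm A V) (Lsum K q1 q2) (Lsum_norm K q1 q2)"
    unfolding continuous_embedding_def using sub by blast
  show "compact_embedding (X_space A V a0 ainf :: ('a \<Rightarrow> real) set) (X_norm A V) (Lsum K q1 q2) (Lsum_norm K q1 q2)"
    unfolding compact_embedding_def
  proof (intro conjI sub allI impI; elim conjE exE)
    fix u :: "nat \<Rightarrow> 'a \<Rightarrow> real" and M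
    assume u: "\<forall>n. u n \<in> X_space A V a0 ainf" and M: "\<forall>n. X_norm A V (u n) \<le> M"
    \<comment> \<open>\<open>M + 1\<close> is strictly above all norms, as the normalisation
      requires.\<close>
    define s where "s = c * (M + 1)"
    have M0: "0 \<le> M" using order_trans[OF normX M[rule_format, of 0]] .
    have s: "0 < s" using c(1) M0 by (simp add: s_def)
    define v where "v n x = u n x / s" for n x
    have v: "admissible A V (v n)" for n
    proof -
      have "X_norm A V (u n) < M + 1" using M[rule_format, of n] by simp
      then show ?thesis unfolding v_def[abs_def] s_def using c(2) u by blast
    qed
    have "\<forall>n. \<exists>f. (AE x in lebesgue. v n x = f (norm x)) \<and> profile_bound DIM('a) A 1 f"
      using v by (simp add: admissible_def)
    from choice[OF this] obtain f
      where f: "\<And>n. AE x in lebesgue. v n x = f n (norm x)" "\<And>n. profile_bound DIM('a) A 1 (f n)"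
      by blast
    have "1 \<le> DIM('a)" using DIM_positive[where 'a = 'a] by linarith
    from profile_bound_subsequence[where f = f, OF A this f(2)]
    obtain r :: "nat \<Rightarrow> nat" and g where r: "strict_mono r" and g: "\<forall>t>0. (\<lambda>n. f (r n) t) \<longlonglongrightarrow> g t"
      by (elim exE conjE)
    have g': "(\<lambda>n. f (r n) t) \<longlonglongrightarrow> g t" if "0 < t" for t using g that by simp
    define w where "w x = g (norm x)" for x :: 'a
    have w: "admissible A V w" and vw: "AE x in lebesgue. (\<lambda>n. v (r n) x) \<longlonglongrightarrow> w x"
      unfolding w_def[abs_def]
      by (rule admissible_limit[where v = "\<lambda>n. v (r n)" and f = "\<lambda>n. f (r n)" and g = g, OF V v f g'];
          assumption)+
    define z where "z n x = (v (r n) x - w x) / 2" for n x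
    have z: "admissible A V (z n)" for n
      unfolding z_def[abs_def] by (rule admissible_half_diff[OF V v w])
    have z0: "AE x in lebesgue. (\<lambda>n. z n x) \<longlonglongrightarrow> 0"
      using vw
    proof eventually_elim
      case (elim x)
      have "(\<lambda>n. (v (r n) x - w x) / 2) \<longlonglongrightarrow> (w x - w x) / 2" by (intro tendsto_intros elim) simp
      then show ?case by (simp add: z_def)
    qed
    \<comment> \<open>The factor \<open>2 * s\<close> undoes both the normalisation by
      \<open>s\<close> and the halving in \<open>z\<close>.\<close>
    have uz: "(\<lambda>x. u (r n) x - s * w x) = (\<lambda>x. (2 * s) * z n x)" for n
      using s by (simp add: z_def v_def fun_eq_iff field_simps)
    have I0: "(\<lambda>n. ?I (z n)) \<longlonglongrightarrow> 0" and J0: "(\<lambda>n. ?J (z n)) \<longlonglongrightarrow> 0"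
      by (rule small_tails_tendsto[OF A K q(1) S tails(1) z z0] small_tails_tendsto[OF A K q(2) S' tails(2) z z0])+
    have "(\<lambda>n. (2 * s) * max (?I (z n) powr (1 / q1)) (?J (z n) powr (1 / q2)))
        \<longlonglongrightarrow> (2 * s) * max (0 powr (1 / q1)) (0 powr (1 / q2))"
      using q by (intro tendsto_intros tendsto_max tendsto_powr' I0 J0 disjI2 conjI always_eventually allI nonneg) auto
    then have lim: "(\<lambda>n. (2 * s) * max (?I (z n) powr (1 / q1)) (?J (z n) powr (1 / q2))) \<longlonglongrightarrow> 0"
      using q by simp
    have "(\<lambda>n. Lsum_norm K q1 q2 (\<lambda>x. u (r n) x - s * w x)) \<longlonglongrightarrow> 0"
      unfolding uz
    proof (rule tendsto_sandwich[OF _ _ tendsto_const lim]; intro always_eventually allI)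
      show "0 \<le> Lsum_norm K q1 q2 (\<lambda>x. 2 * s * z n x)" for n
        using s by (intro Lsum_norm_nonneg sL(1)[OF z]) simp
      show "Lsum_norm K q1 q2 (\<lambda>x. 2 * s * z n x) \<le> 2 * s * max (?I (z n) powr (1 / q1)) (?J (z n) powr (1 / q2))" for n
        using s by (intro sL(2)[OF z]) simp
    qed
    moreover have "(\<lambda>x. s * w x) \<in> Lsum K q1 q2" using s by (intro sL(1)[OF w]) simp
    ultimately show "\<exists>r v. strict_mono (r :: nat \<Rightarrow> nat) \<and> v \<in> Lsum K q1 q2 \<and>
        (\<lambda>n. Lsum_norm K q1 q2 (\<lambda>x. u (r n) x - v x)) \<longlonglongrightarrow> 0"
      using r by blast
  qed
qed

theorem theorem4p6:
  fixes A V K :: "real \<Rightarrow> real"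
    and a0 ainf R1 R2 \<alpha>0 \<alpha>inf \<beta>0 \<beta>inf q1 q2 :: real
  assumes "DIM('a::euclidean_space) \<ge> 3"
    and "hyp_A DIM('a) A a0 ainf"
    and "hyp_V V"
    and "hyp_K DIM('a) a0 ainf K"
    and "R1 > 0" and "R2 > 0"
    and "\<beta>0 \<in> {0..1}" and "\<beta>inf \<in> {0..1}"
    and "esssup (lebesgue_on {x::'a. norm x < R1}) (\<lambda>x. quotient_KV K V \<alpha>0 \<beta>0 (norm x)) < \<infinity>"
    and "esssup (lebesgue_on {x::'a. norm x \<ge> R2}) (\<lambda>x. quotient_KV K V \<alpha>inf \<beta>inf (norm x)) < \<infinity>"
    and "q1 \<in> {max 1 (2 * \<beta>0) <..< q_star DIM('a) a0 \<alpha>0 \<beta>0}"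
    and "q2 \<in> {max 1 (max (2 * \<beta>inf) (q_star DIM('a) ainf \<alpha>inf \<beta>inf)) <..}"
  shows "continuous_embedding
           (X_space A V a0 ainf :: ('a \<Rightarrow> real) set) (X_norm A V)
           (Lsum K q1 q2) (Lsum_norm K q1 q2) \<and>
         compact_embedding
           (X_space A V a0 ainf :: ('a \<Rightarrow> real) set) (X_norm A V)
           (Lsum K q1 q2) (Lsum_norm K q1 q2)"
proof -
  have K: "0 < K r" if "0 < r" for r using assms(4) that by (simp add: hyp_K_def)
  have S: "{x::'a. norm x < R1} \<in> sets lebesgue" by (simp add: norm_less_eq_ball)
  have "small_tails A V K q1 {x::'a. norm x < R1}"
  proof (rule esssup_quotient_bound[OF S K assms(9)])
    fix M assume "0 \<le> M" "AE x in lebesgue. x \<in> {x::'a. norm x < R1} \<longrightarrow>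
      K (norm x) \<le> M * (norm x powr \<alpha>0 * (if \<beta>0 = 0 then 1 else V (norm x) powr \<beta>0))"
    then show ?thesis
      using assms(7,11) by (intro small_tails_ball[OF assms(2-5)]) auto
  qed simp
  \<comment> \<open>The exterior region begins at the cut \<open>R1\<close>, although the hypothesis
    on \<open>K\<close> begins at \<open>R2\<close>; \<open>small_tails_outside\<close> allows the
    two radii to differ.\<close>
  moreover have "small_tails A V K q2 {x::'a. R1 \<le> norm x}"
  proof (rule esssup_quotient_bound[OF norm_ge_sets K assms(10)])
    fix M assume "0 \<le> M" "AE x in lebesgue. x \<in> {x::'a. R2 \<le> norm x} \<longrightarrow>
      K (norm x) \<le> M * (norm x powr \<alpha>inf * (if \<beta>inf = 0 then 1 else V (norm x) powr \<beta>inf))"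
    then show ?thesis
      using assms(8,12) by (intro small_tails_outside[OF assms(2-6)]) auto
  qed simp
  moreover have "{x::'a. R1 \<le> norm x} = - {x. norm x < R1}" by auto
  ultimately show ?thesis
    using admissible_embeddings[OF assms(2-4) _ _ S, of q1 q2] assms(11,12) by simp
qed

end
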